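(* Let $(X,\mathscr{T},\mathcal{X},\mu)$ be a locally compact Polish Radon-measure space such that $\mu$ has full support, and let $(E,\mathscr{D}(E))$ be a regular Dirichlet form on $L^2(\mu)$. Assume that $(E,\mathscr{D}(E))$ admits - an ergodic decomposition $\zeta\mapsto (E^1_\zeta,\mathscr{D}(E^1_\zeta))$ indexed by $(Z^1,\mathcal{Z}^1,\nu^1)$, and - an ergodic decomposition $\eta\mapsto (E^2_\eta,\mathscr{D}(E^2_\eta))$ indexed by $(Z^2,\mathcal{Z}^2,\nu^2)$. Then there exist an almost isomorphism $\varrho\colon (Z^1,\mathcal{Z}^1,\mathcal{N}^{\nu^1})\to (Z^2,\mathcal{Z}^2,\mathcal{N}^{\nu^2})$ and a $\mathcal{Z}^2$-measurable function $h\colon Z^2\to(0,\infty)$ such that $\varrho_\sharp\nu^1\sim\nu^2$ and $$E^1_\zeta = h(\varrho(\zeta))\, E^2_{\varrho(\zeta)}\qquad\text{for $\nu^1$-a.e. }\zeta\in Z^1 .$$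
   Context: **Measure spaces.** For a measure space $(X,\mathcal{X},\mu)$, $\mathcal{X}^\mu$ and $\hat\mu$ denote the completed $\sigma$-algebra and measure, $\mathcal{N}^\mu$ is the $\sigma$-ideal of $\mu$-negligible sets, and "$\mu$-measurable" means $\mathcal{X}^\mu$-measurable. $f_\sharp\mu$ is the push-forward; $\mu_1\sim\mu_2$ means mutual absolute continuity. A measurable space is *separable* if its $\sigma$-algebra contains all singletons; it is *countably generated* if its $\sigma$-algebra is generated by a countable family. A Hausdorff topological measure space $(X,\mathscr{T},\mathcal{X},\mu)$ is a *Radon-measure space* if $\mathcal{X}^\mu$ is the $\mu$-completion of the Borel $\sigma$-algebra and $\hat\mu$ is locally finite and inner regular with respect to compact sets. Here $\mathcal{X}$ is the Borel $\sigma$-algebra of $(X,\mathscr{T})$. **Almost isomorphism.** $\varrho$ is an almost isomorphism $(Z^1,\mathcal{Z}^1,\mathcal{N}^{\nu^1})\to(Z^2,\mathcal{Z}^2,\mathcal{N}^{\nu^2})$ if there are $N^i\in\mathcal{N}^{\nu^i}$ such that $\varrho$ restricts to a bijection $Z^1\setminus N^1\to Z^2\setminus N^2$ which identifies the traces of the $\sigma$-algebras $\{A\cup N: A\in\mathcal{Z}^i,N\in\mathcal{N}^{\nu^i}\}$ and the traces of the $\sigma$-ideals $\mathcal{N}^{\nu^i}$. (It need not preserve the measures.) **Direct integrals of Hilbert spaces.** All Hilbert spaces are real and separable. Let $(Z,\mathcal{Z},\nu)$ be $\sigma$-finite and $(H_\zeta)_{\zeta\in Z}$ a family of Hilbert spaces.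 $\zeta\mapsto H_\zeta$ is a *$\nu$-measurable field of Hilbert spaces with underlying space $S$* if $S$ is a linear subspace of $\prod_\zeta H_\zeta$ such that: (a) $\zeta\mapsto\|u_\zeta\|$ is $\nu$-measurable for all $u\in S$; (b) if $v\in\prod_\zeta H_\zeta$ and $\zeta\mapsto\langle u_\zeta,v_\zeta\rangle$ is $\nu$-measurable for all $u\in S$, then $v\in S$; (c) there is a sequence $(u_n)\subset S$ with $(u_{n,\zeta})_n$ total (i.e. with dense linear span) in $H_\zeta$ for every $\zeta$. Elements of $S$ are the $\nu$-measurable vector fields. A family satisfying (a) and (c) is contained in exactly one such $S$, said to be generated by it. The *direct integral* $H=\int_Z^\oplus H_\zeta\,d\nu(\zeta)$ is the Hilbert space of classes, modulo $\nu$-a.e. equality, of $u\in S$ with $\|u\|^2=\int_Z\|u_\zeta\|^2d\nu(\zeta)<\infty$. **Direct integrals of quadratic forms.** A quadratic form on $H$ is a map $Q\colon H\to[0,\infty]$ satisfying the parallelogram identity, with dense domain $\mathscr{D}(Q)=\{Q<\infty\}$; the same letter denotes the associated bilinear form, and $Q_1(u)=Q(u)+\|u\|^2$. $\mathscr{D}(Q)_1$ denotes the domain of a closed form with the Hilbert norm $Q_1^{1/2}$. For $(Z,\mathcal{Z},\nu)$ $\sigma$-finite countably generated, closed forms $\zeta\mapsto(Q_\zeta,\mathscr{D}(Q_\zeta))$ on $H_\zeta$ are a *$\nu$-measurable field of quadratic forms* if $\zeta\mapsto H_\zeta$ and $\zeta\mapsto\mathscr{D}(Q_\zeta)_1$ are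 $\nu$-measurable fields of Hilbert spaces with underlying spaces $S_H$ and $S_Q$, and $S_Q\subset S_H$ is a linear subspace. Their *direct integral* $Q=\int^\oplus_Z Q_\zeta\,d\nu(\zeta)$ has domain the classes in $H$ of $u\in S_Q$ with $\int_Z Q_{\zeta,1}(u_\zeta)\,d\nu<\infty$, and $Q(u,v)=\int_Z Q_\zeta(u_\zeta,v_\zeta)\,d\nu(\zeta)$. **Disintegrations.** A *pseudo-disintegration* of $\mu$ over $\nu$ is a family $(\mu_\zeta)_{\zeta\in Z}$ of non-zero measures on $(X,\mathcal{X})$ with $\zeta\mapsto\mu_\zeta A$ $\nu$-measurable and $\mu A=\int_Z\mu_\zeta A\,d\nu(\zeta)$ for all $A\in\mathcal{X}$. It is *separated* if there are pairwise disjoint sets $A_\zeta\in\mathcal{X}^\mu$ with $A_\zeta$ $\mu_\zeta$-conegligible for $\nu$-a.e. $\zeta$. For measurable $s\colon X\to Z$ it is *strongly consistent with $s$* if $\mu(A\cap s^{-1}(B))=\int_B\mu_\zeta A\,d\nu(\zeta)$ for all $A\in\mathcal{X}$, $B\in\mathcal{Z}$, and $s^{-1}(\zeta)$ is $\mu_\zeta$-conegligible for $\nu$-a.e. $\zeta$. **$L^2$ as a direct integral.** Let $\mathcal{L}^2(\mu)$ be the space of $\mu$-measurable square-integrable functions (not classes). For $f\in\mathcal{L}^2(\mu)$ let $\delta(f)_\zeta$ be the class of $f$ in $L^2(\mu_\zeta)$ if $f\in\mathcal{L}^2(\mu_\zeta)$, and $0$ otherwise. If $\mathcal{A}\subset\mathcal{L}^2(\mu)$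 is a linear subspace whose classes are dense in $L^2(\mu)$, let $S_{\mathcal{A}}$ be the space of $\nu$-measurable vector fields generated by $\delta(\mathcal{A})$. When $(\mu_\zeta)$ is separated, $[f]\mapsto[\delta(f)]$ is a unitary order-preserving identification $L^2(\mu)=\int_Z^\oplus L^2(\mu_\zeta)\,d\nu(\zeta)$. **Dirichlet forms.** A *Dirichlet form* on $L^2(m)$ is a closed quadratic form with $f\in\mathscr{D}(E)\Rightarrow f^+\wedge 1\in\mathscr{D}(E)$ and $E(f^+\wedge1)\le E(f)$. For $m$ a Borel measure on a locally compact $(X,\mathscr{T})$, it is *regular* if $\mathscr{D}(E)\cap C_0(X)$ is $E_1^{1/2}$-dense in $\mathscr{D}(E)$ and uniformly dense in $C_0(X)$ (continuous functions vanishing at infinity). With $T_t$ the associated semigroup, an $m$-measurable $A$ is *$E$-invariant* if $T_t(1_Af)=1_AT_tf$ $m$-a.e. for all $f\in L^2(m)$, $t>0$; $E$ is *irreducible* if each invariant set is $m$-negligible or $m$-conegligible. $E$ is a *direct integral of Dirichlet forms* $\zeta\mapsto E_\zeta$ if it is their direct integral as quadratic forms, each $E_\zeta$ is a Dirichlet form on $L^2(\mu_\zeta)$ with $(\mu_\zeta)$ a separated pseudo-disintegration of $\mu$, and (compatibility) the space $S_Q$ underlying $\zeta\mapsto\mathscr{D}(E_\zeta)_1$ is of the form $S_{\mathcal{A}}$ (i.e. generated by $\delta(\mathcal{A})$) for some linear subspace $\mathcal{A}\subset\mathcal{L}^2(\mu)$ whose classes are dense in $L^2(\mu)$ and with $\mathcal{A}\subset\mathscr{D}(E)$.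 **Ergodic decomposition.** A regular Dirichlet form $(E,\mathscr{D}(E))$ on $L^2(\mu)$ admits an *ergodic decomposition $\zeta\mapsto(E_\zeta,\mathscr{D}(E_\zeta))$ indexed by $(Z,\mathcal{Z},\nu)$* if there exist: (i) a separable countably generated probability space $(Z,\mathcal{Z},\nu)$ and a measurable surjective map $s\colon(X,\mathcal{X})\to(Z,\mathcal{Z})$; (ii) a pseudo-disintegration $(\mu_\zeta)_{\zeta\in Z}$ of $\mu$ over $\nu$, strongly consistent with $s$, such that for $\nu$-a.e. $\zeta$ the fibre $s^{-1}(\zeta)$, with the subspace topology and the trace $\sigma$-algebra inherited from $(X,\mathscr{T},\mathcal{X}^\mu)$, and with $\hat\mu_\zeta$, is a Radon-measure space; (iii) a $\nu$-measurable field $\zeta\mapsto(E_\zeta,\mathscr{D}(E_\zeta))$ of regular irreducible Dirichlet forms on $L^2(\mu_\zeta)$; such that $L^2(\mu)=\int_Z^\oplus L^2(\mu_\zeta)\,d\nu(\zeta)$ and $E=\int_Z^\oplus E_\zeta\,d\nu(\zeta)$ as a direct integral of Dirichlet forms. Equality of quadratic forms includes equality of domains. *)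

theory Defs
  imports "HOL-Probability.Probability"
begin

section \<open>Hilbert spaces with explicit carrier\<close>

text \<open>A field of Hilbert spaces may have a different space over every point of the index set, so
  the Hilbert space structure is a value and not a type class. All spaces are real.\<close>

record 'a hspace =
  hcarrier :: "'a set"
  hzero :: 'a
  hadd :: "'a \<Rightarrow> 'a \<Rightarrow> 'a"
  hscale :: "real \<Rightarrow> 'a \<Rightarrow> 'a"
  hinner :: "'a \<Rightarrow> 'a \<Rightarrow> real"

definition hdiff :: "'a hspace \<Rightarrow> 'a \<Rightarrow> 'a \<Rightarrow> 'a" where
  "hdiff H x y = hadd H x (hscale H (-1) y)"

definition hnorm :: "'a hspace \<Rightarrow> 'a \<Rightarrow> real" where
  "hnorm H x = sqrt (hinner H x x)"

definition hdist :: "'a hspace \<Rightarrow> 'a \<Rightarrow> 'a \<Rightarrow> real" where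
  "hdist H x y = hnorm H (hdiff H x y)"

definition hdense :: "'a hspace \<Rightarrow> 'a set \<Rightarrow> 'a set \<Rightarrow> bool" where
  "hdense H A B \<longleftrightarrow> A \<subseteq> B \<and> (\<forall>x\<in>B. \<forall>e>0. \<exists>y\<in>A. hdist H x y < e)"

locale separable_hilbert_space =
  fixes H :: "'a hspace"
  assumes zero_closed: "hzero H \<in> hcarrier H"
    and add_closed: "\<lbrakk>x \<in> hcarrier H; y \<in> hcarrier H\<rbrakk> \<Longrightarrow> hadd H x y \<in> hcarrier H"
    and scale_closed: "x \<in> hcarrier H \<Longrightarrow> hscale H c x \<in> hcarrier H"
    and add_assoc: "\<lbrakk>x \<in> hcarrier H; y \<in> hcarrier H; z \<in> hcarrier H\<rbrakk>
          \<Longrightarrow> hadd H (hadd H x y) z = hadd H x (hadd H y z)"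
    and add_commute: "\<lbrakk>x \<in> hcarrier H; y \<in> hcarrier H\<rbrakk> \<Longrightarrow> hadd H x y = hadd H y x"
    and add_zero: "x \<in> hcarrier H \<Longrightarrow> hadd H x (hzero H) = x"
    and diff_self: "x \<in> hcarrier H \<Longrightarrow> hdiff H x x = hzero H"
    and scale_add: "\<lbrakk>x \<in> hcarrier H; y \<in> hcarrier H\<rbrakk>
          \<Longrightarrow> hscale H c (hadd H x y) = hadd H (hscale H c x) (hscale H c y)"
    and add_scale: "x \<in> hcarrier H \<Longrightarrow> hscale H (c + d) x = hadd H (hscale H c x) (hscale H d x)"
    and scale_scale: "x \<in> hcarrier H \<Longrightarrow> hscale H c (hscale H d x) = hscale H (c * d) x"
    and scale_one: "x \<in> hcarrier H \<Longrightarrow> hscale H 1 x = x"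
    and inner_commute: "\<lbrakk>x \<in> hcarrier H; y \<in> hcarrier H\<rbrakk> \<Longrightarrow> hinner H x y = hinner H y x"
    and inner_add: "\<lbrakk>x \<in> hcarrier H; y \<in> hcarrier H; z \<in> hcarrier H\<rbrakk>
          \<Longrightarrow> hinner H (hadd H x y) z = hinner H x z + hinner H y z"
    and inner_scale: "\<lbrakk>x \<in> hcarrier H; y \<in> hcarrier H\<rbrakk>
          \<Longrightarrow> hinner H (hscale H c x) y = c * hinner H x y"
    and inner_nonneg: "x \<in> hcarrier H \<Longrightarrow> 0 \<le> hinner H x x"
    and inner_definite: "\<lbrakk>x \<in> hcarrier H; hinner H x x = 0\<rbrakk> \<Longrightarrow> x = hzero H"
    and complete: "\<lbrakk>\<And>n. X n \<in> hcarrier H; \<And>e. 0 < e \<Longrightarrow> \<exists>N. \<forall>i\<ge>N. \<forall>j\<ge>N. hdist H (X i) (X j) < e\<rbrakk>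
          \<Longrightarrow> \<exists>x\<in>hcarrier H. (\<lambda>n. hdist H (X n) x) \<longlonglongrightarrow> 0"
    and separable: "\<exists>D. countable D \<and> hdense H D (hcarrier H)"

definition hsubspace :: "'a hspace \<Rightarrow> 'a set \<Rightarrow> bool" where
  "hsubspace H W \<longleftrightarrow> W \<subseteq> hcarrier H \<and> hzero H \<in> W \<and>
     (\<forall>x\<in>W. \<forall>y\<in>W. hadd H x y \<in> W) \<and> (\<forall>c. \<forall>x\<in>W. hscale H c x \<in> W)"

definition hspan :: "'a hspace \<Rightarrow> 'a set \<Rightarrow> 'a set" where
  "hspan H A = \<Inter>{W. hsubspace H W \<and> A \<subseteq> W}"

definition htotal :: "'a hspace \<Rightarrow> 'a set \<Rightarrow> bool" where
  "htotal H A \<longleftrightarrow> A \<subseteq> hcarrier H \<and> hdense H (hspan H A) (hcarrier H)"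

definition hlinear :: "'a hspace \<Rightarrow> 'b hspace \<Rightarrow> ('a \<Rightarrow> 'b) \<Rightarrow> bool" where
  "hlinear H K P \<longleftrightarrow> P \<in> hcarrier H \<rightarrow> hcarrier K \<and>
     (\<forall>x\<in>hcarrier H. \<forall>y\<in>hcarrier H. P (hadd H x y) = hadd K (P x) (P y)) \<and>
     (\<forall>c. \<forall>x\<in>hcarrier H. P (hscale H c x) = hscale K c (P x))"

definition hunitary :: "'a hspace \<Rightarrow> 'b hspace \<Rightarrow> ('a \<Rightarrow> 'b) \<Rightarrow> bool" where
  "hunitary H K P \<longleftrightarrow> hlinear H K P \<and> bij_betw P (hcarrier H) (hcarrier K) \<and>
     (\<forall>x\<in>hcarrier H. \<forall>y\<in>hcarrier H. hinner K (P x) (P y) = hinner H x y)"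


section \<open>The Hilbert space of square-integrable functions\<close>

definition aeclass :: "'i measure \<Rightarrow> ('i \<Rightarrow> 'a) set \<Rightarrow> ('i \<Rightarrow> 'a) \<Rightarrow> ('i \<Rightarrow> 'a) set" where
  "aeclass M V f = {g \<in> V. AE x in M. f x = g x}"

definition rep :: "'a set \<Rightarrow> 'a" where
  "rep U = (SOME u. u \<in> U)"

definition lspace :: "'x measure \<Rightarrow> ('x \<Rightarrow> real) set" where
  "lspace M = {f \<in> borel_measurable (completion M). integrable (completion M) (\<lambda>x. (f x)\<^sup>2)}"

abbreviation lclass :: "'x measure \<Rightarrow> ('x \<Rightarrow> real) \<Rightarrow> ('x \<Rightarrow> real) set" where
  "lclass M \<equiv> aeclass M (lspace M)"

definition L2 :: "'x measure \<Rightarrow> ('x \<Rightarrow> real) set hspace" where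
  "L2 M = \<lparr> hcarrier = lclass M ` lspace M,
            hzero = lclass M (\<lambda>x. 0),
            hadd = (\<lambda>U V. lclass M (\<lambda>x. rep U x + rep V x)),
            hscale = (\<lambda>c U. lclass M (\<lambda>x. c * rep U x)),
            hinner = (\<lambda>U V. \<integral>x. rep U x * rep V x \<partial>completion M) \<rparr>"


section \<open>Measurable fields of Hilbert spaces and direct integrals\<close>

definition countably_generated_measure :: "'z measure \<Rightarrow> bool" where
  "countably_generated_measure M \<longleftrightarrow>
     (\<exists>G. countable G \<and> G \<subseteq> Pow (space M) \<and> sets M = sigma_sets (space M) G)"

definition separable_measure :: "'z measure \<Rightarrow> bool" where
  "separable_measure M \<longleftrightarrow> (\<forall>z\<in>space M. {z} \<in> sets M)"

definition field_linear_subspace ::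
    "'z measure \<Rightarrow> ('z \<Rightarrow> 'a hspace) \<Rightarrow> ('z \<Rightarrow> 'a) set \<Rightarrow> bool" where
  "field_linear_subspace \<nu> H S \<longleftrightarrow>
     S \<subseteq> (\<Pi>\<^sub>E \<zeta>\<in>space \<nu>. hcarrier (H \<zeta>)) \<and>
     (\<lambda>\<zeta>\<in>space \<nu>. hzero (H \<zeta>)) \<in> S \<and>
     (\<forall>u\<in>S. \<forall>v\<in>S. (\<lambda>\<zeta>\<in>space \<nu>. hadd (H \<zeta>) (u \<zeta>) (v \<zeta>)) \<in> S) \<and>
     (\<forall>c. \<forall>u\<in>S. (\<lambda>\<zeta>\<in>space \<nu>. hscale (H \<zeta>) c (u \<zeta>)) \<in> S)"

definition measurable_norms ::
    "'z measure \<Rightarrow> ('z \<Rightarrow> 'a hspace) \<Rightarrow> ('z \<Rightarrow> 'a) set \<Rightarrow> bool" where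
  "measurable_norms \<nu> H F \<longleftrightarrow>
     (\<forall>u\<in>F. (\<lambda>\<zeta>. hnorm (H \<zeta>) (u \<zeta>)) \<in> borel_measurable (completion \<nu>))"

definition has_total_sequence ::
    "'z measure \<Rightarrow> ('z \<Rightarrow> 'a hspace) \<Rightarrow> ('z \<Rightarrow> 'a) set \<Rightarrow> bool" where
  "has_total_sequence \<nu> H F \<longleftrightarrow>
     (\<exists>u :: nat \<Rightarrow> 'z \<Rightarrow> 'a. range u \<subseteq> F \<and> (\<forall>\<zeta>\<in>space \<nu>. htotal (H \<zeta>) (range (\<lambda>n. u n \<zeta>))))"

definition measurable_hilbert_field ::
    "'z measure \<Rightarrow> ('z \<Rightarrow> 'a hspace) \<Rightarrow> ('z \<Rightarrow> 'a) set \<Rightarrow> bool" where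
  "measurable_hilbert_field \<nu> H S \<longleftrightarrow>
     sigma_finite_measure \<nu> \<and>
     (\<forall>\<zeta>\<in>space \<nu>. separable_hilbert_space (H \<zeta>)) \<and>
     field_linear_subspace \<nu> H S \<and>
     measurable_norms \<nu> H S \<and>
     (\<forall>v \<in> (\<Pi>\<^sub>E \<zeta>\<in>space \<nu>. hcarrier (H \<zeta>)).
        (\<forall>u\<in>S. (\<lambda>\<zeta>. hinner (H \<zeta>) (u \<zeta>) (v \<zeta>)) \<in> borel_measurable (completion \<nu>)) \<longrightarrow> v \<in> S) \<and>
     has_total_sequence \<nu> H S"

definition generates_field ::
    "'z measure \<Rightarrow> ('z \<Rightarrow> 'a hspace) \<Rightarrow> ('z \<Rightarrow> 'a) set \<Rightarrow> ('z \<Rightarrow> 'a) set \<Rightarrow> bool" where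
  "generates_field \<nu> H F S \<longleftrightarrow>
     measurable_norms \<nu> H F \<and> has_total_sequence \<nu> H F \<and> measurable_hilbert_field \<nu> H S \<and> F \<subseteq> S"

definition sq_integrable_fields ::
    "'z measure \<Rightarrow> ('z \<Rightarrow> 'a hspace) \<Rightarrow> ('z \<Rightarrow> 'a) set \<Rightarrow> ('z \<Rightarrow> 'a) set" where
  "sq_integrable_fields \<nu> H S =
     {u \<in> S. (\<integral>\<^sup>+\<zeta>. ennreal ((hnorm (H \<zeta>) (u \<zeta>))\<^sup>2) \<partial>completion \<nu>) < \<infinity>}"

abbreviation fclass :: "'z measure \<Rightarrow> ('z \<Rightarrow> 'a hspace) \<Rightarrow> ('z \<Rightarrow> 'a) set \<Rightarrow> ('z \<Rightarrow> 'a) \<Rightarrow> ('z \<Rightarrow> 'a) set"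
  where "fclass \<nu> H S \<equiv> aeclass \<nu> (sq_integrable_fields \<nu> H S)"

definition direct_integral ::
    "'z measure \<Rightarrow> ('z \<Rightarrow> 'a hspace) \<Rightarrow> ('z \<Rightarrow> 'a) set \<Rightarrow> ('z \<Rightarrow> 'a) set hspace" where
  "direct_integral \<nu> H S =
     \<lparr> hcarrier = fclass \<nu> H S ` sq_integrable_fields \<nu> H S,
       hzero = fclass \<nu> H S (\<lambda>\<zeta>\<in>space \<nu>. hzero (H \<zeta>)),
       hadd = (\<lambda>U V. fclass \<nu> H S (\<lambda>\<zeta>\<in>space \<nu>. hadd (H \<zeta>) (rep U \<zeta>) (rep V \<zeta>))),
       hscale = (\<lambda>c U. fclass \<nu> H S (\<lambda>\<zeta>\<in>space \<nu>. hscale (H \<zeta>) c (rep U \<zeta>))),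
       hinner = (\<lambda>U V. \<integral>\<zeta>. hinner (H \<zeta>) (rep U \<zeta>) (rep V \<zeta>) \<partial>completion \<nu>) \<rparr>"


section \<open>Quadratic forms and their direct integrals\<close>

text \<open>A form on \<open>H\<close> is a map to \<open>[0,\<infinity>]\<close>; only its values on the carrier of \<open>H\<close> matter.\<close>

definition qdom :: "'a hspace \<Rightarrow> ('a \<Rightarrow> ennreal) \<Rightarrow> 'a set" where
  "qdom H Q = {u \<in> hcarrier H. Q u < \<infinity>}"

definition quadratic_form :: "'a hspace \<Rightarrow> ('a \<Rightarrow> ennreal) \<Rightarrow> bool" where
  "quadratic_form H Q \<longleftrightarrow>
     (\<forall>u\<in>hcarrier H. \<forall>v\<in>hcarrier H. Q (hadd H u v) + Q (hdiff H u v) = 2 * Q u + 2 * Q v) \<and>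
     hdense H (qdom H Q) (hcarrier H)"

definition qbil :: "'a hspace \<Rightarrow> ('a \<Rightarrow> ennreal) \<Rightarrow> 'a \<Rightarrow> 'a \<Rightarrow> real" where
  "qbil H Q u v = (enn2real (Q (hadd H u v)) - enn2real (Q (hdiff H u v))) / 4"

text \<open>The domain of a form with the inner product belonging to \<open>Q\<^sub>1\<close>.\<close>

definition form_space :: "'a hspace \<Rightarrow> ('a \<Rightarrow> ennreal) \<Rightarrow> 'a hspace" where
  "form_space H Q =
     \<lparr> hcarrier = qdom H Q, hzero = hzero H, hadd = hadd H, hscale = hscale H,
       hinner = (\<lambda>u v. qbil H Q u v + hinner H u v) \<rparr>"

text \<open>The parallelogram identity alone does not give \<open>Q (c u) = c\<^sup>2 Q u\<close> for real \<open>c\<close>; for closed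
  forms this is part of the domain being a Hilbert space.\<close>

definition closed_form :: "'a hspace \<Rightarrow> ('a \<Rightarrow> ennreal) \<Rightarrow> bool" where
  "closed_form H Q \<longleftrightarrow> quadratic_form H Q \<and> separable_hilbert_space (form_space H Q)"

definition measurable_form_field ::
    "'z measure \<Rightarrow> ('z \<Rightarrow> 'a hspace) \<Rightarrow> ('z \<Rightarrow> 'a \<Rightarrow> ennreal) \<Rightarrow> ('z \<Rightarrow> 'a) set \<Rightarrow> ('z \<Rightarrow> 'a) set \<Rightarrow> bool"
  where
  "measurable_form_field \<nu> H Q SH SQ \<longleftrightarrow>
     sigma_finite_measure \<nu> \<and> countably_generated_measure \<nu> \<and>
     (\<forall>\<zeta>\<in>space \<nu>. closed_form (H \<zeta>) (Q \<zeta>)) \<and>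
     measurable_hilbert_field \<nu> H SH \<and>
     measurable_hilbert_field \<nu> (\<lambda>\<zeta>. form_space (H \<zeta>) (Q \<zeta>)) SQ \<and>
     SQ \<subseteq> SH"

text \<open>The integral does not depend on the choice of \<open>u\<close> in the class \<open>U\<close>, so the infimum is the
  common value if \<open>U\<close> is in the domain; otherwise it is an infimum over the empty set, i.e. \<open>\<infinity>\<close>.\<close>

definition direct_integral_form ::
    "'z measure \<Rightarrow> ('z \<Rightarrow> 'a hspace) \<Rightarrow> ('z \<Rightarrow> 'a \<Rightarrow> ennreal) \<Rightarrow> ('z \<Rightarrow> 'a) set \<Rightarrow> ('z \<Rightarrow> 'a) set \<Rightarrow> ennreal"
  where
  "direct_integral_form \<nu> H Q SQ U =
     (INF u \<in> {u \<in> SQ \<inter> U.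
        (\<integral>\<^sup>+\<zeta>. Q \<zeta> (u \<zeta>) + ennreal ((hnorm (H \<zeta>) (u \<zeta>))\<^sup>2) \<partial>completion \<nu>) < \<infinity>}.
        \<integral>\<^sup>+\<zeta>. Q \<zeta> (u \<zeta>) \<partial>completion \<nu>)"


section \<open>Semigroups and Dirichlet forms\<close>

text \<open>\<open>P\<close> is the strongly continuous contraction semigroup generated by \<open>-A\<close>, where \<open>A\<close> is the
  operator of the form: \<open>u \<in> D(A)\<close> and \<open>A u = w\<close> iff \<open>u \<in> D(Q)\<close> and \<open>Q(u,v) = \<langle>w,v\<rangle>\<close> for all
  \<open>v \<in> D(Q)\<close>. A closed form has exactly one such semigroup.\<close>

definition associated_semigroup ::
    "'a hspace \<Rightarrow> ('a \<Rightarrow> ennreal) \<Rightarrow> (real \<Rightarrow> 'a \<Rightarrow> 'a) \<Rightarrow> bool" where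
  "associated_semigroup H Q P \<longleftrightarrow>
     (\<forall>t\<ge>0. hlinear H H (P t)) \<and>
     (\<forall>t\<ge>0. \<forall>u\<in>hcarrier H. hnorm H (P t u) \<le> hnorm H u) \<and>
     (\<forall>u\<in>hcarrier H. P 0 u = u) \<and>
     (\<forall>s\<ge>0. \<forall>t\<ge>0. \<forall>u\<in>hcarrier H. P (s + t) u = P s (P t u)) \<and>
     (\<forall>u\<in>hcarrier H. ((\<lambda>t. hdist H (P t u) u) \<longlongrightarrow> 0) (at_right 0)) \<and>
     (\<forall>u\<in>hcarrier H. \<forall>w\<in>hcarrier H.
        ((\<lambda>t. hdist H (hscale H (1 / t) (hdiff H u (P t u))) w) \<longlongrightarrow> 0) (at_right 0) \<longleftrightarrow>
        (u \<in> qdom H Q \<and> (\<forall>v\<in>qdom H Q. qbil H Q u v = hinner H w v)))"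

definition dirichlet_form :: "'x measure \<Rightarrow> (('x \<Rightarrow> real) set \<Rightarrow> ennreal) \<Rightarrow> bool" where
  "dirichlet_form M E \<longleftrightarrow>
     closed_form (L2 M) E \<and>
     (\<forall>f\<in>lspace M. lclass M f \<in> qdom (L2 M) E \<longrightarrow>
        lclass M (\<lambda>x. min (max (f x) 0) 1) \<in> qdom (L2 M) E \<and>
        E (lclass M (\<lambda>x. min (max (f x) 0) 1)) \<le> E (lclass M f))"

definition mult_indicator :: "'x measure \<Rightarrow> 'x set \<Rightarrow> ('x \<Rightarrow> real) set \<Rightarrow> ('x \<Rightarrow> real) set" where
  "mult_indicator M A U = lclass M (\<lambda>x. indicator A x * rep U x)"

definition invariant_set :: "'x measure \<Rightarrow> (('x \<Rightarrow> real) set \<Rightarrow> ennreal) \<Rightarrow> 'x set \<Rightarrow> bool" where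
  "invariant_set M E A \<longleftrightarrow>
     A \<in> sets (completion M) \<and>
     (\<forall>P. associated_semigroup (L2 M) E P \<longrightarrow>
        (\<forall>U\<in>hcarrier (L2 M). \<forall>t>0. P t (mult_indicator M A U) = mult_indicator M A (P t U)))"

abbreviation negligible_sets :: "'x measure \<Rightarrow> 'x set set" where
  "negligible_sets M \<equiv> null_sets (completion M)"

definition conegligible :: "'x measure \<Rightarrow> 'x set \<Rightarrow> bool" where
  "conegligible M A \<longleftrightarrow> space M - A \<in> negligible_sets M"

definition irreducible_form :: "'x measure \<Rightarrow> (('x \<Rightarrow> real) set \<Rightarrow> ennreal) \<Rightarrow> bool" where
  "irreducible_form M E \<longleftrightarrow>
     (\<forall>A. invariant_set M E A \<longrightarrow> A \<in> negligible_sets M \<or> conegligible M A)"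

definition borel_of :: "'x topology \<Rightarrow> 'x measure" where
  "borel_of T = sigma (topspace T) {U. openin T U}"

definition C0 :: "'x topology \<Rightarrow> ('x \<Rightarrow> real) set" where
  "C0 T = {f. continuous_map T euclideanreal f \<and>
              (\<forall>e>0. \<exists>K. compactin T K \<and> (\<forall>x\<in>topspace T - K. \<bar>f x\<bar> < e))}"

definition C0_dom :: "'x topology \<Rightarrow> 'x measure \<Rightarrow> (('x \<Rightarrow> real) set \<Rightarrow> ennreal) \<Rightarrow> ('x \<Rightarrow> real) set" where
  "C0_dom T M E = {f \<in> C0 T \<inter> lspace M. lclass M f \<in> qdom (L2 M) E}"

text \<open>The measure need not have full support: the elements of \<open>C0_dom\<close> are functions, not classes.\<close>

definition regular_dirichlet_form ::
    "'x topology \<Rightarrow> 'x measure \<Rightarrow> (('x \<Rightarrow> real) set \<Rightarrow> ennreal) \<Rightarrow> bool" where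
  "regular_dirichlet_form T M E \<longleftrightarrow>
     Hausdorff_space T \<and> locally_compact_space T \<and> sets M = sets (borel_of T) \<and>
     dirichlet_form M E \<and>
     hdense (form_space (L2 M) E) (lclass M ` C0_dom T M E) (qdom (L2 M) E) \<and>
     (\<forall>f\<in>C0 T. \<forall>e>0. \<exists>g\<in>C0_dom T M E. \<forall>x\<in>topspace T. \<bar>f x - g x\<bar> < e)"


section \<open>Radon-measure spaces and disintegrations\<close>

definition radon_measure_space :: "'x topology \<Rightarrow> 'x measure \<Rightarrow> bool" where
  "radon_measure_space T M \<longleftrightarrow>
     Hausdorff_space T \<and> space M = topspace T \<and> sets (borel_of T) \<subseteq> sets M \<and>
     sets (completion M) =
       sets (completion (measure_of (topspace T) (sets (borel_of T)) (emeasure M))) \<and>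
     (\<forall>x\<in>topspace T. \<exists>U. openin T U \<and> x \<in> U \<and> emeasure (completion M) U < \<infinity>) \<and>
     (\<forall>A\<in>sets (completion M).
        emeasure (completion M) A = (SUP K\<in>{K. compactin T K \<and> K \<subseteq> A}. emeasure (completion M) K))"

definition full_support :: "'x topology \<Rightarrow> 'x measure \<Rightarrow> bool" where
  "full_support T M \<longleftrightarrow> (\<forall>U. openin T U \<and> U \<noteq> {} \<longrightarrow> 0 < emeasure M U)"

definition pseudo_disintegration :: "'x measure \<Rightarrow> 'z measure \<Rightarrow> ('z \<Rightarrow> 'x measure) \<Rightarrow> bool" where
  "pseudo_disintegration M \<nu> m \<longleftrightarrow>
     (\<forall>\<zeta>\<in>space \<nu>. sets (m \<zeta>) = sets M \<and> emeasure (m \<zeta>) (space M) \<noteq> 0) \<and>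
     (\<forall>A\<in>sets M. (\<lambda>\<zeta>. emeasure (m \<zeta>) A) \<in> borel_measurable (completion \<nu>) \<and>
        emeasure M A = (\<integral>\<^sup>+\<zeta>. emeasure (m \<zeta>) A \<partial>completion \<nu>))"

definition separated_disintegration :: "'x measure \<Rightarrow> 'z measure \<Rightarrow> ('z \<Rightarrow> 'x measure) \<Rightarrow> bool" where
  "separated_disintegration M \<nu> m \<longleftrightarrow>
     (\<exists>A. (\<forall>\<zeta>\<in>space \<nu>. A \<zeta> \<in> sets (completion M)) \<and> disjoint_family_on A (space \<nu>) \<and>
        (AE \<zeta> in \<nu>. conegligible (m \<zeta>) (A \<zeta>)))"

definition fibre :: "'x measure \<Rightarrow> ('x \<Rightarrow> 'z) \<Rightarrow> 'z \<Rightarrow> 'x set" where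
  "fibre M s \<zeta> = s -` {\<zeta>} \<inter> space M"

definition strongly_consistent ::
    "'x measure \<Rightarrow> 'z measure \<Rightarrow> ('z \<Rightarrow> 'x measure) \<Rightarrow> ('x \<Rightarrow> 'z) \<Rightarrow> bool" where
  "strongly_consistent M \<nu> m s \<longleftrightarrow>
     (\<forall>A\<in>sets M. \<forall>B\<in>sets \<nu>.
        emeasure M (A \<inter> (s -` B \<inter> space M)) =
        (\<integral>\<^sup>+\<zeta>. emeasure (m \<zeta>) A * indicator B \<zeta> \<partial>completion \<nu>)) \<and>
     (AE \<zeta> in \<nu>. conegligible (m \<zeta>) (fibre M s \<zeta>))"

text \<open>A fibre that is \<open>M\<close>-negligible inherits all its subsets from the completion of \<open>M\<close>, and the
  completion of \<open>m \<zeta>\<close> does not measure all of them. The trace is therefore taken on those sets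
  that the completion of \<open>m \<zeta>\<close> does measure.\<close>

definition fibre_measure ::
    "'x measure \<Rightarrow> ('z \<Rightarrow> 'x measure) \<Rightarrow> ('x \<Rightarrow> 'z) \<Rightarrow> 'z \<Rightarrow> 'x measure" where
  "fibre_measure M m s \<zeta> =
     measure_of (fibre M s \<zeta>)
       (sets (restrict_space (completion M) (fibre M s \<zeta>)) \<inter> sets (completion (m \<zeta>)))
       (emeasure (completion (m \<zeta>)))"


section \<open>Direct integrals of Dirichlet forms and ergodic decompositions\<close>

definition delta_field ::
    "'z measure \<Rightarrow> ('z \<Rightarrow> 'x measure) \<Rightarrow> ('x \<Rightarrow> real) \<Rightarrow> 'z \<Rightarrow> ('x \<Rightarrow> real) set" where
  "delta_field \<nu> m f =
     (\<lambda>\<zeta>\<in>space \<nu>. if f \<in> lspace (m \<zeta>) then lclass (m \<zeta>) f else hzero (L2 (m \<zeta>)))"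

text \<open>The map sending the class of \<open>f\<close> to the class of \<open>\<delta>(f)\<close>.\<close>

definition delta_map ::
    "'z measure \<Rightarrow> ('z \<Rightarrow> 'x measure) \<Rightarrow> ('z \<Rightarrow> ('x \<Rightarrow> real) set) set \<Rightarrow>
     ('x \<Rightarrow> real) set \<Rightarrow> ('z \<Rightarrow> ('x \<Rightarrow> real) set) set" where
  "delta_map \<nu> m SH U = fclass \<nu> (\<lambda>\<zeta>. L2 (m \<zeta>)) SH (delta_field \<nu> m (rep U))"

definition dense_function_space :: "'x measure \<Rightarrow> ('x \<Rightarrow> real) set \<Rightarrow> bool" where
  "dense_function_space M \<A> \<longleftrightarrow>
     \<A> \<subseteq> lspace M \<and> (\<lambda>x. 0) \<in> \<A> \<and>
     (\<forall>f\<in>\<A>. \<forall>g\<in>\<A>. (\<lambda>x. f x + g x) \<in> \<A>) \<and> (\<forall>c. \<forall>f\<in>\<A>. (\<lambda>x. c * f x) \<in> \<A>) \<and>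
     hdense (L2 M) (lclass M ` \<A>) (hcarrier (L2 M))"

definition direct_integral_of_dirichlet_forms ::
    "'x measure \<Rightarrow> (('x \<Rightarrow> real) set \<Rightarrow> ennreal) \<Rightarrow> 'z measure \<Rightarrow> ('z \<Rightarrow> 'x measure) \<Rightarrow>
     ('z \<Rightarrow> ('x \<Rightarrow> real) set \<Rightarrow> ennreal) \<Rightarrow> bool" where
  "direct_integral_of_dirichlet_forms M E \<nu> m F \<longleftrightarrow>
     pseudo_disintegration M \<nu> m \<and> separated_disintegration M \<nu> m \<and>
     (\<forall>\<zeta>\<in>space \<nu>. dirichlet_form (m \<zeta>) (F \<zeta>)) \<and>
     (\<exists>SH SQ \<A>.
        measurable_form_field \<nu> (\<lambda>\<zeta>. L2 (m \<zeta>)) F SH SQ \<and>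
        dense_function_space M \<A> \<and> lclass M ` \<A> \<subseteq> qdom (L2 M) E \<and>
        generates_field \<nu> (\<lambda>\<zeta>. L2 (m \<zeta>)) (delta_field \<nu> m ` \<A>) SH \<and>
        generates_field \<nu> (\<lambda>\<zeta>. form_space (L2 (m \<zeta>)) (F \<zeta>)) (delta_field \<nu> m ` \<A>) SQ \<and>
        hunitary (L2 M) (direct_integral \<nu> (\<lambda>\<zeta>. L2 (m \<zeta>)) SH) (delta_map \<nu> m SH) \<and>
        (\<forall>U\<in>hcarrier (L2 M).
           E U = direct_integral_form \<nu> (\<lambda>\<zeta>. L2 (m \<zeta>)) F SQ (delta_map \<nu> m SH U)))"

text \<open>\<open>m \<zeta>\<close> is a measure on the whole space, and regularity of \<open>F \<zeta>\<close> refers to the topology of the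
  whole space: a fibre need not be locally compact.\<close>

definition ergodic_decomposition ::
    "'x topology \<Rightarrow> 'x measure \<Rightarrow> (('x \<Rightarrow> real) set \<Rightarrow> ennreal) \<Rightarrow> 'z measure \<Rightarrow> ('x \<Rightarrow> 'z) \<Rightarrow>
     ('z \<Rightarrow> 'x measure) \<Rightarrow> ('z \<Rightarrow> ('x \<Rightarrow> real) set \<Rightarrow> ennreal) \<Rightarrow> bool" where
  "ergodic_decomposition T M E \<nu> s m F \<longleftrightarrow>
     prob_space \<nu> \<and> separable_measure \<nu> \<and> countably_generated_measure \<nu> \<and>
     s \<in> M \<rightarrow>\<^sub>M \<nu> \<and> s ` space M = space \<nu> \<and>
     pseudo_disintegration M \<nu> m \<and> strongly_consistent M \<nu> m s \<and>
     (AE \<zeta> in \<nu>. radon_measure_space (subtopology T (fibre M s \<zeta>)) (fibre_measure M m s \<zeta>)) \<and>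
     (\<forall>\<zeta>\<in>space \<nu>. regular_dirichlet_form T (m \<zeta>) (F \<zeta>) \<and> irreducible_form (m \<zeta>) (F \<zeta>)) \<and>
     direct_integral_of_dirichlet_forms M E \<nu> m F"


section \<open>Almost isomorphisms and equality of forms\<close>

text \<open>The sets \<open>A \<union> N\<close> with \<open>A\<close> measurable and \<open>N\<close> negligible are those of the completion.\<close>

definition almost_isomorphism :: "'y measure \<Rightarrow> 'z measure \<Rightarrow> ('y \<Rightarrow> 'z) \<Rightarrow> bool" where
  "almost_isomorphism \<nu>1 \<nu>2 \<rho> \<longleftrightarrow>
     \<rho> \<in> space \<nu>1 \<rightarrow> space \<nu>2 \<and>
     (\<exists>N1\<in>negligible_sets \<nu>1. \<exists>N2\<in>negligible_sets \<nu>2.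
        bij_betw \<rho> (space \<nu>1 - N1) (space \<nu>2 - N2) \<and>
        (\<lambda>A. \<rho> ` A) ` {A - N1 |A. A \<in> sets (completion \<nu>1)} = {B - N2 |B. B \<in> sets (completion \<nu>2)} \<and>
        (\<lambda>A. \<rho> ` A) ` {A - N1 |A. A \<in> negligible_sets \<nu>1} = {B - N2 |B. B \<in> negligible_sets \<nu>2})"

definition equivalent_measures :: "'z measure \<Rightarrow> 'z measure \<Rightarrow> bool" where
  "equivalent_measures M N \<longleftrightarrow> absolutely_continuous M N \<and> absolutely_continuous N M"

text \<open>Equality as maps to \<open>[0,\<infinity>]\<close> on the same set of classes; this contains equality of domains.\<close>

definition same_form ::
    "'x measure \<Rightarrow> (('x \<Rightarrow> real) set \<Rightarrow> ennreal) \<Rightarrow> 'x measure \<Rightarrow> (('x \<Rightarrow> real) set \<Rightarrow> ennreal) \<Rightarrow> bool"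
  where
  "same_form M E N F \<longleftrightarrow>
     hcarrier (L2 M) = hcarrier (L2 N) \<and> (\<forall>U\<in>hcarrier (L2 M). E U = F U)"

end

theory Submission
  imports Defs
begin

text \<open>A set \<open>s2 -` B\<close> is a symmetry of \<open>E\<close>: multiplication by \<open>1\<close> on it and \<open>-1\<close> off it preserves
  \<open>E\<close>, as one sees fibrewise in the second decomposition. Localising this identity along \<open>s1\<close> shows
  that the same multiplication preserves almost every \<open>E1 \<zeta>\<close>, hence commutes with its semigroup, so by
  irreducibility the set is null or conull for almost every \<open>\<mu>1 \<zeta>\<close>. It therefore agrees, up to a
  \<open>\<mu>\<close>-null set, with some \<open>s1 -` A\<close>. As the index spaces are countably generated, a single null set
  serves for all \<open>B\<close>; off it, \<open>s1\<close> and \<open>s2\<close> have the same fibres and generate the same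
  \<open>\<sigma>\<close>-algebra, and \<open>s1 x \<mapsto> s2 x\<close> is the almost isomorphism \<open>\<rho>\<close>. With \<open>h\<close> the density of \<open>\<nu>2\<close> with
  respect to \<open>distr \<nu>1 \<nu>2 \<rho>\<close>, comparing the integrals of \<open>\<mu>i \<zeta>\<close> and of \<open>Ei \<zeta>\<close> over all measurable sets of
  indices gives \<open>\<mu>1 \<zeta> = h (\<rho> \<zeta>) \<mu>2 (\<rho> \<zeta>)\<close>, and the same for the forms on countably many functions that
  are total in the form domains; completeness of these domains extends it to all functions.\<close>

section \<open>Hilbert spaces with explicit carrier\<close>

text \<open>Each function brings its own null set of indices, while a form domain may be
  uncountable. Fibrewise comparisons are therefore made along a sequence and extended by
  \<open>conformal_extension\<close>, which serves both the sign symmetry (factor 1) and the passage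
  between the two decompositions (factor \<open>h\<close>). Polarisation is the reason why sums and
  differences of the chosen functions are followed as well. Irreducibility is stated through the
  semigroup, the decompositions only through forms. A sign function replaces the indicator because
  it acts as a self-adjoint unitary involution: its symmetry is one equation between values of
  \<open>E\<close>, and this already forces commutation with the semigroup. Localisation rests on
  one fact: for almost every \<open>\<zeta>\<close> a factor \<open>\<theta> (s x)\<close> equals
  \<open>\<theta> \<zeta>\<close> almost everywhere on the fibre, so it multiplies the energy
  density by \<open>(\<theta> \<zeta>)\<^sup>2\<close>. Indicators recover the density from
  \<open>E\<close>; values 1 and -1 leave \<open>E\<close> unchanged. Images under \<open>s1\<close>
  and \<open>s2\<close> need not be measurable. Hence \<open>\<rho>\<close> is measurable only from
  the completion, and index sets are compared through their preimages in the common space.\<close>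

context separable_hilbert_space
begin

lemma inner_add_right:
  "\<lbrakk>x \<in> hcarrier H; y \<in> hcarrier H; z \<in> hcarrier H\<rbrakk>
    \<Longrightarrow> hinner H x (hadd H y z) = hinner H x y + hinner H x z"
  by (metis add_closed inner_add inner_commute)

lemma inner_scale_right:
  "\<lbrakk>x \<in> hcarrier H; y \<in> hcarrier H\<rbrakk> \<Longrightarrow> hinner H x (hscale H c y) = c * hinner H x y"
  by (metis scale_closed inner_scale inner_commute)

lemma diff_closed: "\<lbrakk>x \<in> hcarrier H; y \<in> hcarrier H\<rbrakk> \<Longrightarrow> hdiff H x y \<in> hcarrier H"
  by (simp add: hdiff_def add_closed scale_closed)

lemma inner_diff:
  "\<lbrakk>x \<in> hcarrier H; y \<in> hcarrier H; z \<in> hcarrier H\<rbrakk>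
    \<Longrightarrow> hinner H (hdiff H x y) z = hinner H x z - hinner H y z"
  by (simp add: hdiff_def inner_add inner_scale scale_closed)

lemma inner_diff_right:
  "\<lbrakk>x \<in> hcarrier H; y \<in> hcarrier H; z \<in> hcarrier H\<rbrakk>
    \<Longrightarrow> hinner H x (hdiff H y z) = hinner H x y - hinner H x z"
  by (simp add: hdiff_def inner_add_right inner_scale_right scale_closed)

lemma inner_zero: "x \<in> hcarrier H \<Longrightarrow> hinner H (hzero H) x = 0"
  using diff_self[of x] inner_diff[of x x x] by simp

lemma inner_zero_right: "x \<in> hcarrier H \<Longrightarrow> hinner H x (hzero H) = 0"
  by (metis inner_commute inner_zero zero_closed)

lemmas hclosed = zero_closed add_closed scale_closed diff_closed
lemmas hinner_simps = inner_add inner_add_right inner_scale inner_scale_right inner_diff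
  inner_diff_right inner_zero inner_zero_right

lemma eq_if_diff_zero:
  assumes x: "x \<in> hcarrier H" and y: "y \<in> hcarrier H" and "hdiff H x y = hzero H"
  shows "x = y"
proof -
  have "hadd H (hdiff H x y) y = hadd H x (hdiff H y y)"
    using x y unfolding hdiff_def by (metis add_assoc add_commute scale_closed)
  then show ?thesis
    using assms by (metis add_commute add_zero diff_self zero_closed)
qed

text \<open>Reduces vector identities to identities between real numbers.\<close>

lemma hext:
  assumes "x \<in> hcarrier H" "y \<in> hcarrier H"
    and "\<And>z. z \<in> hcarrier H \<Longrightarrow> hinner H x z = hinner H y z"
  shows "x = y"
proof (rule eq_if_diff_zero)
  show "hdiff H x y = hzero H"
    by (rule inner_definite) (use assms in \<open>simp_all add: hclosed inner_diff\<close>)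
qed (use assms in auto)

lemma hnorm_nonneg: "x \<in> hcarrier H \<Longrightarrow> 0 \<le> hnorm H x"
  by (simp add: hnorm_def inner_nonneg)

lemma hnorm_sq: "x \<in> hcarrier H \<Longrightarrow> (hnorm H x)\<^sup>2 = hinner H x x"
  by (simp add: hnorm_def inner_nonneg)

lemma Cauchy_Schwarz_sq:
  assumes x: "x \<in> hcarrier H" and y: "y \<in> hcarrier H"
  shows "(hinner H x y)\<^sup>2 \<le> hinner H x x * hinner H y y"
proof (cases "hinner H y y = 0")
  case True
  then show ?thesis using inner_definite[OF y] x by (simp add: inner_zero_right inner_zero zero_closed)
next
  case False
  define a b where "a = hinner H y y" and "b = hinner H x y"
  have a: "a > 0" using False inner_nonneg[OF y] by (simp add: a_def)
  \<comment> \<open>The vector is \<open>a\<close> times the component of \<open>x\<close>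
    orthogonal to \<open>y\<close>; the factor \<open>a\<close> avoids a division.\<close>
  have "0 \<le> hinner H (hdiff H (hscale H a x) (hscale H b y)) (hdiff H (hscale H a x) (hscale H b y))"
    using x y by (simp add: inner_nonneg hclosed)
  also have "\<dots> = a * (a * hinner H x x - b\<^sup>2)"
    using x y inner_commute[OF x y]
    by (simp add: hinner_simps hclosed a_def b_def algebra_simps power2_eq_square)
  finally have "0 \<le> a * hinner H x x - b\<^sup>2" using a by (simp add: zero_le_mult_iff)
  then show ?thesis by (simp add: a_def b_def mult.commute)
qed

lemma Cauchy_Schwarz:
  assumes x: "x \<in> hcarrier H" and y: "y \<in> hcarrier H"
  shows "\<bar>hinner H x y\<bar> \<le> hnorm H x * hnorm H y"
  using real_sqrt_le_mono[OF Cauchy_Schwarz_sq[OF x y]] by (simp add: hnorm_def real_sqrt_mult)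

lemma hnorm_triangle:
  assumes x: "x \<in> hcarrier H" and y: "y \<in> hcarrier H"
  shows "hnorm H (hadd H x y) \<le> hnorm H x + hnorm H y"
proof (rule power2_le_imp_le)
  have "(hnorm H (hadd H x y))\<^sup>2 = (hnorm H x)\<^sup>2 + 2 * hinner H x y + (hnorm H y)\<^sup>2"
    using x y inner_commute[OF x y] by (simp add: hnorm_sq hclosed hinner_simps)
  also have "\<dots> \<le> (hnorm H x)\<^sup>2 + 2 * (hnorm H x * hnorm H y) + (hnorm H y)\<^sup>2"
    using Cauchy_Schwarz[OF x y] by simp
  finally show "(hnorm H (hadd H x y))\<^sup>2 \<le> (hnorm H x + hnorm H y)\<^sup>2"
    by (simp add: power2_sum)
qed (simp add: hnorm_nonneg x y)

lemma hnorm_scale: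
  assumes x: "x \<in> hcarrier H"
  shows "hnorm H (hscale H c x) = \<bar>c\<bar> * hnorm H x"
proof -
  have "hinner H (hscale H c x) (hscale H c x) = c\<^sup>2 * hinner H x x"
    using x by (simp add: hinner_simps hclosed power2_eq_square)
  then show ?thesis by (simp add: hnorm_def real_sqrt_mult)
qed

lemma hdist_nonneg: "\<lbrakk>x \<in> hcarrier H; y \<in> hcarrier H\<rbrakk> \<Longrightarrow> 0 \<le> hdist H x y"
  by (simp add: hdist_def hnorm_nonneg hclosed)

lemma hdist_commute:
  assumes x: "x \<in> hcarrier H" and y: "y \<in> hcarrier H"
  shows "hdist H x y = hdist H y x"
proof -
  have "hdiff H x y = hscale H (-1) (hdiff H y x)"
    using x y by (intro hext) (simp_all add: hclosed hinner_simps)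
  then show ?thesis using x y by (simp add: hdist_def hnorm_scale hclosed)
qed

lemma hdist_triangle:
  assumes x: "x \<in> hcarrier H" and y: "y \<in> hcarrier H" and z: "z \<in> hcarrier H"
  shows "hdist H x z \<le> hdist H x y + hdist H y z"
proof -
  have "hdiff H x z = hadd H (hdiff H x y) (hdiff H y z)"
    using x y z by (intro hext) (simp_all add: hclosed hinner_simps)
  then show ?thesis using x y z by (simp add: hdist_def hnorm_triangle hclosed)
qed

lemma hdist_self: "x \<in> hcarrier H \<Longrightarrow> hdist H x x = 0"
  by (simp add: hdist_def diff_self hnorm_def inner_zero zero_closed)

lemma eq_if_hdist_zero:
  assumes "x \<in> hcarrier H" "y \<in> hcarrier H" "hdist H x y = 0"
  shows "x = y"
proof (rule eq_if_diff_zero)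
  show "hdiff H x y = hzero H"
    by (rule inner_definite) (use assms in \<open>simp_all add: hdist_def hnorm_def hclosed\<close>)
qed (use assms in auto)

lemma hnorm_diff_le:
  assumes x: "x \<in> hcarrier H" and y: "y \<in> hcarrier H"
  shows "\<bar>hnorm H x - hnorm H y\<bar> \<le> hdist H x y"
proof -
  have *: "hnorm H a \<le> hdist H a b + hnorm H b" if a: "a \<in> hcarrier H" and b: "b \<in> hcarrier H" for a b
  proof -
    have "a = hadd H (hdiff H a b) b"
      using a b by (intro hext) (simp_all add: hclosed hinner_simps)
    then show ?thesis using hnorm_triangle[of "hdiff H a b" b] a b by (simp add: hdist_def hclosed)
  qed
  show ?thesis using *[OF x y] *[OF y x] hdist_commute[OF x y] by linarith
qed

lemma hdist_limit_unique:
  assumes X: "\<And>n. X n \<in> hcarrier H" and a: "a \<in> hcarrier H" and b: "b \<in> hcarrier H"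
    and "((\<lambda>n. hdist H (X n) a) \<longlongrightarrow> 0) G" "((\<lambda>n. hdist H (X n) b) \<longlongrightarrow> 0) G" "G \<noteq> bot"
  shows "a = b"
proof (rule eq_if_hdist_zero[OF a b])
  have "((\<lambda>n. hdist H (X n) a + hdist H (X n) b) \<longlongrightarrow> 0 + 0) G"
    using assms by (intro tendsto_add)
  moreover have "hdist H a b \<le> hdist H (X n) a + hdist H (X n) b" for n
    using hdist_triangle[OF a X b] hdist_commute[OF a X] by simp
  ultimately have "hdist H a b \<le> 0"
    using \<open>G \<noteq> bot\<close> by (intro tendsto_lowerbound) auto
  then show "hdist H a b = 0" using hdist_nonneg[OF a b] by simp
qed

lemma hnorm_tendsto:
  assumes X: "\<And>n. X n \<in> hcarrier H" and a: "a \<in> hcarrier H" and "((\<lambda>n. hdist H (X n) a) \<longlongrightarrow> 0) G"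
  shows "((\<lambda>n. hnorm H (X n)) \<longlongrightarrow> hnorm H a) G"
proof -
  have "((\<lambda>n. hnorm H (X n) - hnorm H a) \<longlongrightarrow> 0) G"
    using hnorm_diff_le[OF X a] by (intro Lim_null_comparison[OF _ assms(3)]) auto
  then show ?thesis by (simp add: LIM_zero_iff)
qed

lemma hsubspace_span:
  assumes "A \<subseteq> hcarrier H"
  shows "hsubspace H (hspan H A)"
proof -
  have "hsubspace H (hcarrier H)" by (simp add: hsubspace_def hclosed)
  then show ?thesis using assms by (auto simp: hsubspace_def hspan_def)
qed

lemma hspan_minimal: "\<lbrakk>hsubspace H W; A \<subseteq> W\<rbrakk> \<Longrightarrow> hspan H A \<subseteq> W"
  by (auto simp: hspan_def)

text \<open>The solution minimises \<open>B v v - 2 l v\<close>, and the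
  parallelogram identity for \<open>B\<close> makes minimising sequences Cauchy.\<close>

lemma symmetric_Lax_Milgram:
  fixes B :: "'a \<Rightarrow> 'a \<Rightarrow> real" and l :: "'a \<Rightarrow> real"
  assumes B_add: "\<And>x y z. \<lbrakk>x \<in> hcarrier H; y \<in> hcarrier H; z \<in> hcarrier H\<rbrakk> \<Longrightarrow> B (hadd H x y) z = B x z + B y z"
    and B_scale: "\<And>c x y. \<lbrakk>x \<in> hcarrier H; y \<in> hcarrier H\<rbrakk> \<Longrightarrow> B (hscale H c x) y = c * B x y"
    and B_commute: "\<And>x y. \<lbrakk>x \<in> hcarrier H; y \<in> hcarrier H\<rbrakk> \<Longrightarrow> B x y = B y x"
    and B_lower: "\<And>x. x \<in> hcarrier H \<Longrightarrow> hinner H x x \<le> B x x"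
    and B_bound: "\<And>x y. \<lbrakk>x \<in> hcarrier H; y \<in> hcarrier H\<rbrakk> \<Longrightarrow> \<bar>B x y\<bar> \<le> C * (hnorm H x * hnorm H y)"
    and l_add: "\<And>x y. \<lbrakk>x \<in> hcarrier H; y \<in> hcarrier H\<rbrakk> \<Longrightarrow> l (hadd H x y) = l x + l y"
    and l_scale: "\<And>c x. x \<in> hcarrier H \<Longrightarrow> l (hscale H c x) = c * l x"
    and l_bound: "\<And>x. x \<in> hcarrier H \<Longrightarrow> \<bar>l x\<bar> \<le> D * hnorm H x"
  obtains v where "v \<in> hcarrier H" "\<And>x. x \<in> hcarrier H \<Longrightarrow> B v x = l x"
proof -
  let ?C = "hcarrier H"
  define \<Phi> where "\<Phi> v = B v v - 2 * l v" for v
  have B_add_right: "B x (hadd H y z) = B x y + B x z" if "x \<in> ?C" "y \<in> ?C" "z \<in> ?C" for x y z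
    using that B_commute[of x] B_add[of y z x] by (simp add: add_closed)
  have B_scale_right: "B x (hscale H c y) = c * B x y" if "x \<in> ?C" "y \<in> ?C" for c x y
    using that B_commute[of x] B_scale[of y x c] by (simp add: scale_closed)
  have B_diff: "B (hdiff H x y) z = B x z - B y z" "B z (hdiff H x y) = B z x - B z y"
    if "x \<in> ?C" "y \<in> ?C" "z \<in> ?C" for x y z
    using that by (simp_all add: hdiff_def B_add B_scale B_add_right B_scale_right scale_closed)
  have l_diff: "l (hdiff H x y) = l x - l y" if "x \<in> ?C" "y \<in> ?C" for x y
    using that by (simp add: hdiff_def l_add l_scale scale_closed)
  note Bs = B_add B_scale B_add_right B_scale_right B_diff l_add l_scale l_diff
  \<comment> \<open>Completing the square: coercivity and the bound on \<open>l\<close> give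
    \<open>\<Phi> v\<close> at least \<open>(hnorm H v)\<^sup>2 - 2 * D * hnorm H v\<close>.\<close>
  have lower: "- D\<^sup>2 \<le> \<Phi> v" if v: "v \<in> ?C" for v
  proof -
    have "0 \<le> (hnorm H v - D)\<^sup>2" by simp
    also have "\<dots> \<le> (hnorm H v)\<^sup>2 - 2 * l v + D\<^sup>2"
      using l_bound[OF v] by (simp add: power2_diff mult.commute)
    also have "\<dots> \<le> \<Phi> v + D\<^sup>2" using B_lower[OF v] by (simp add: \<Phi>_def hnorm_sq v)
    finally show ?thesis by simp
  qed
  define d where "d = Inf (\<Phi> ` ?C)"
  have bdd: "bdd_below (\<Phi> ` ?C)" using lower by (intro bdd_belowI2)
  have d_le: "d \<le> \<Phi> v" if "v \<in> ?C" for v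
    unfolding d_def using that bdd by (intro cINF_lower)
  have "\<exists>v\<in>?C. \<Phi> v < d + 1 / (real n + 1)" for n
  proof -
    have "Inf (\<Phi> ` ?C) < d + 1 / (real n + 1)" by (simp add: d_def)
    moreover have "\<Phi> ` ?C \<noteq> {}" using zero_closed by blast
    ultimately show ?thesis using cInf_lessD[of "\<Phi> ` ?C"] by blast
  qed
  then obtain X where X: "\<And>n. X n \<in> ?C" and X_lt: "\<And>n. \<Phi> (X n) < d + 1 / (real n + 1)"
    by metis
  have close: "(hdist H (X i) (X j))\<^sup>2 < 2 * (1 / (real i + 1) + 1 / (real j + 1))" for i j
  proof -
    let ?m = "hscale H (1/2) (hadd H (X i) (X j))"
    have m: "?m \<in> ?C" by (simp add: hclosed X)
    have "\<Phi> ?m = (\<Phi> (X i) + \<Phi> (X j)) / 2 - B (hdiff H (X i) (X j)) (hdiff H (X i) (X j)) / 4"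
      using B_commute[OF X[of i] X[of j]] X
      by (simp add: \<Phi>_def Bs hclosed) argo
    with d_le[OF m] X_lt[of i] X_lt[of j]
    have "B (hdiff H (X i) (X j)) (hdiff H (X i) (X j)) < 2 * (1 / (real i + 1) + 1 / (real j + 1))"
      by argo
    then show ?thesis
      using B_lower[of "hdiff H (X i) (X j)"] X by (simp add: hdist_def hnorm_sq hclosed)
  qed
  have "\<exists>N. \<forall>i\<ge>N. \<forall>j\<ge>N. hdist H (X i) (X j) < e" if e: "0 < e" for e :: real
  proof -
    obtain N :: nat where N: "4 / e\<^sup>2 < real N" using reals_Archimedean2 by blast
    have "hdist H (X i) (X j) < e" if "i \<ge> N" "j \<ge> N" for i j
    proof (rule power_less_imp_less_base)
      have "1 / (real i + 1) \<le> 1 / (real N + 1)" "1 / (real j + 1) \<le> 1 / (real N + 1)"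
        using that by (simp_all add: frac_le)
      with close[of i j] have "(hdist H (X i) (X j))\<^sup>2 < 4 * (1 / (real N + 1))" by argo
      also have "\<dots> \<le> e\<^sup>2"
      proof -
        have "4 < real N * e\<^sup>2" using N e by (simp add: pos_divide_less_eq)
        also have "\<dots> \<le> (real N + 1) * e\<^sup>2" by (intro mult_right_mono) auto
        finally show ?thesis by (simp add: pos_divide_le_eq mult.commute)
      qed
      finally show "(hdist H (X i) (X j))\<^sup>2 < e\<^sup>2" .
    qed (use e in simp)
    then show ?thesis by blast
  qed
  from complete[OF X this] obtain v where v: "v \<in> ?C" and lim: "(\<lambda>n. hdist H (X n) v) \<longlonglongrightarrow> 0"
    by blast
  have stationary: "B v x = l x" if x: "x \<in> ?C" for x
  proof -
    have min: "d \<le> \<Phi> v + 2 * t * (B v x - l x) + t\<^sup>2 * B x x" for t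
    proof -
      have "\<Phi> (hadd H v (hscale H t x)) = \<Phi> v + 2 * t * (B v x - l x) + t\<^sup>2 * B x x"
        using x v B_commute[OF x v] by (simp add: \<Phi>_def Bs hclosed algebra_simps power2_eq_square)
      then show ?thesis using d_le[of "hadd H v (hscale H t x)"] x v by (simp add: hclosed)
    qed
    have \<Phi>v: "\<Phi> v \<le> d"
    proof -
      let ?r = "\<lambda>n. hdiff H v (X n)"
      \<comment> \<open>Continuity of \<open>\<Phi>\<close> at \<open>v\<close> with an explicit
        modulus: expanding in the remainder \<open>?r n\<close> leaves two linear terms, bounded by
        its norm, and \<open>- B (?r n) (?r n)\<close>, which has the right sign to be
        dropped.\<close>
      have bound: "\<Phi> v \<le> d + 1 / (real n + 1) + (2 * (C * hnorm H v) + 2 * D) * hdist H (X n) v" for n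
      proof -
        define \<delta> where "\<delta> = hdist H (X n) v"
        have \<delta>: "\<delta> = hnorm H (?r n)" using hdist_commute[OF v X[of n]] by (simp add: \<delta>_def hdist_def)
        have r: "?r n \<in> ?C" using v X by (simp add: hclosed)
        have "\<Phi> v = \<Phi> (X n) - B (?r n) (?r n) + 2 * B v (?r n) - 2 * l (?r n)"
          using v X[of n] B_commute[OF v X[of n]] by (simp add: \<Phi>_def Bs hclosed)
        moreover have "B v (?r n) \<le> C * hnorm H v * \<delta>"
          using B_bound[OF v r] by (simp add: \<delta> mult.assoc)
        moreover have "- l (?r n) \<le> D * \<delta>"
          using l_bound[OF r] by (simp add: \<delta>)
        moreover have "0 \<le> B (?r n) (?r n)"
          using B_lower[OF r] inner_nonneg[OF r] by simp
        moreover have "(2 * (C * hnorm H v) + 2 * D) * \<delta> = 2 * (C * hnorm H v * \<delta>) + 2 * (D * \<delta>)"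
          by (simp add: distrib_right)
        ultimately show ?thesis using X_lt[of n] unfolding \<delta>_def[symmetric] by linarith
      qed
      have "(\<lambda>n. d + 1 / (real n + 1) + (2 * (C * hnorm H v) + 2 * D) * hdist H (X n) v)
          \<longlonglongrightarrow> d + 0 + (2 * (C * hnorm H v) + 2 * D) * 0"
        by (intro tendsto_intros lim) (use LIMSEQ_inverse_real_of_nat in \<open>simp add: inverse_eq_divide add.commute\<close>)
      then show ?thesis
        using LIMSEQ_le_const[of _ d "\<Phi> v"] bound by simp
    qed
    have nonneg: "0 \<le> 2 * t * (B v x - l x) + t\<^sup>2 * B x x" for t using min[of t] \<Phi>v by simp
    show ?thesis
    proof (rule ccontr)
      assume ne: "B v x \<noteq> l x"
      define a where "a = B v x - l x"
      \<comment> \<open>The choice \<open>t = - a / b\<close> minimises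
        \<open>2 * t * a + t\<^sup>2 * b\<close>; the summand 1 keeps \<open>b\<close>
        positive.\<close>
      define b where "b = \<bar>B x x\<bar> + 1"
      have "b > 0" "a \<noteq> 0" using ne by (auto simp: a_def b_def)
      have "0 \<le> 2 * (- a / b) * a + (- a / b)\<^sup>2 * b"
      proof -
        have "0 \<le> 2 * (- a / b) * a + (- a / b)\<^sup>2 * B x x" using nonneg[of "- a / b"] by (simp add: a_def)
        also have "\<dots> \<le> 2 * (- a / b) * a + (- a / b)\<^sup>2 * b"
          by (intro add_left_mono mult_left_mono) (auto simp: b_def)
        finally show ?thesis .
      qed
      also have "\<dots> = - a\<^sup>2 / b" using \<open>b > 0\<close> by (simp add: field_simps power2_eq_square)
      finally show False using \<open>b > 0\<close> \<open>a \<noteq> 0\<close> by (simp add: field_simps)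
    qed
  qed
  show thesis using that[OF v stationary] .
qed

end

section \<open>Closed forms and their semigroups\<close>

lemma form_space_simps [simp]:
  "hcarrier (form_space H Q) = qdom H Q" "hzero (form_space H Q) = hzero H"
  "hadd (form_space H Q) = hadd H" "hscale (form_space H Q) = hscale H"
  "hdiff (form_space H Q) = hdiff H"
  "hinner (form_space H Q) u v = qbil H Q u v + hinner H u v"
  by (simp_all add: form_space_def hdiff_def fun_eq_iff)

lemma qdomD: "u \<in> qdom H Q \<Longrightarrow> u \<in> hcarrier H"
  by (simp add: qdom_def)

locale closed_form_space = separable_hilbert_space H
  for H :: "'a hspace" +
  fixes Q :: "'a \<Rightarrow> ennreal"
  assumes closed: "closed_form H Q"
begin

sublocale K: separable_hilbert_space "form_space H Q"
  using closed by (simp add: closed_form_def)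

lemma parallelogram:
  "\<lbrakk>u \<in> hcarrier H; v \<in> hcarrier H\<rbrakk> \<Longrightarrow> Q (hadd H u v) + Q (hdiff H u v) = 2 * Q u + 2 * Q v"
  using closed by (simp add: closed_form_def quadratic_form_def)

lemma qdom_dense: "hdense H (qdom H Q) (hcarrier H)"
  using closed by (simp add: closed_form_def quadratic_form_def)

lemmas qdom_closed = K.hclosed[simplified]

lemma Q_eq: "u \<in> qdom H Q \<Longrightarrow> Q u = ennreal (enn2real (Q u))"
  by (simp add: qdom_def ennreal_enn2real_if less_top)

lemma parallelogram_real:
  assumes u: "u \<in> qdom H Q" and v: "v \<in> qdom H Q"
  shows "enn2real (Q (hadd H u v)) + enn2real (Q (hdiff H u v)) = 2 * enn2real (Q u) + 2 * enn2real (Q v)"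
proof -
  have "ennreal (enn2real (Q (hadd H u v)) + enn2real (Q (hdiff H u v)))
      = Q (hadd H u v) + Q (hdiff H u v)"
    using Q_eq[OF qdom_closed(2)[OF u v]] Q_eq[OF qdom_closed(4)[OF u v]] by simp
  also have "\<dots> = 2 * Q u + 2 * Q v" using u v by (simp add: parallelogram qdomD)
  also have "\<dots> = ennreal (2 * enn2real (Q u) + 2 * enn2real (Q v))"
    using Q_eq[OF u] Q_eq[OF v] by (simp add: ennreal_mult)
  finally show ?thesis by (subst (asm) ennreal_inj) auto
qed

lemma Q_zero: "Q (hzero H) = 0"
proof -
  have z: "hzero H \<in> qdom H Q" by (rule qdom_closed)
  have "enn2real (Q (hzero H)) = 0"
    using parallelogram_real[OF z z] by (simp add: add_zero diff_self zero_closed)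
  then show ?thesis using Q_eq[OF z] by simp
qed

lemma qbil_self: "u \<in> qdom H Q \<Longrightarrow> qbil H Q u u = enn2real (Q u)"
  using parallelogram_real[of u u] by (simp add: qbil_def diff_self qdomD Q_zero)

text \<open>The inner product of \<open>form_space H Q\<close> is \<open>qbil\<close> plus that of
  \<open>H\<close>. Both inner products are bilinear and symmetric, so \<open>qbil\<close> inherits
  these properties, here and in the lemmas that follow, by subtraction.\<close>

lemma qbil_commute: "\<lbrakk>u \<in> qdom H Q; v \<in> qdom H Q\<rbrakk> \<Longrightarrow> qbil H Q u v = qbil H Q v u"
  using K.inner_commute[of u v] inner_commute[of u v] by (simp add: qdomD)

lemma qbil_add:
  "\<lbrakk>u \<in> qdom H Q; v \<in> qdom H Q; w \<in> qdom H Q\<rbrakk> \<Longrightarrow> qbil H Q (hadd H u v) w = qbil H Q u w + qbil H Q v w"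
  using K.inner_add[of u v w] inner_add[of u v w] by (simp add: qdomD)

lemma qbil_scale:
  "\<lbrakk>u \<in> qdom H Q; v \<in> qdom H Q\<rbrakk> \<Longrightarrow> qbil H Q (hscale H c u) v = c * qbil H Q u v"
  using K.inner_scale[of u v c] inner_scale[of u v c] by (simp add: qdomD distrib_left)

lemma qbil_diff:
  "\<lbrakk>u \<in> qdom H Q; v \<in> qdom H Q; w \<in> qdom H Q\<rbrakk> \<Longrightarrow> qbil H Q (hdiff H u v) w = qbil H Q u w - qbil H Q v w"
  using K.inner_diff[of u v w] inner_diff[of u v w] by (simp add: qdomD)

lemma qbil_add_right:
  "\<lbrakk>u \<in> qdom H Q; v \<in> qdom H Q; w \<in> qdom H Q\<rbrakk> \<Longrightarrow> qbil H Q u (hadd H v w) = qbil H Q u v + qbil H Q u w"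
  using K.inner_add_right[of u v w] inner_add_right[of u v w] by (simp add: qdomD)

lemma qbil_scale_right:
  "\<lbrakk>u \<in> qdom H Q; v \<in> qdom H Q\<rbrakk> \<Longrightarrow> qbil H Q u (hscale H c v) = c * qbil H Q u v"
  using K.inner_scale_right[of u v c] inner_scale_right[of u v c] by (simp add: qdomD distrib_left)

lemma qbil_diff_right:
  "\<lbrakk>u \<in> qdom H Q; v \<in> qdom H Q; w \<in> qdom H Q\<rbrakk> \<Longrightarrow> qbil H Q u (hdiff H v w) = qbil H Q u v - qbil H Q u w"
  using K.inner_diff_right[of u v w] inner_diff_right[of u v w] by (simp add: qdomD)

lemmas qbil_simps = qbil_add qbil_scale qbil_diff qbil_add_right qbil_scale_right qbil_diff_right

lemma qbil_nonneg: "u \<in> qdom H Q \<Longrightarrow> 0 \<le> qbil H Q u u"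
  by (simp add: qbil_self)

lemma K_hnorm_sq: "u \<in> qdom H Q \<Longrightarrow> (hnorm (form_space H Q) u)\<^sup>2 = enn2real (Q u) + (hnorm H u)\<^sup>2"
  using K.hnorm_sq[of u] hnorm_sq[of u] by (simp add: qdomD qbil_self)

lemma hnorm_le_K: "u \<in> qdom H Q \<Longrightarrow> hnorm H u \<le> hnorm (form_space H Q) u"
  using K_hnorm_sq[of u] K.hnorm_nonneg[of u] by (intro power2_le_imp_le[of "hnorm H u"]) auto

lemma hdist_le_K: "\<lbrakk>u \<in> qdom H Q; v \<in> qdom H Q\<rbrakk> \<Longrightarrow> hdist H u v \<le> hdist (form_space H Q) u v"
  using hnorm_le_K[of "hdiff H u v"] by (simp add: hdist_def qdom_closed)

text \<open>Homogeneity comes from the bilinearity of \<open>qbil\<close>, hence from the Hilbert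
  space structure on the domain and not from the parallelogram identity.\<close>

lemma Q_scale:
  assumes u: "u \<in> qdom H Q"
  shows "Q (hscale H c u) = ennreal (c\<^sup>2) * Q u"
proof -
  have "enn2real (Q (hscale H c u)) = c\<^sup>2 * enn2real (Q u)"
    using u by (simp flip: qbil_self add: qdom_closed qbil_simps power2_eq_square)
  then show ?thesis
    using Q_eq[OF u] Q_eq[OF qdom_closed(3)[OF u, of c]] by (metis ennreal_mult' zero_le_power2)
qed

text \<open>The solution \<open>v\<close> of \<open>Q(v,x) + r\<langle>v,x\<rangle> = r\<langle>u,x\<rangle>\<close> lies in the domain of the
  generator and converges to \<open>u\<close> as \<open>r \<rightarrow> \<infinity>\<close>.\<close>

lemma generator_dense:
  assumes u: "u \<in> hcarrier H" and e: "0 < e"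
  obtains v w where "v \<in> qdom H Q" "w \<in> hcarrier H"
    "\<And>x. x \<in> qdom H Q \<Longrightarrow> qbil H Q v x = hinner H w x" "hdist H v u < e"
proof -
  obtain u' where u': "u' \<in> qdom H Q" "hdist H u u' < e / 2"
    using qdom_dense u e unfolding hdense_def by (meson half_gt_zero)
  have u'H: "u' \<in> hcarrier H" using u' by (simp add: qdomD)
  \<comment> \<open>Chosen so that \<open>r * (e / 2)\<^sup>2\<close> exceeds a quarter of
    \<open>qbil H Q u' u'\<close>, the bound obtained for \<open>r * (hdist H v u')\<^sup>2\<close>
    below; at the same time \<open>r\<close> is at least 1, as coercivity requires.\<close>
  define r where "r = 1 + qbil H Q u' u' / e\<^sup>2"
  have r: "1 \<le> r" using qbil_nonneg[OF u'(1)] by (simp add: r_def)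
  let ?B = "\<lambda>x y. qbil H Q x y + r * hinner H x y"
  let ?l = "\<lambda>x. r * hinner H u' x"
  \<comment> \<open>The problem is solved in the form norm. There \<open>?B\<close> is the inner
    product plus \<open>r - 1\<close> times the inner product of \<open>H\<close>, hence coercive
    with constant 1 and bounded with constant \<open>r\<close>.\<close>
  obtain v where v: "v \<in> qdom H Q" and v_eq: "\<And>x. x \<in> qdom H Q \<Longrightarrow> ?B v x = ?l x"
  proof (rule K.symmetric_Lax_Milgram[of ?B r ?l "r * hnorm H u'"], goal_cases)
    case 1 then show ?case by (simp add: qbil_simps hinner_simps qdomD algebra_simps)
  next
    case 2 then show ?case by (simp add: qbil_simps hinner_simps qdomD algebra_simps)
  next
    case 3 then show ?case by (simp add: qbil_commute inner_commute qdomD)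
  next
    case (4 x) then show ?case
      using mult_right_mono[OF r inner_nonneg[of x]] by (simp add: qdomD)
  next
    case (5 x y)
    have "\<bar>(qbil H Q x y + hinner H x y) + (r - 1) * hinner H x y\<bar>
       \<le> \<bar>qbil H Q x y + hinner H x y\<bar> + (r - 1) * \<bar>hinner H x y\<bar>"
      using r by (intro order_trans[OF abs_triangle_ineq]) (simp add: abs_mult)
    also have "\<dots> \<le> hnorm (form_space H Q) x * hnorm (form_space H Q) y
        + (r - 1) * (hnorm (form_space H Q) x * hnorm (form_space H Q) y)"
    proof (intro add_mono mult_left_mono)
      show "\<bar>qbil H Q x y + hinner H x y\<bar> \<le> hnorm (form_space H Q) x * hnorm (form_space H Q) y"
        using K.Cauchy_Schwarz[of x y] 5 by simp
      have "\<bar>hinner H x y\<bar> \<le> hnorm H x * hnorm H y" using Cauchy_Schwarz[of x y] 5 by (simp add: qdomD)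
      also have "\<dots> \<le> hnorm (form_space H Q) x * hnorm (form_space H Q) y"
        using 5 by (intro mult_mono hnorm_le_K) (auto simp: hnorm_nonneg K.hnorm_nonneg qdomD)
      finally show "\<bar>hinner H x y\<bar> \<le> hnorm (form_space H Q) x * hnorm (form_space H Q) y" .
    qed (use r in auto)
    finally show ?case by (simp add: algebra_simps)
  next
    case 6 then show ?case using u' by (simp add: hinner_simps qdomD algebra_simps)
  next
    case 7 then show ?case using u' by (simp add: hinner_simps qdomD algebra_simps)
  next
    case (8 x)
    have "\<bar>hinner H u' x\<bar> \<le> hnorm H u' * hnorm H x" using Cauchy_Schwarz[of u' x] 8 u' by (simp add: qdomD)
    also have "\<dots> \<le> hnorm H u' * hnorm (form_space H Q) x"
      using 8 u' by (intro mult_left_mono hnorm_le_K) (auto simp: hnorm_nonneg qdomD)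
    finally show ?case using r by (simp add: abs_mult)
  next
    case (9 v) then show ?case using that[of v] by simp
  qed
  have vH: "v \<in> hcarrier H" using v by (simp add: qdomD)
  \<comment> \<open>Young's inequality for the form, obtained from its nonnegativity at
    \<open>v\<close> minus half of \<open>u'\<close>.\<close>
  have "0 \<le> qbil H Q (hdiff H v (hscale H (1/2) u')) (hdiff H v (hscale H (1/2) u'))"
    by (intro qbil_nonneg) (simp add: qdom_closed v u')
  then have young: "qbil H Q v u' \<le> qbil H Q v v + qbil H Q u' u' / 4"
    using qbil_commute[OF v u'(1)] by (simp add: qbil_simps qdom_closed v u')
  \<comment> \<open>The equation for \<open>v\<close> tested at \<open>u'\<close>, minus the same
    equation tested at \<open>v\<close>.\<close>
  have "r * hinner H (hdiff H v u') (hdiff H v u') = qbil H Q v u' - qbil H Q v v"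
    using v_eq[OF v] v_eq[OF u'(1)] inner_commute[OF vH u'H]
    by (simp add: hinner_simps hclosed vH u'H algebra_simps)
  then have "r * (hdist H v u')\<^sup>2 \<le> qbil H Q u' u' / 4"
    using young by (simp add: hdist_def hnorm_sq hclosed vH u'H)
  also have "\<dots> < r * (e / 2)\<^sup>2"
    using e by (simp add: r_def power_divide field_simps)
  finally have "hdist H v u' < e / 2"
    using r e by (intro power_less_imp_less_base[of "hdist H v u'" 2]) auto
  then have "hdist H v u < e"
    using hdist_triangle[OF vH u'H u] hdist_commute[OF u u'H] u' by simp
  moreover have "qbil H Q v x = hinner H (hscale H r (hdiff H u' v)) x" if "x \<in> qdom H Q" for x
    using v_eq[OF that] that vH u'H by (simp add: hinner_simps hclosed qdomD algebra_simps)
  ultimately show thesis using that v vH u'H by (metis hclosed(3,4))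
qed

end

text \<open>On the span of \<open>F\<close> the map multiplies form norms by \<open>sqrt c\<close>,
  so approximants of \<open>u\<close> from the span have images that are Cauchy in the form norm of
  \<open>Q'\<close>. Completeness of that domain provides a limit, and continuity of
  \<open>J\<close> in the weaker Hilbert norms identifies it with \<open>J u\<close>. Only one
  inclusion of domains results; equality needs a second application in the opposite
  direction.\<close>

lemma conformal_extension:
  fixes J :: "'a \<Rightarrow> 'b"
  assumes 1: "closed_form_space H Q" and 2: "closed_form_space H' Q'"
    and J: "hlinear H H' J" and c: "0 < c"
    and J_inner: "\<And>x y. \<lbrakk>x \<in> hcarrier H; y \<in> hcarrier H\<rbrakk> \<Longrightarrow> hinner H' (J x) (J y) = c * hinner H x y"
    and total: "htotal (form_space H Q) F"
    and J_dom: "\<And>f. f \<in> F \<Longrightarrow> J f \<in> qdom H' Q'"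
    and J_form: "\<And>f g. \<lbrakk>f \<in> F; g \<in> F\<rbrakk> \<Longrightarrow> qbil H' Q' (J f) (J g) = c * qbil H Q f g"
    and u: "u \<in> qdom H Q"
  shows "J u \<in> qdom H' Q' \<and> Q' (J u) = ennreal c * Q u"
proof -
  interpret A: closed_form_space H Q by fact
  interpret B: closed_form_space H' Q' by fact
  let ?K = "form_space H Q" and ?K' = "form_space H' Q'"
  have J_car: "J x \<in> hcarrier H'" if "x \<in> hcarrier H" for x
    using J that by (auto simp: hlinear_def)
  have J_add: "J (hadd H x y) = hadd H' (J x) (J y)" if "x \<in> hcarrier H" "y \<in> hcarrier H" for x y
    using J that by (auto simp: hlinear_def)
  have J_scale: "J (hscale H a x) = hscale H' a (J x)" if "x \<in> hcarrier H" for x a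
    using J that by (auto simp: hlinear_def)
  have J_diff: "J (hdiff H x y) = hdiff H' (J x) (J y)" if "x \<in> hcarrier H" "y \<in> hcarrier H" for x y
    using that by (simp add: hdiff_def J_add J_scale A.scale_closed)
  have J_zero: "J (hzero H) = hzero H'"
    using J_diff[of "hzero H" "hzero H"] by (simp add: A.diff_self B.diff_self A.zero_closed J_car)
  \<comment> \<open>Membership of \<open>J w\<close> in the domain is part of the predicate, because
    the bilinear form is additive only there.\<close>
  define good where "good w v \<longleftrightarrow> J w \<in> qdom H' Q' \<and> hinner ?K' (J w) (J v) = c * hinner ?K w v" for w v
  have F: "F \<subseteq> qdom H Q" and dense: "hdense ?K (hspan ?K F) (qdom H Q)"
    using total by (auto simp: htotal_def)
  \<comment> \<open>With the second arguments \<open>V\<close> fixed, the condition is linear in the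
    first. It is used twice: with \<open>V = F\<close> to reach the span in the first argument and,
    after exchanging the arguments, with \<open>V\<close> the span itself.\<close>
  have sub: "hsubspace ?K {w \<in> qdom H Q. J w \<in> qdom H' Q' \<and> (\<forall>v\<in>V. good w v)}"
    if V: "\<And>v. v \<in> V \<Longrightarrow> v \<in> qdom H Q \<and> J v \<in> qdom H' Q'" for V
    unfolding hsubspace_def good_def
    using V A.K.hclosed B.K.hclosed A.K.hinner_simps B.K.hinner_simps
    by (auto simp: J_zero J_add J_scale qdomD distrib_left simp del: form_space_simps(6))
  have FF: "good f g" if "f \<in> F" "g \<in> F" for f g
    using that J_inner[of f g] qdomD[OF subsetD[OF F]] by (simp add: good_def J_dom J_form distrib_left)
  have span1: "w \<in> qdom H Q \<and> J w \<in> qdom H' Q' \<and> (\<forall>f\<in>F. good w f)" if "w \<in> hspan ?K F" for w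
  proof -
    have "hspan ?K F \<subseteq> {w \<in> qdom H Q. J w \<in> qdom H' Q' \<and> (\<forall>v\<in>F. good w v)}"
      using F J_dom FF by (intro A.K.hspan_minimal sub) auto
    then show ?thesis using that by auto
  qed
  have good_commute: "good w v" if "good v w" "w \<in> qdom H Q" "v \<in> qdom H Q" "J w \<in> qdom H' Q'" for v w
    using that unfolding good_def by (metis A.K.inner_commute B.K.inner_commute form_space_simps(1))
  have span2: "good w v" if "w \<in> hspan ?K F" "v \<in> hspan ?K F" for w v
  proof -
    have "good f v" if "f \<in> F" "v \<in> hspan ?K F" for f v
      using span1[OF that(2)] that(1) F J_dom by (intro good_commute[of v f]) auto
    then have "hspan ?K F \<subseteq> {w \<in> qdom H Q. J w \<in> qdom H' Q' \<and> (\<forall>v\<in>hspan ?K F. good w v)}"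
      using F J_dom span1 by (intro A.K.hspan_minimal sub) auto
    then show ?thesis using that by auto
  qed
  have diff_span: "hdiff H w v \<in> hspan ?K F" if "w \<in> hspan ?K F" "v \<in> hspan ?K F" for w v
  proof -
    have "hsubspace ?K (hspan ?K F)" using F by (intro A.K.hsubspace_span) simp
    then show ?thesis using that by (auto simp: hdiff_def hsubspace_def)
  qed
  have norm_span: "hnorm ?K' (J w) = sqrt c * hnorm ?K w" if "w \<in> hspan ?K F" for w
    using span2[OF that that] by (simp add: hnorm_def good_def real_sqrt_mult flip: form_space_simps(6))
  have uH: "u \<in> hcarrier H" using u by (rule qdomD)
  have "\<exists>w\<in>hspan ?K F. hdist ?K u w < inverse (real (Suc n))" for n
    using dense u unfolding hdense_def by (meson inverse_positive_iff_positive of_nat_0_less_iff zero_less_Suc)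
  then obtain X where X: "\<And>n. X n \<in> hspan ?K F"
    and X_lt: "\<And>n. hdist ?K u (X n) < inverse (real (Suc n))" by metis
  have Xd: "X n \<in> qdom H Q" "X n \<in> hcarrier H" "J (X n) \<in> qdom H' Q'" "J (X n) \<in> hcarrier H'" for n
    using span1[OF X[of n]] by (auto simp: qdomD)
  have limX: "(\<lambda>n. hdist ?K (X n) u) \<longlonglongrightarrow> 0"
    using X_lt A.K.hdist_commute[of u] A.K.hdist_nonneg Xd u
    by (intro Lim_null_comparison[OF _ LIMSEQ_inverse_real_of_nat]) (auto simp: less_imp_le)
  have dist_J: "hdist ?K' (J (X i)) (J (X j)) = sqrt c * hdist ?K (X i) (X j)" for i j
    using norm_span[OF diff_span[OF X[of i] X[of j]]] Xd by (simp add: hdist_def J_diff)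
  have "\<exists>N. \<forall>i\<ge>N. \<forall>j\<ge>N. hdist ?K' (J (X i)) (J (X j)) < e" if e: "0 < e" for e
  proof -
    have "0 < e / (2 * sqrt c)" using e c by simp
    with limX have "\<forall>\<^sub>F n in sequentially. hdist ?K (X n) u < e / (2 * sqrt c)"
      by (rule order_tendstoD)
    then obtain N where N: "\<And>n. n \<ge> N \<Longrightarrow> hdist ?K (X n) u < e / (2 * sqrt c)"
      by (auto simp: eventually_sequentially)
    have "hdist ?K' (J (X i)) (J (X j)) < e" if "i \<ge> N" "j \<ge> N" for i j
    proof -
      have "hdist ?K (X i) (X j) < e / (2 * sqrt c) + e / (2 * sqrt c)"
        using A.K.hdist_triangle[of "X i" u "X j"] A.K.hdist_commute[of "X j" u] N[of i] N[of j] that Xd u by simp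
      then show ?thesis using c by (simp add: dist_J field_simps)
    qed
    then show ?thesis by blast
  qed
  from B.K.complete[OF _ this] obtain z where z: "z \<in> qdom H' Q'"
    and limz: "(\<lambda>n. hdist ?K' (J (X n)) z) \<longlonglongrightarrow> 0" using Xd by auto
  \<comment> \<open>Form norms dominate Hilbert norms, so \<open>z\<close> is also the limit in
    \<open>H'\<close>, where \<open>J\<close> is continuous.\<close>
  have "z = J u"
  proof (rule B.hdist_limit_unique)
    show "(\<lambda>n. hdist H' (J (X n)) z) \<longlonglongrightarrow> 0"
      using B.hdist_le_K B.hdist_nonneg Xd z
      by (intro Lim_null_comparison[OF _ limz]) (auto simp: qdomD)
    have "hdist H' (J (X n)) (J u) = sqrt c * hdist H (X n) u" for n
      using J_inner Xd uH by (simp add: hdist_def hnorm_def J_diff[symmetric] A.hclosed real_sqrt_mult)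
    moreover have "(\<lambda>n. hdist H (X n) u) \<longlonglongrightarrow> 0"
      using A.hdist_le_K A.hdist_nonneg Xd u uH
      by (intro Lim_null_comparison[OF _ limX]) (auto simp: qdomD)
    ultimately show "(\<lambda>n. hdist H' (J (X n)) (J u)) \<longlonglongrightarrow> 0"
      by (auto intro!: tendsto_mult_right_zero)
  qed (use Xd z uH J_car in \<open>auto simp: qdomD\<close>)
  with z limz have Ju: "J u \<in> qdom H' Q'" and limJ: "(\<lambda>n. hdist ?K' (J (X n)) (J u)) \<longlonglongrightarrow> 0" by auto
  have "(\<lambda>n. hnorm ?K' (J (X n))) \<longlonglongrightarrow> hnorm ?K' (J u)"
    using Xd Ju limJ by (intro B.K.hnorm_tendsto) auto
  moreover have "(\<lambda>n. hnorm ?K' (J (X n))) \<longlonglongrightarrow> sqrt c * hnorm ?K u"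
    unfolding norm_span[OF X] using Xd u limX by (intro tendsto_mult tendsto_const A.K.hnorm_tendsto) auto
  ultimately have "hnorm ?K' (J u) = sqrt c * hnorm ?K u" by (rule LIMSEQ_unique)
  then have "(hnorm ?K' (J u))\<^sup>2 = c * (hnorm ?K u)\<^sup>2" using c by (simp add: power_mult_distrib)
  moreover have "(hnorm H' (J u))\<^sup>2 = c * (hnorm H u)\<^sup>2"
    using uH J_car by (simp add: A.hnorm_sq B.hnorm_sq J_inner)
  ultimately have "enn2real (Q' (J u)) = c * enn2real (Q u)"
    using A.K_hnorm_sq[OF u] B.K_hnorm_sq[OF Ju] by (simp add: distrib_left)
  then show ?thesis
    using Ju A.Q_eq[OF u] B.Q_eq[OF Ju] c by (metis ennreal_mult' less_imp_le)
qed

text \<open>Continuous induction: the times in \<open>{0..t}\<close> with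
  \<open>\<phi> s - e * s \<le> \<phi> 0\<close> form a closed set, and the Dini condition moves
  beyond its supremum unless this is \<open>t\<close>. Then \<open>e\<close> tends to 0.\<close>

lemma right_Dini_nonincreasing:
  fixes \<phi> :: "real \<Rightarrow> real"
  assumes t: "0 \<le> t" and cont: "continuous_on {0..} \<phi>"
    and Dini: "\<And>s e. \<lbrakk>0 \<le> s; 0 < e\<rbrakk> \<Longrightarrow> \<forall>\<^sub>F h in at_right 0. \<phi> (s + h) \<le> \<phi> s + e * h"
  shows "\<phi> t \<le> \<phi> 0"
proof -
  have "\<phi> t \<le> \<phi> 0 + e * t" if e: "0 < e" for e
  proof -
    define S where "S = {s \<in> {0..t}. \<phi> s - e * s \<le> \<phi> 0}"
    have cont': "continuous_on {0..t} (\<lambda>s. \<phi> s - e * s)"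
      using cont by (intro continuous_intros) (auto elim: continuous_on_subset)
    have "closed S"
      unfolding S_def by (rule continuous_on_closed_Collect_le[OF cont' continuous_on_const]) simp
    moreover have "0 \<in> S" using t by (simp add: S_def)
    moreover have bdd: "bdd_above S" by (auto simp: S_def intro: bdd_aboveI[of _ t])
    ultimately have sup: "Sup S \<in> S" by (intro closed_contains_Sup) auto
    have "Sup S = t"
    proof (rule ccontr)
      assume "Sup S \<noteq> t"
      with sup have s: "0 \<le> Sup S" "Sup S < t" by (auto simp: S_def)
      have "\<forall>\<^sub>F h in at_right 0. h < t - Sup S" using s by (intro order_tendstoD[OF tendsto_ident_at]) auto
      with Dini[OF s(1) e] have "\<forall>\<^sub>F h in at_right 0. h < t - Sup S \<and> \<phi> (Sup S + h) \<le> \<phi> (Sup S) + e * h \<and> 0 < h"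
        using eventually_at_right_less[of 0] by eventually_elim auto
      then obtain h where h: "h < t - Sup S" "\<phi> (Sup S + h) \<le> \<phi> (Sup S) + e * h" "0 < h"
        using eventually_happens'[OF trivial_limit_at_right_real] by blast
      then have "Sup S + h \<in> S" using sup s by (auto simp: S_def algebra_simps)
      then have "Sup S + h \<le> Sup S" by (rule cSup_upper[OF _ bdd])
      then show False using h by simp
    qed
    then show ?thesis using sup by (simp add: S_def)
  qed
  note le = this
  show ?thesis
  proof (rule ccontr)
    assume "\<not> \<phi> t \<le> \<phi> 0"
    then have d: "0 < \<phi> t - \<phi> 0" by simp
    \<comment> \<open>The slope is small enough for the error over \<open>[0,t]\<close> to stay
      below half the gap; \<open>t + 1\<close> in place of \<open>t\<close> covers
      \<open>t = 0\<close>.\<close>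
    have "\<phi> t \<le> \<phi> 0 + (\<phi> t - \<phi> 0) / (2 * (t + 1)) * t" using d t by (intro le) simp
    also have "\<dots> \<le> \<phi> 0 + (\<phi> t - \<phi> 0) / 2"
      using d t by (simp add: field_simps)
    finally show False using d by argo
  qed
qed

context closed_form_space
begin

text \<open>A symmetry of the form commutes with the generator. Hence \<open>J P\<^sub>h - P\<^sub>h J\<close> is \<open>o(h)\<close> on its
  domain, and \<open>\<parallel>J P\<^sub>t u - P\<^sub>t J u\<parallel>\<close> has upper right Dini derivative at most 0.\<close>

lemma semigroup_commutes:
  assumes P: "associated_semigroup H Q P" and J: "hlinear H H J"
    and J_inner: "\<And>x y. \<lbrakk>x \<in> hcarrier H; y \<in> hcarrier H\<rbrakk> \<Longrightarrow> hinner H (J x) (J y) = hinner H x y"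
    and J_J: "\<And>x. x \<in> hcarrier H \<Longrightarrow> J (J x) = x"
    and J_dom: "\<And>x. x \<in> qdom H Q \<Longrightarrow> J x \<in> qdom H Q"
    and J_Q: "\<And>x. x \<in> qdom H Q \<Longrightarrow> Q (J x) = Q x"
    and t: "0 \<le> t" and u: "u \<in> hcarrier H"
  shows "P t (J u) = J (P t u)"
proof -
  let ?C = "hcarrier H"
  have P_car: "P s x \<in> ?C" if "x \<in> ?C" "0 \<le> s" for s x
    using P that by (auto simp: associated_semigroup_def hlinear_def)
  have P_add: "P s (hadd H x y) = hadd H (P s x) (P s y)" if "x \<in> ?C" "y \<in> ?C" "0 \<le> s" for s x y
    using P that by (auto simp: associated_semigroup_def hlinear_def)
  have P_scale: "P s (hscale H a x) = hscale H a (P s x)" if "x \<in> ?C" "0 \<le> s" for s x a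
    using P that by (auto simp: associated_semigroup_def hlinear_def)
  have P_diff: "P s (hdiff H x y) = hdiff H (P s x) (P s y)" if "x \<in> ?C" "y \<in> ?C" "0 \<le> s" for s x y
    using that by (simp add: hdiff_def P_add P_scale scale_closed)
  have P_norm: "hnorm H (P s x) \<le> hnorm H x" if "x \<in> ?C" "0 \<le> s" for s x
    using P that by (auto simp: associated_semigroup_def)
  have P_dist: "hdist H (P s x) (P s y) \<le> hdist H x y" if "x \<in> ?C" "y \<in> ?C" "0 \<le> s" for s x y
    using P_norm[of "hdiff H x y" s] that by (simp add: hdist_def P_diff hclosed)
  have P_0: "P 0 x = x" if "x \<in> ?C" for x
    using P that by (auto simp: associated_semigroup_def)
  have P_plus: "P (s + r) x = P s (P r x)" if "x \<in> ?C" "0 \<le> s" "0 \<le> r" for s r x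
    using P that by (auto simp: associated_semigroup_def)
  have P_lim: "((\<lambda>s. hdist H (P s x) x) \<longlongrightarrow> 0) (at_right 0)" if "x \<in> ?C" for x
    using P that by (auto simp: associated_semigroup_def)
  have J_car: "J x \<in> ?C" if "x \<in> ?C" for x
    using J that by (auto simp: hlinear_def)
  have J_add: "J (hadd H x y) = hadd H (J x) (J y)" if "x \<in> ?C" "y \<in> ?C" for x y
    using J that by (auto simp: hlinear_def)
  have J_scale: "J (hscale H a x) = hscale H a (J x)" if "x \<in> ?C" for x a
    using J that by (auto simp: hlinear_def)
  have J_diff: "J (hdiff H x y) = hdiff H (J x) (J y)" if "x \<in> ?C" "y \<in> ?C" for x y
    using that by (simp add: hdiff_def J_add J_scale scale_closed)
  have J_dist: "hdist H (J x) (J y) = hdist H x y" if "x \<in> ?C" "y \<in> ?C" for x y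
    using that by (simp add: hdist_def hnorm_def J_diff[symmetric] J_inner hclosed)
  have J_qbil: "qbil H Q (J x) (J y) = qbil H Q x y" if "x \<in> qdom H Q" "y \<in> qdom H Q" for x y
    using that by (simp add: qbil_def qdomD J_add[symmetric] J_diff[symmetric] J_Q qdom_closed)
  \<comment> \<open>The strong derivative at 0: \<open>x\<close> lies in the domain of the operator
    of the form, which maps it to \<open>w\<close>.\<close>
  define gen where "gen x w \<longleftrightarrow> ((\<lambda>h. hdist H (hscale H (1 / h) (hdiff H x (P h x))) w) \<longlongrightarrow> 0) (at_right 0)" for x w
  have gen: "gen x w \<longleftrightarrow> x \<in> qdom H Q \<and> (\<forall>v\<in>qdom H Q. qbil H Q x v = hinner H w v)"
    if "x \<in> ?C" "w \<in> ?C" for x w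
    using P that unfolding associated_semigroup_def gen_def by blast
  \<comment> \<open>An isometric involution is its own adjoint, both for \<open>qbil\<close> and for
    the inner product, so \<open>J\<close> moves to the test vector and back.\<close>
  have J_gen: "gen (J x) (J w)" if x: "x \<in> ?C" and w: "w \<in> ?C" and g: "gen x w" for x w
  proof -
    have x': "x \<in> qdom H Q" and eq: "\<And>v. v \<in> qdom H Q \<Longrightarrow> qbil H Q x v = hinner H w v"
      using g gen[OF x w] by auto
    have "qbil H Q (J x) v = hinner H (J w) v" if v: "v \<in> qdom H Q" for v
      using J_qbil[OF x' J_dom[OF v]] eq[OF J_dom[OF v]] J_inner[of w "J v"] v w
      by (simp add: J_J qdomD J_car)
    then show ?thesis using gen[of "J x" "J w"] x w x' by (simp add: J_car J_dom)
  qed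
  have P_gen: "gen (P s x) (P s w)" if x: "x \<in> ?C" and w: "w \<in> ?C" and s: "0 \<le> s" and g: "gen x w" for x w s
    unfolding gen_def
  proof (rule Lim_null_comparison)
    show "((\<lambda>h. hdist H (hscale H (1 / h) (hdiff H x (P h x))) w) \<longlongrightarrow> 0) (at_right 0)"
      using g by (simp add: gen_def)
    show "\<forall>\<^sub>F h in at_right 0. norm (hdist H (hscale H (1 / h) (hdiff H (P s x) (P h (P s x)))) (P s w))
        \<le> hdist H (hscale H (1 / h) (hdiff H x (P h x))) w"
      using eventually_at_right_less[of "0::real"]
    proof eventually_elim
      case (elim h)
      have "P h (P s x) = P s (P h x)"
        using P_plus[of x h s] P_plus[of x s h] x s elim by (simp add: add.commute)
      then have "hscale H (1 / h) (hdiff H (P s x) (P h (P s x))) = P s (hscale H (1 / h) (hdiff H x (P h x)))"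
        using x s elim by (simp add: P_diff P_scale P_car hclosed)
      then show ?case
        using P_dist[of "hscale H (1 / h) (hdiff H x (P h x))" w s] x s w elim
        by (simp add: hdist_nonneg hclosed P_car)
    qed
  qed
  define C where "C s x = hdist H (J (P s x)) (P s (J x))" for s x
  \<comment> \<open>Both \<open>J (P h x)\<close> and \<open>P h (J x)\<close> equal
    \<open>J x\<close> minus \<open>h\<close> times \<open>J w\<close> up to an error of order
    \<open>o(h)\<close>; the first-order terms cancel.\<close>
  have C_small: "\<forall>\<^sub>F h in at_right 0. C h x \<le> e * h" if x: "x \<in> ?C" and w: "w \<in> ?C" and g: "gen x w" and e: "0 < e" for x w e
  proof -
    have "\<forall>\<^sub>F h in at_right 0. hdist H (hscale H (1 / h) (hdiff H x (P h x))) w < e / 2"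
      using g e by (intro order_tendstoD) (auto simp: gen_def)
    moreover have "\<forall>\<^sub>F h in at_right 0. hdist H (hscale H (1 / h) (hdiff H (J x) (P h (J x)))) (J w) < e / 2"
      using J_gen[OF x w g] e by (intro order_tendstoD) (auto simp: gen_def)
    ultimately show ?thesis using eventually_at_right_less[of "0::real"]
    proof eventually_elim
      case (elim h)
      let ?a = "hscale H (1 / h) (hdiff H x (P h x))" and ?b = "hscale H (1 / h) (hdiff H (J x) (P h (J x)))"
      have cl: "?a \<in> ?C" "?b \<in> ?C" "P h x \<in> ?C" "P h (J x) \<in> ?C" "J (P h x) \<in> ?C"
        using x elim by (simp_all add: hclosed P_car J_car)
      have "hdiff H (J (P h x)) (P h (J x)) = hscale H h (hdiff H ?b (J ?a))"
        using elim x cl by (intro hext) (simp_all add: hclosed J_car J_scale J_diff hinner_simps field_simps)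
      then have "C h x = h * hdist H ?b (J ?a)"
        using elim cl by (simp add: C_def hdist_def hnorm_scale hclosed J_car)
      also have "hdist H ?b (J ?a) \<le> hdist H ?b (J w) + hdist H (J w) (J ?a)"
        using cl w by (intro hdist_triangle) (auto simp: J_car)
      also have "hdist H (J w) (J ?a) = hdist H ?a w"
        using cl w by (simp add: J_dist hdist_commute)
      finally have "C h x \<le> h * (hdist H ?b (J w) + hdist H ?a w)" using elim by (simp add: mult_left_mono)
      also have "\<dots> \<le> h * e" using elim by (intro mult_left_mono) auto
      finally show ?case by (simp add: mult.commute)
    qed
  qed
  have P_shift: "hdist H (P r x) (P s x) \<le> hdist H (P \<bar>r - s\<bar> x) x" if "x \<in> ?C" "0 \<le> r" "0 \<le> s" for r s x
  proof -
    have *: "hdist H (P b x) (P a x) \<le> hdist H (P (b - a) x) x" if "0 \<le> a" "a \<le> b" for a b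
      using P_dist[of "P (b - a) x" x a] P_plus[of x a "b - a"] that \<open>x \<in> ?C\<close> by (simp add: P_car)
    show ?thesis
    proof (cases "s \<le> r")
      case True then show ?thesis using *[of s r] that by simp
    next
      case False then show ?thesis using *[of r s] that hdist_commute[of "P r x" "P s x"] by (simp add: P_car)
    qed
  qed
  have C_cont: "continuous_on {0..} (\<lambda>s. C s x)" if x: "x \<in> ?C" for x
    unfolding continuous_on_def
  proof
    fix s :: real assume s: "s \<in> {0..}"
    have lim: "((\<lambda>r. hdist H (P \<bar>r - s\<bar> y) y) \<longlongrightarrow> 0) (at s within {0..})" if y: "y \<in> ?C" for y
    proof -
      \<comment> \<open>The filter leaves out \<open>s\<close> itself, so the time difference is
        positive and strong continuity from the right at 0 applies.\<close>
      have "filterlim (\<lambda>r. \<bar>r - s\<bar>) (at_right 0) (at s within {0..})"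
        unfolding filterlim_at by (auto simp: eventually_at_filter intro!: tendsto_eq_intros)
      from filterlim_compose[OF P_lim[OF y] this] show ?thesis .
    qed
    have "((\<lambda>r. C r x - C s x) \<longlongrightarrow> 0) (at s within {0..})"
    proof (rule Lim_null_comparison)
      show "((\<lambda>r. hdist H (P \<bar>r - s\<bar> x) x + hdist H (P \<bar>r - s\<bar> (J x)) (J x)) \<longlongrightarrow> 0) (at s within {0..})"
        using x by (intro tendsto_add_zero lim J_car)
      show "\<forall>\<^sub>F r in at s within {0..}. norm (C r x - C s x)
          \<le> hdist H (P \<bar>r - s\<bar> x) x + hdist H (P \<bar>r - s\<bar> (J x)) (J x)"
        unfolding eventually_at_filter
      proof (intro always_eventually allI impI)
        fix r :: real assume r: "r \<in> {0..}"
        let ?a = "J (P r x)" and ?b = "P r (J x)" and ?c = "J (P s x)" and ?d = "P s (J x)"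
        have cl: "?a \<in> ?C" "?b \<in> ?C" "?c \<in> ?C" "?d \<in> ?C" using r s x by (auto simp: J_car P_car)
        have "\<bar>C r x - C s x\<bar> \<le> hdist H ?a ?c + hdist H ?b ?d"
          unfolding C_def
          using hdist_triangle[of ?a ?c ?b] hdist_triangle[of ?c ?d ?b] hdist_triangle[of ?c ?a ?d]
            hdist_triangle[of ?a ?b ?d] hdist_commute[of ?a ?c] hdist_commute[of ?b ?d] cl by linarith
        also have "\<dots> \<le> hdist H (P \<bar>r - s\<bar> x) x + hdist H (P \<bar>r - s\<bar> (J x)) (J x)"
          using r s x P_shift[of x r s] P_shift[of "J x" r s] by (simp add: J_dist P_car J_car)
        finally show "norm (C r x - C s x) \<le> hdist H (P \<bar>r - s\<bar> x) x + hdist H (P \<bar>r - s\<bar> (J x)) (J x)" by simp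
      qed
    qed
    then show "((\<lambda>r. C r x) \<longlongrightarrow> C s x) (at s within {0..})" by (simp add: LIM_zero_iff)
  qed
  have C_zero: "C t x \<le> 0" if x: "x \<in> ?C" and w: "w \<in> ?C" and g: "gen x w" for x w
  proof -
    have "C t x \<le> C 0 x"
    proof (rule right_Dini_nonincreasing[OF t C_cont[OF x]])
      fix s e :: real assume s: "0 \<le> s" and e: "0 < e"
      have Psx: "P s x \<in> ?C" "P s w \<in> ?C" using x w s by (auto simp: P_car)
      have "\<forall>\<^sub>F h in at_right 0. C h (P s x) \<le> e * h"
        by (rule C_small[OF Psx P_gen[OF x w s g] e])
      then show "\<forall>\<^sub>F h in at_right 0. C (s + h) x \<le> C s x + e * h"
        using eventually_at_right_less[of "0::real"]
      proof eventually_elim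
        case (elim h)
        \<comment> \<open>Inserting \<open>?b\<close> splits the commutator at time
          \<open>s + h\<close> into the one at time \<open>h\<close> started from
          \<open>P s x\<close>, which is small, and the one at time \<open>s\<close> after the
          contraction \<open>P h\<close>.\<close>
        let ?a = "J (P h (P s x))" and ?b = "P h (J (P s x))" and ?c = "P h (P s (J x))"
        have "C (s + h) x = hdist H ?a ?c"
          using P_plus[of x h s] P_plus[of "J x" h s] x s elim by (simp add: C_def J_car add.commute)
        also have "\<dots> \<le> hdist H ?a ?b + hdist H ?b ?c"
          using x s elim by (intro hdist_triangle) (auto simp: J_car P_car)
        also have "hdist H ?b ?c \<le> C s x"
          unfolding C_def using x s elim by (intro P_dist) (auto simp: J_car P_car)
        finally show ?case using elim by (simp add: C_def)
      qed
    qed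
    also have "C 0 x = 0" using x by (simp add: C_def P_0 J_car hdist_self)
    finally show ?thesis .
  qed
  \<comment> \<open>The commutator vanishes on the dense domain of the generator, and both
    \<open>J\<close> after \<open>P t\<close> and \<open>P t\<close> after \<open>J\<close> are
    contractions.\<close>
  have "C t u \<le> e" if e: "0 < e" for e
  proof -
    obtain v w where v: "v \<in> qdom H Q" and w: "w \<in> ?C"
      and vw: "\<And>x. x \<in> qdom H Q \<Longrightarrow> qbil H Q v x = hinner H w x" and d: "hdist H v u < e / 2"
      using generator_dense[OF u, of "e / 2"] e by auto
    have vC: "v \<in> ?C" using v by (rule qdomD)
    let ?a = "J (P t u)" and ?b = "P t (J u)" and ?c = "J (P t v)" and ?d = "P t (J v)"
    have cl: "?a \<in> ?C" "?b \<in> ?C" "?c \<in> ?C" "?d \<in> ?C" using t u vC by (auto simp: J_car P_car)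
    have "gen v w" using gen[OF vC w] v vw by blast
    then have "hdist H ?c ?d \<le> 0" using C_zero[OF vC w] by (simp add: C_def)
    moreover have "hdist H ?a ?c \<le> hdist H v u"
      using P_dist[of u v t] t u vC by (simp add: J_dist P_car hdist_commute)
    moreover have "hdist H ?d ?b \<le> hdist H v u"
      using P_dist[of "J v" "J u" t] t u vC by (simp add: J_dist J_car)
    ultimately show ?thesis
      unfolding C_def using hdist_triangle[of ?a ?c ?b] hdist_triangle[of ?c ?d ?b] cl d by linarith
  qed
  then have "C t u \<le> 0" by (rule field_le_epsilon[of _ 0, simplified])
  then have "hdist H (P t (J u)) (J (P t u)) = 0"
    using hdist_nonneg[of "P t (J u)" "J (P t u)"] hdist_commute[of "P t (J u)" "J (P t u)"] t u
    by (simp add: C_def P_car J_car)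
  then show ?thesis using t u by (intro eq_if_hdist_zero) (auto simp: P_car J_car)
qed

end

section \<open>Square-integrable functions\<close>

lemma measurable_completion_cong_AE:
  assumes f: "f \<in> completion M \<rightarrow>\<^sub>M N" and ae: "AE x in M. f x = g x" and g: "g \<in> space M \<rightarrow> space N"
  shows "g \<in> completion M \<rightarrow>\<^sub>M N"
proof (rule measurableI)
  fix A assume A: "A \<in> sets N"
  show "g -` A \<inter> space (completion M) \<in> sets (completion M)"
  proof (rule completion.in_sets_AE)
    show "AE x in completion M. x \<in> f -` A \<inter> space (completion M) \<longleftrightarrow> x \<in> g -` A \<inter> space (completion M)"
      using ae by (simp add: AE_completion_iff) (auto elim: AE_mp)
    show "f -` A \<inter> space (completion M) \<in> sets (completion M)" using f A by (rule measurable_sets)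
  qed simp
qed (use g in auto)

lemma lspace_measurable: "f \<in> lspace M \<Longrightarrow> f \<in> borel_measurable (completion M)"
  by (simp add: lspace_def)

lemma lspace_iff_nn_integral:
  "f \<in> lspace M \<longleftrightarrow>
     f \<in> borel_measurable (completion M) \<and> (\<integral>\<^sup>+x. ennreal ((f x)\<^sup>2) \<partial>completion M) < \<infinity>"
  by (auto simp: lspace_def integrable_iff_bounded)

lemma lspace_mult:
  assumes f: "f \<in> lspace M" and g: "g \<in> borel_measurable (completion M)" and "\<And>x. x \<in> space M \<Longrightarrow> \<bar>g x\<bar> \<le> c"
  shows "(\<lambda>x. g x * f x) \<in> lspace M"
proof -
  have "integrable (completion M) (\<lambda>x. (g x * f x)\<^sup>2)"
  proof (rule Bochner_Integration.integrable_bound)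
    show "integrable (completion M) (\<lambda>x. c\<^sup>2 * (f x)\<^sup>2)" using f by (simp add: lspace_def)
    show "AE x in completion M. norm ((g x * f x)\<^sup>2) \<le> norm (c\<^sup>2 * (f x)\<^sup>2)"
      using assms(3) by (intro AE_I2) (auto simp: power_mult_distrib abs_mult intro!: mult_right_mono power_mono_even abs_le_square_iff[THEN iffD1] order_trans[OF _ abs_ge_self])
  qed (use lspace_measurable[OF f] g in measurable)
  moreover have "(\<lambda>x. g x * f x) \<in> borel_measurable (completion M)"
    using lspace_measurable[OF f] g by measurable
  ultimately show ?thesis by (simp add: lspace_def)
qed

lemma lspace_scale: "f \<in> lspace M \<Longrightarrow> (\<lambda>x. c * f x) \<in> lspace M"
  by (rule lspace_mult[where c = "\<bar>c\<bar>"]) auto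

lemma lspace_product_integrable:
  assumes "f \<in> lspace M" "g \<in> lspace M"
  shows "integrable (completion M) (\<lambda>x. f x * g x)"
proof (rule Bochner_Integration.integrable_bound)
  show "integrable (completion M) (\<lambda>x. (f x)\<^sup>2 + (g x)\<^sup>2)" using assms by (simp add: lspace_def)
  show "AE x in completion M. norm (f x * g x) \<le> norm ((f x)\<^sup>2 + (g x)\<^sup>2)"
  proof (intro AE_I2)
    fix x
    have "2 * \<bar>f x\<bar> * \<bar>g x\<bar> \<le> (f x)\<^sup>2 + (g x)\<^sup>2" using sum_squares_bound[of "\<bar>f x\<bar>" "\<bar>g x\<bar>"] by simp
    moreover have "0 \<le> \<bar>f x\<bar> * \<bar>g x\<bar>" by simp
    ultimately show "norm (f x * g x) \<le> norm ((f x)\<^sup>2 + (g x)\<^sup>2)" unfolding real_norm_def abs_mult by linarith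
  qed
qed (use assms[THEN lspace_measurable] in measurable)

lemma lspace_add:
  assumes "f \<in> lspace M" "g \<in> lspace M"
  shows "(\<lambda>x. f x + g x) \<in> lspace M"
proof -
  have "integrable (completion M) (\<lambda>x. (f x)\<^sup>2 + (g x)\<^sup>2 + 2 * (f x * g x))"
    using assms lspace_product_integrable[OF assms] by (simp add: lspace_def)
  moreover have "(\<lambda>x. f x + g x) \<in> borel_measurable (completion M)"
    using assms[THEN lspace_measurable] by measurable
  ultimately show ?thesis by (simp add: lspace_def power2_sum mult.assoc)
qed

lemma lspace_cong_AE:
  assumes "f \<in> lspace M" "AE x in M. f x = g x"
  shows "g \<in> lspace M"
proof -
  have ae: "AE x in completion M. f x = g x" using assms by (simp add: AE_completion_iff)
  have g: "g \<in> borel_measurable (completion M)"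
    using lspace_measurable[OF assms(1)] assms(2) by (rule measurable_completion_cong_AE) simp
  have "integrable (completion M) (\<lambda>x. (g x)\<^sup>2)"
    using assms(1) g ae by (subst integrable_cong_AE[of _ _ "\<lambda>x. (f x)\<^sup>2"]) (auto simp: lspace_def elim: AE_mp)
  with g show ?thesis by (simp add: lspace_def)
qed

lemma lclass_self: "f \<in> lspace M \<Longrightarrow> f \<in> lclass M f"
  by (simp add: aeclass_def)

lemma lclass_eqI: "AE x in M. f x = g x \<Longrightarrow> lclass M f = lclass M g"
  unfolding aeclass_def by (auto elim: AE_mp)

text \<open>\<open>rep\<close> picks an unspecified member of a class and is known only up to a null
  set. This is what turns the operations of \<open>L2\<close>, which are defined through
  \<open>rep\<close>, into operations on given functions.\<close>

lemma rep_lclass: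
  assumes "f \<in> lspace M"
  shows "rep (lclass M f) \<in> lspace M" "AE x in M. rep (lclass M f) x = f x"
proof -
  have "rep (lclass M f) \<in> lclass M f"
    unfolding rep_def by (rule someI[of "\<lambda>u. u \<in> lclass M f", OF lclass_self[OF assms]])
  then show "rep (lclass M f) \<in> lspace M" "AE x in M. rep (lclass M f) x = f x"
    by (auto simp: aeclass_def elim: AE_mp)
qed

lemma L2_carrierE:
  assumes "U \<in> hcarrier (L2 M)"
  obtains f where "f \<in> lspace M" "U = lclass M f"
  using assms by (auto simp: L2_def)

lemma lclass_carrier: "f \<in> lspace M \<Longrightarrow> lclass M f \<in> hcarrier (L2 M)"
  by (auto simp: L2_def)

lemma L2_add:
  assumes "f \<in> lspace M" "g \<in> lspace M"
  shows "hadd (L2 M) (lclass M f) (lclass M g) = lclass M (\<lambda>x. f x + g x)"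
proof -
  have "AE x in M. rep (lclass M f) x + rep (lclass M g) x = f x + g x"
    using rep_lclass(2)[OF assms(1)] rep_lclass(2)[OF assms(2)] by eventually_elim simp
  then show ?thesis by (simp add: L2_def lclass_eqI)
qed

lemma L2_scale:
  assumes "f \<in> lspace M"
  shows "hscale (L2 M) c (lclass M f) = lclass M (\<lambda>x. c * f x)"
proof -
  have "AE x in M. c * rep (lclass M f) x = c * f x"
    using rep_lclass(2)[OF assms(1)] by eventually_elim simp
  then show ?thesis by (simp add: L2_def lclass_eqI)
qed

lemma L2_diff:
  assumes "f \<in> lspace M" "g \<in> lspace M"
  shows "hdiff (L2 M) (lclass M f) (lclass M g) = lclass M (\<lambda>x. f x - g x)"
  using L2_add[OF assms(1) lspace_scale[OF assms(2), of "-1"]] assms by (simp add: hdiff_def L2_scale)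

lemma L2_inner:
  assumes "f \<in> lspace M" "g \<in> lspace M"
  shows "hinner (L2 M) (lclass M f) (lclass M g) = (\<integral>x. f x * g x \<partial>completion M)"
proof -
  have "AE x in M. rep (lclass M f) x * rep (lclass M g) x = f x * g x"
    using rep_lclass(2)[OF assms(1)] rep_lclass(2)[OF assms(2)] by eventually_elim simp
  then have "AE x in completion M. rep (lclass M f) x * rep (lclass M g) x = f x * g x"
    by (simp add: AE_completion_iff)
  then show ?thesis
    unfolding L2_def using assms rep_lclass(1)[OF assms(1)] rep_lclass(1)[OF assms(2)]
    by (auto intro!: integral_cong_AE borel_measurable_integrable lspace_product_integrable)
qed

section \<open>Multiplication operators and invariant sets\<close>

definition mult_class :: "'x measure \<Rightarrow> ('x \<Rightarrow> real) \<Rightarrow> ('x \<Rightarrow> real) set \<Rightarrow> ('x \<Rightarrow> real) set" where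
  "mult_class M g U = lclass M (\<lambda>x. g x * rep U x)"

lemma mult_class_lclass:
  "f \<in> lspace M \<Longrightarrow> mult_class M g (lclass M f) = lclass M (\<lambda>x. g x * f x)"
  unfolding mult_class_def using rep_lclass(2)[of f M] by (intro lclass_eqI) (auto elim: AE_mp)

lemma mult_class_linear:
  assumes g: "g \<in> borel_measurable (completion M)" "\<And>x. x \<in> space M \<Longrightarrow> \<bar>g x\<bar> \<le> c"
  shows "hlinear (L2 M) (L2 M) (mult_class M g)"
  unfolding hlinear_def
proof (intro conjI ballI allI Pi_I)
  fix U assume "U \<in> hcarrier (L2 M)"
  then show "mult_class M g U \<in> hcarrier (L2 M)"
    by (elim L2_carrierE) (simp add: mult_class_lclass lclass_carrier lspace_mult[OF _ g])
next
  fix U V assume "U \<in> hcarrier (L2 M)" "V \<in> hcarrier (L2 M)"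
  then show "mult_class M g (hadd (L2 M) U V) = hadd (L2 M) (mult_class M g U) (mult_class M g V)"
    by (elim L2_carrierE) (simp add: mult_class_lclass L2_add lspace_add lspace_mult[OF _ g] distrib_left)
next
  fix U a assume "U \<in> hcarrier (L2 M)"
  then show "mult_class M g (hscale (L2 M) a U) = hscale (L2 M) a (mult_class M g U)"
    by (elim L2_carrierE) (simp add: mult_class_lclass L2_scale lspace_scale lspace_mult[OF _ g] mult.left_commute)
qed

text \<open>The reflection \<open>2 * indicator A - 1\<close>: unlike the indicator, it multiplies
  square-integrable functions isometrically and is its own inverse, as
  \<open>semigroup_commutes\<close> requires.\<close>

definition signum :: "'x set \<Rightarrow> 'x \<Rightarrow> real" where
  "signum A x = (if x \<in> A then 1 else -1)"

lemma signum_simps [simp]: "signum A x * (signum A x * r) = r" "signum A x * r * (signum A x * q) = r * q" "\<bar>signum A x\<bar> = 1" "(signum A x)\<^sup>2 = 1"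
  by (simp_all add: signum_def)

lemma signum_measurable [measurable (raw)]:
  assumes [measurable]: "A \<in> sets M"
  shows "signum A \<in> borel_measurable M"
  unfolding signum_def by measurable

text \<open>Multiplication by \<open>1\<^sub>A\<close> is half the sum of the identity and the involution
  \<open>mult_class M (signum A)\<close>.\<close>

lemma invariant_set_signum:
  assumes F: "closed_form_space (L2 M) F" and A: "A \<in> sets M"
    and dom: "\<And>U. U \<in> qdom (L2 M) F \<Longrightarrow> mult_class M (signum A) U \<in> qdom (L2 M) F \<and> F (mult_class M (signum A) U) = F U"
  shows "invariant_set M F A"
proof -
  interpret closed_form_space "L2 M" F by fact
  let ?J = "mult_class M (signum A)"
  have g: "signum A \<in> borel_measurable (completion M)" "\<And>x. x \<in> space M \<Longrightarrow> \<bar>signum A x\<bar> \<le> 1"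
    using A by (auto intro: measurable_completion)
  have lin: "hlinear (L2 M) (L2 M) ?J" by (rule mult_class_linear[OF g])
  have half: "mult_indicator M A U = hscale (L2 M) (1/2) (hadd (L2 M) U (?J U))" if U: "U \<in> hcarrier (L2 M)" for U
  proof -
    obtain f where f: "f \<in> lspace M" "U = lclass M f" using U by (rule L2_carrierE)
    have "mult_indicator M A U = lclass M (\<lambda>x. 1/2 * (f x + signum A x * f x))"
      unfolding mult_indicator_def f(2) using rep_lclass(2)[OF f(1)]
      by (intro lclass_eqI) (auto elim!: AE_mp simp: signum_def)
    then show ?thesis
      using f by (simp add: mult_class_lclass L2_add L2_scale lspace_add lspace_mult[OF _ g])
  qed
  show ?thesis
    unfolding invariant_set_def
  proof (intro conjI allI impI ballI)
    show "A \<in> sets (completion M)" using A by simp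
    fix P U and t :: real
    assume P: "associated_semigroup (L2 M) F P" and U: "U \<in> hcarrier (L2 M)" and t: "0 < t"
    have comm: "P t (?J U) = ?J (P t U)"
    proof (rule semigroup_commutes[OF P lin])
      fix x y assume "x \<in> hcarrier (L2 M)" "y \<in> hcarrier (L2 M)"
      then show "hinner (L2 M) (?J x) (?J y) = hinner (L2 M) x y"
        by (elim L2_carrierE)
          (simp add: mult_class_lclass L2_inner lspace_mult[OF _ g])
    next
      fix x assume "x \<in> hcarrier (L2 M)"
      then show "?J (?J x) = x"
        by (elim L2_carrierE) (simp add: mult_class_lclass lspace_mult[OF _ g])
    qed (use dom t U in auto)
    have lin': "hlinear (L2 M) (L2 M) (P t)" using P t by (auto simp: associated_semigroup_def)
    have PU: "P t U \<in> hcarrier (L2 M)" and JU: "?J U \<in> hcarrier (L2 M)"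
      using lin lin' U by (auto simp: hlinear_def)
    have "P t (mult_indicator M A U) = hscale (L2 M) (1/2) (hadd (L2 M) (P t U) (P t (?J U)))"
      unfolding half[OF U] using lin' U JU by (simp add: hlinear_def add_closed)
    then show "P t (mult_indicator M A U) = mult_indicator M A (P t U)"
      by (simp add: half[OF PU] comm)
  qed
qed

text \<open>\<open>M\<close> is \<open>N\<close> with a constant density, and the same relation
  passes to the completions. As \<open>c\<close> is positive, null sets and integrability are
  unchanged, so the classes are literally the same sets and forms over \<open>M\<close> and over
  \<open>N\<close> can be evaluated at the same argument.\<close>

lemma L2_proportional:
  assumes sets: "sets M = sets N" and c: "0 < c"
    and M: "\<And>A. A \<in> sets N \<Longrightarrow> emeasure M A = ennreal c * emeasure N A"
  shows "lspace M = lspace N" "lclass M = lclass N"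
    "\<And>f g. \<lbrakk>f \<in> lspace N; g \<in> lspace N\<rbrakk> \<Longrightarrow>
      hinner (L2 M) (lclass M f) (lclass M g) = c * hinner (L2 N) (lclass N f) (lclass N g)"
proof -
  have eq: "M = density N (\<lambda>_. ennreal c)"
    using sets M by (intro measure_eqI) (auto simp: emeasure_density_const)
  then have compl: "completion M = density (completion N) (\<lambda>_. ennreal c)"
    using completion_density_eq[of "\<lambda>_. ennreal c" N] c by simp
  have "integrable (completion M) f \<longleftrightarrow> integrable (completion N) f"
    if "f \<in> borel_measurable (completion N)" for f :: "_ \<Rightarrow> real"
    unfolding compl using that c by (subst integrable_density) auto
  then show l: "lspace M = lspace N"
    by (auto simp: lspace_def compl)
  have "(AE x in M. P x) \<longleftrightarrow> (AE x in N. P x)" for P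
    unfolding eq using c by (subst AE_density) auto
  then show lc: "lclass M = lclass N" by (simp add: aeclass_def fun_eq_iff l)
  fix f g assume fg: "f \<in> lspace N" "g \<in> lspace N"
  then have "(\<lambda>x. f x * g x) \<in> borel_measurable (completion N)"
    using lspace_measurable[of f N] lspace_measurable[of g N] by measurable
  then show "hinner (L2 M) (lclass M f) (lclass M g) = c * hinner (L2 N) (lclass N f) (lclass N g)"
    using fg c L2_inner[of f M g] by (simp add: l L2_inner compl integral_density)
qed

lemma L2_carrier_proportional:
  assumes "lclass M = lclass N" "lspace M = lspace N"
  shows "hcarrier (L2 M) = hcarrier (L2 N)" "hadd (L2 M) = hadd (L2 N)" "hscale (L2 M) = hscale (L2 N)"
    "hdiff (L2 M) = hdiff (L2 N)"
proof -
  have eq: "lclass M U = lclass N U" for U using assms(1) by (rule fun_cong)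
  show "hcarrier (L2 M) = hcarrier (L2 N)" unfolding L2_def by (simp add: eq) (simp add: assms(2))
  show a: "hadd (L2 M) = hadd (L2 N)" unfolding L2_def by (simp add: eq)
  show s: "hscale (L2 M) = hscale (L2 N)" unfolding L2_def by (simp add: eq)
  show "hdiff (L2 M) = hdiff (L2 N)" by (simp add: hdiff_def a s fun_eq_iff)
qed

section \<open>Decompositions of a form\<close>

text \<open>Replacing both functions by Borel versions reduces this to uniqueness of densities over
  a finite measure, which admits infinite values and infinite integrals.\<close>

lemma completion_AE_eq_if_nn_integral_eq:
  assumes "finite_measure M"
    and f: "f \<in> borel_measurable (completion M)" and g: "g \<in> borel_measurable (completion M)"
    and eq: "\<And>A. A \<in> sets M \<Longrightarrow> (\<integral>\<^sup>+x. f x * indicator A x \<partial>M) = (\<integral>\<^sup>+x. g x * indicator A x \<partial>M)"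
  shows "AE x in M. f x = (g x :: ennreal)"
proof -
  interpret finite_measure M by fact
  obtain f' g' where f': "f' \<in> borel_measurable M" "AE x in M. f x = f' x"
    and g': "g' \<in> borel_measurable M" "AE x in M. g x = g' x"
    using completion_ex_borel_measurable[OF f] completion_ex_borel_measurable[OF g] by blast
  have "AE x in M. f' x = g' x"
  proof (rule density_unique_finite_measure)
    fix A assume "A \<in> sets M"
    moreover have "(\<integral>\<^sup>+x. f' x * indicator A x \<partial>M) = (\<integral>\<^sup>+x. f x * indicator A x \<partial>M)"
      using f'(2) by (intro nn_integral_cong_AE) (auto elim: AE_mp)
    moreover have "(\<integral>\<^sup>+x. g' x * indicator A x \<partial>M) = (\<integral>\<^sup>+x. g x * indicator A x \<partial>M)"
      using g'(2) by (intro nn_integral_cong_AE) (auto elim: AE_mp)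
    ultimately show "(\<integral>\<^sup>+x. f' x * indicator A x \<partial>M) = (\<integral>\<^sup>+x. g' x * indicator A x \<partial>M)"
      using eq by simp
  qed (use f' g' in auto)
  with f'(2) g'(2) show ?thesis by eventually_elim simp
qed

lemma AE_completion_set:
  assumes "A \<in> sets (completion M)"
  obtains B where "B \<in> sets M" "AE x in M. x \<in> A \<longleftrightarrow> x \<in> B"
proof -
  obtain S N N' where S: "A = S \<union> N" "N \<subseteq> N'" "N' \<in> null_sets M" "S \<in> sets M"
    using assms by (rule sets_completionE)
  have "AE x in M. x \<in> A \<longleftrightarrow> x \<in> S"
    using AE_not_in[OF S(3)] by eventually_elim (use S in auto)
  with S(4) show thesis by (rule that)
qed

text \<open>The underlying spaces \<open>SH\<close>, \<open>SQ\<close> and the generating space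
  \<open>\<A>\<close> are existentially bound in the definition of an ergodic decomposition. As
  parameters, they allow two decompositions of the same form to be interpreted side by side.\<close>

locale decomposition =
  fixes M :: "'x measure" and E :: "('x \<Rightarrow> real) set \<Rightarrow> ennreal"
    and \<nu> :: "'z measure" and s :: "'x \<Rightarrow> 'z" and m :: "'z \<Rightarrow> 'x measure"
    and F :: "'z \<Rightarrow> ('x \<Rightarrow> real) set \<Rightarrow> ennreal"
    and SH SQ :: "('z \<Rightarrow> ('x \<Rightarrow> real) set) set" and \<A> :: "('x \<Rightarrow> real) set"
  assumes prob: "prob_space \<nu>"
    and singletons: "separable_measure \<nu>"
    and countably_generated: "countably_generated_measure \<nu>"
    and s_measurable [measurable]: "s \<in> M \<rightarrow>\<^sub>M \<nu>"
    and disintegration: "pseudo_disintegration M \<nu> m"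
    and consistent: "strongly_consistent M \<nu> m s"
    and irreducible: "\<And>\<zeta>. \<zeta> \<in> space \<nu> \<Longrightarrow> irreducible_form (m \<zeta>) (F \<zeta>)"
    and form_field: "measurable_form_field \<nu> (\<lambda>\<zeta>. L2 (m \<zeta>)) F SH SQ"
    and \<A>: "dense_function_space M \<A>" "lclass M ` \<A> \<subseteq> qdom (L2 M) E"
    and generates: "generates_field \<nu> (\<lambda>\<zeta>. form_space (L2 (m \<zeta>)) (F \<zeta>)) (delta_field \<nu> m ` \<A>) SQ"
    and E_eq: "\<And>U. U \<in> hcarrier (L2 M) \<Longrightarrow>
      E U = direct_integral_form \<nu> (\<lambda>\<zeta>. L2 (m \<zeta>)) F SQ (delta_map \<nu> m SH U)"

lemma ergodic_decompositionE:
  assumes "ergodic_decomposition T M E \<nu> s m F"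
  obtains SH SQ \<A> where "decomposition M E \<nu> s m F SH SQ \<A>"
proof -
  have *: "prob_space \<nu>" "separable_measure \<nu>" "countably_generated_measure \<nu>" "s \<in> M \<rightarrow>\<^sub>M \<nu>"
    "pseudo_disintegration M \<nu> m" "strongly_consistent M \<nu> m s"
    "\<And>\<zeta>. \<zeta> \<in> space \<nu> \<Longrightarrow> irreducible_form (m \<zeta>) (F \<zeta>)"
    "direct_integral_of_dirichlet_forms M E \<nu> m F"
    using assms unfolding ergodic_decomposition_def by simp_all
  obtain SH SQ \<A> where "measurable_form_field \<nu> (\<lambda>\<zeta>. L2 (m \<zeta>)) F SH SQ"
      "dense_function_space M \<A>" "lclass M ` \<A> \<subseteq> qdom (L2 M) E"
      "generates_field \<nu> (\<lambda>\<zeta>. form_space (L2 (m \<zeta>)) (F \<zeta>)) (delta_field \<nu> m ` \<A>) SQ"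
      "\<forall>U\<in>hcarrier (L2 M). E U = direct_integral_form \<nu> (\<lambda>\<zeta>. L2 (m \<zeta>)) F SQ (delta_map \<nu> m SH U)"
    using *(8) unfolding direct_integral_of_dirichlet_forms_def by (elim conjE exE) (rule that)
  with * have "decomposition M E \<nu> s m F SH SQ \<A>"
    by (intro decomposition.intro) simp_all
  then show thesis by (rule that)
qed

section \<open>Fibre measures: null sets, integrals and the quotient map\<close>

context decomposition
begin

sublocale prob_space \<nu> by (rule prob)

lemma sets_m: "\<zeta> \<in> space \<nu> \<Longrightarrow> sets (m \<zeta>) = sets M"
  using disintegration by (simp add: pseudo_disintegration_def)

lemma space_m: "\<zeta> \<in> space \<nu> \<Longrightarrow> space (m \<zeta>) = space M"
  using sets_m by (rule sets_eq_imp_space_eq)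

lemma m_nonzero: "\<zeta> \<in> space \<nu> \<Longrightarrow> emeasure (m \<zeta>) (space M) \<noteq> 0"
  using disintegration by (simp add: pseudo_disintegration_def)

lemma emeasure_m_measurable: "A \<in> sets M \<Longrightarrow> (\<lambda>\<zeta>. emeasure (m \<zeta>) A) \<in> borel_measurable (completion \<nu>)"
  using disintegration by (simp add: pseudo_disintegration_def)

lemma emeasure_eq: "A \<in> sets M \<Longrightarrow> emeasure M A = (\<integral>\<^sup>+\<zeta>. emeasure (m \<zeta>) A \<partial>completion \<nu>)"
  using disintegration by (simp add: pseudo_disintegration_def)

lemma emeasure_Int_eq:
  "\<lbrakk>A \<in> sets M; B \<in> sets \<nu>\<rbrakk> \<Longrightarrow>
    emeasure M (A \<inter> (s -` B \<inter> space M)) = (\<integral>\<^sup>+\<zeta>. emeasure (m \<zeta>) A * indicator B \<zeta> \<partial>\<nu>)"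
  using consistent by (simp add: strongly_consistent_def nn_integral_completion)

lemma null_sets_iff:
  assumes N: "N \<in> sets M"
  shows "N \<in> null_sets M \<longleftrightarrow> (AE \<zeta> in \<nu>. N \<in> null_sets (m \<zeta>))"
proof -
  have "N \<in> null_sets M \<longleftrightarrow> (AE \<zeta> in completion \<nu>. emeasure (m \<zeta>) N = 0)"
    using N emeasure_m_measurable[OF N]
    by (simp add: null_sets_def emeasure_eq nn_integral_0_iff_AE)
  also have "\<dots> \<longleftrightarrow> (AE \<zeta> in \<nu>. N \<in> null_sets (m \<zeta>))"
    unfolding AE_completion_iff using N by (intro AE_cong) (auto simp: null_sets_def sets_m)
  finally show ?thesis .
qed

lemma AE_emeasure_finite:
  assumes A: "A \<in> sets M" "emeasure M A < \<infinity>"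
  shows "AE \<zeta> in \<nu>. emeasure (m \<zeta>) A < \<infinity>"
proof -
  have "AE \<zeta> in completion \<nu>. emeasure (m \<zeta>) A \<noteq> \<infinity>"
    using A emeasure_eq[OF A(1)] by (intro nn_integral_PInf_AE emeasure_m_measurable) auto
  then show ?thesis by (simp add: AE_completion_iff less_top)
qed

lemma AE_fibre_measures:
  assumes "AE x in M. P x"
  shows "AE \<zeta> in \<nu>. AE x in m \<zeta>. P x"
proof -
  obtain N where N: "{x \<in> space M. \<not> P x} \<subseteq> N" "N \<in> null_sets M"
    using assms by (auto simp: eventually_ae_filter)
  then have "AE \<zeta> in \<nu>. N \<in> null_sets (m \<zeta>)" using null_sets_iff by auto
  with AE_space show ?thesis
  proof eventually_elim
    case (elim \<zeta>)
    then show ?case using N by (intro AE_I'[of N]) (auto simp: space_m)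
  qed
qed

lemma AE_fibre: "AE \<zeta> in \<nu>. AE x in m \<zeta>. s x = \<zeta>"
proof -
  have "AE \<zeta> in \<nu>. conegligible (m \<zeta>) (fibre M s \<zeta>)"
    using consistent by (simp add: strongly_consistent_def)
  with AE_space show ?thesis
  proof eventually_elim
    case (elim \<zeta>)
    then have "AE x in completion (m \<zeta>). x \<notin> space (m \<zeta>) - fibre M s \<zeta>"
      by (intro AE_not_in) (simp add: conegligible_def)
    then have "AE x in m \<zeta>. x \<notin> space (m \<zeta>) - fibre M s \<zeta>" by (simp only: AE_completion_iff)
    then show ?case using AE_space by eventually_elim (auto simp: fibre_def)
  qed
qed

text \<open>Induction over measurable functions, starting from the disintegration of sets.
  Measurability in \<open>\<zeta>\<close> belongs to the claim because the outer integral is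
  additive and monotonically continuous only for measurable integrands.\<close>

lemma nn_integral_eq:
  assumes "f \<in> borel_measurable M"
  shows "(\<lambda>\<zeta>. \<integral>\<^sup>+x. f x \<partial>m \<zeta>) \<in> borel_measurable (completion \<nu>) \<and>
    (\<integral>\<^sup>+x. f x \<partial>M) = (\<integral>\<^sup>+\<zeta>. \<integral>\<^sup>+x. f x \<partial>m \<zeta> \<partial>completion \<nu>)"
proof -
  \<comment> \<open>The inner integrals are computed only for \<open>\<zeta>\<close> in
    \<open>space \<nu>\<close>; this congruence treats measurability and integral together.\<close>
  have transfer: "a \<in> borel_measurable (completion \<nu>) \<and> r = integral\<^sup>N (completion \<nu>) a"
    if "\<And>\<zeta>. \<zeta> \<in> space \<nu> \<Longrightarrow> a \<zeta> = b \<zeta>" "b \<in> borel_measurable (completion \<nu>)"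
      "r = integral\<^sup>N (completion \<nu>) b" for a b :: "'z \<Rightarrow> ennreal" and r
  proof
    have eq: "\<And>\<zeta>. \<zeta> \<in> space (completion \<nu>) \<Longrightarrow> a \<zeta> = b \<zeta>" using that(1) by simp
    show "a \<in> borel_measurable (completion \<nu>)" using that(2) eq by (subst measurable_cong[OF eq])
    show "r = integral\<^sup>N (completion \<nu>) a" unfolding that(3) by (rule nn_integral_cong) (simp add: eq)
  qed
  show ?thesis
    using assms
  proof (induction f rule: borel_measurable_induct)
    case (cong f g)
    have "(\<integral>\<^sup>+x. f x \<partial>M) = (\<integral>\<^sup>+x. g x \<partial>M)" using cong(3) by (rule nn_integral_cong)
    then show ?case using cong(3,4)
      by (intro transfer[of _ "\<lambda>\<zeta>. integral\<^sup>N (m \<zeta>) g"]) (auto intro: nn_integral_cong simp: space_m)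
  next
    case (set A)
    then show ?case
      by (intro transfer[of _ "\<lambda>\<zeta>. emeasure (m \<zeta>) A"]) (auto simp: sets_m emeasure_m_measurable emeasure_eq)
  next
    case (mult u c)
    then show ?case
      by (intro transfer[of _ "\<lambda>\<zeta>. c * integral\<^sup>N (m \<zeta>) u"])
        (auto intro!: nn_integral_cmult simp: nn_integral_cmult sets_m cong: measurable_cong_sets)
  next
    case (add u v)
    then show ?case
      by (intro transfer[of _ "\<lambda>\<zeta>. integral\<^sup>N (m \<zeta>) v + integral\<^sup>N (m \<zeta>) u"])
        (auto intro!: nn_integral_add simp: nn_integral_add sets_m cong: measurable_cong_sets)
  next
    case (seq U)
    have eq: "(\<integral>\<^sup>+x. (SUP i. U i x) \<partial>m \<zeta>) = (SUP i. \<integral>\<^sup>+x. U i x \<partial>m \<zeta>)" if "\<zeta> \<in> space \<nu>" for \<zeta>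
      using seq that by (intro nn_integral_monotone_convergence_SUP) (simp_all cong: measurable_cong_sets add: sets_m)
    have "(\<integral>\<^sup>+x. (SUP i. U i x) \<partial>M) = (SUP i. \<integral>\<^sup>+x. U i x \<partial>M)"
      using seq by (intro nn_integral_monotone_convergence_SUP)
    also have "\<dots> = (SUP i. \<integral>\<^sup>+\<zeta>. \<integral>\<^sup>+x. U i x \<partial>m \<zeta> \<partial>completion \<nu>)"
      using seq by simp
    also have "\<dots> = (\<integral>\<^sup>+\<zeta>. (SUP i. \<integral>\<^sup>+x. U i x \<partial>m \<zeta>) \<partial>completion \<nu>)"
      using seq by (intro nn_integral_monotone_convergence_SUP[symmetric])
        (auto simp: incseq_def le_fun_def intro!: nn_integral_mono)
    finally have int: "(\<integral>\<^sup>+x. (SUP i. U i x) \<partial>M) = (\<integral>\<^sup>+\<zeta>. (SUP i. \<integral>\<^sup>+x. U i x \<partial>m \<zeta>) \<partial>completion \<nu>)" .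
    have "(\<lambda>\<zeta>. SUP i. \<integral>\<^sup>+x. U i x \<partial>m \<zeta>) \<in> borel_measurable (completion \<nu>)"
      using seq by (intro borel_measurable_SUP) auto
    with int seq eq show ?case
      by (intro transfer[of _ "\<lambda>\<zeta>. SUP i. \<integral>\<^sup>+x. U i x \<partial>m \<zeta>"]) (auto simp: image_comp)
  qed
qed

text \<open>\<open>f\<close> is measurable for the completion of \<open>M\<close>, which says
  nothing about an individual \<open>m \<zeta>\<close>. A Borel version of \<open>f\<close> is
  measurable for all of them and agrees with \<open>f\<close> on almost every fibre.\<close>

lemma AE_lspace:
  assumes f: "f \<in> lspace M"
  shows "AE \<zeta> in \<nu>. f \<in> lspace (m \<zeta>)"
proof -
  obtain g where g: "g \<in> borel_measurable M" "AE x in M. f x = g x"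
    using completion_ex_borel_measurable_real[OF lspace_measurable[OF f]] by blast
  have g2: "(\<lambda>x. ennreal ((g x)\<^sup>2)) \<in> borel_measurable M" using g(1) by measurable
  have "(\<integral>\<^sup>+x. ennreal ((g x)\<^sup>2) \<partial>M) = (\<integral>\<^sup>+x. ennreal ((f x)\<^sup>2) \<partial>completion M)"
    unfolding nn_integral_completion using g(2) by (intro nn_integral_cong_AE) (auto elim: AE_mp)
  also have "\<dots> < \<infinity>" using f by (simp add: lspace_iff_nn_integral)
  finally have "(\<integral>\<^sup>+\<zeta>. \<integral>\<^sup>+x. ennreal ((g x)\<^sup>2) \<partial>m \<zeta> \<partial>completion \<nu>) \<noteq> \<infinity>"
    using nn_integral_eq[OF g2] by (simp add: nn_integral_completion)
  then have "AE \<zeta> in completion \<nu>. (\<integral>\<^sup>+x. ennreal ((g x)\<^sup>2) \<partial>m \<zeta>) \<noteq> \<infinity>"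
    using nn_integral_eq[OF g2] by (intro nn_integral_PInf_AE) auto
  then have "AE \<zeta> in \<nu>. (\<integral>\<^sup>+x. ennreal ((g x)\<^sup>2) \<partial>m \<zeta>) \<noteq> \<infinity>" by (simp only: AE_completion_iff)
  with AE_space AE_fibre_measures[OF g(2)] show ?thesis
  proof eventually_elim
    case (elim \<zeta>)
    have "g \<in> borel_measurable (m \<zeta>)" using g(1) sets_m[OF elim(1)] by (simp cong: measurable_cong_sets)
    then have "g \<in> lspace (m \<zeta>)"
      using elim(3) by (simp add: lspace_iff_nn_integral nn_integral_completion measurable_completion less_top)
    then show ?case by (rule lspace_cong_AE) (use elim(2) in \<open>auto elim: AE_mp\<close>)
  qed
qed

text \<open>Almost every \<open>m \<zeta>\<close> is non-zero and concentrated on the fibre over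
  \<open>\<zeta>\<close>; it therefore gives the preimage of \<open>B\<close> measure 0 exactly when
  \<open>\<zeta>\<close> lies outside \<open>B\<close>.\<close>

lemma null_sets_vimage_iff:
  assumes B: "B \<in> sets \<nu>"
  shows "s -` B \<inter> space M \<in> null_sets M \<longleftrightarrow> B \<in> null_sets \<nu>"
proof -
  have "s -` B \<inter> space M \<in> null_sets M \<longleftrightarrow> (AE \<zeta> in \<nu>. s -` B \<inter> space M \<in> null_sets (m \<zeta>))"
    using B by (intro null_sets_iff) measurable
  also have "\<dots> \<longleftrightarrow> (AE \<zeta> in \<nu>. \<zeta> \<notin> B)"
  proof (intro eventually_subst, use AE_space AE_fibre in eventually_elim)
    case (elim \<zeta>)
    have "s -` B \<inter> space M \<in> sets (m \<zeta>)" using B elim by (simp add: sets_m measurable_sets)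
    then have "s -` B \<inter> space M \<in> null_sets (m \<zeta>) \<longleftrightarrow> (AE x in m \<zeta>. x \<notin> s -` B \<inter> space M)"
      by (simp add: AE_iff_null_sets)
    also have "\<dots> \<longleftrightarrow> (AE x in m \<zeta>. \<zeta> \<notin> B)"
      by (intro eventually_subst, use AE_space elim(2) in eventually_elim) (use elim(1) space_m in auto)
    also have "\<dots> \<longleftrightarrow> \<zeta> \<notin> B"
    proof -
      have "\<not> (AE x in m \<zeta>. False)"
        using AE_E2[of "\<lambda>_. False" "m \<zeta>"] m_nonzero[OF elim(1)] space_m[OF elim(1)] by auto
      then show ?thesis by auto
    qed
    finally show ?case .
  qed
  also have "\<dots> \<longleftrightarrow> B \<in> null_sets \<nu>" using B by (simp add: AE_iff_null_sets)
  finally show ?thesis .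
qed

section \<open>Energy densities and localisation along the quotient map\<close>

definition dom :: "('x \<Rightarrow> real) \<Rightarrow> bool" where
  "dom f \<longleftrightarrow> f \<in> lspace M \<and> lclass M f \<in> qdom (L2 M) E"

definition energy :: "('x \<Rightarrow> real) \<Rightarrow> 'z \<Rightarrow> ennreal" where
  "energy f \<zeta> = F \<zeta> (lclass (m \<zeta>) f)"

text \<open>The fields over which \<open>direct_integral_form\<close> takes its infimum at the class
  of \<open>f\<close>. Such a field lies in the form domain over every \<open>\<zeta>\<close>, while
  \<open>f\<close> itself does so only over almost every one.\<close>

definition repr :: "('x \<Rightarrow> real) \<Rightarrow> ('z \<Rightarrow> ('x \<Rightarrow> real) set) \<Rightarrow> bool" where
  "repr f u \<longleftrightarrow> u \<in> SQ \<and> (AE \<zeta> in \<nu>. u \<zeta> = lclass (m \<zeta>) f) \<and>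
     (\<integral>\<^sup>+\<zeta>. F \<zeta> (u \<zeta>) + ennreal ((hnorm (L2 (m \<zeta>)) (u \<zeta>))\<^sup>2) \<partial>\<nu>) < \<infinity>"

lemma closed_form_space: "\<zeta> \<in> space \<nu> \<Longrightarrow> closed_form_space (L2 (m \<zeta>)) (F \<zeta>)"
  using form_field unfolding measurable_form_field_def measurable_hilbert_field_def
  by (intro closed_form_space.intro closed_form_space_axioms.intro) auto

lemma SQ_field: "measurable_hilbert_field \<nu> (\<lambda>\<zeta>. form_space (L2 (m \<zeta>)) (F \<zeta>)) SQ"
  using form_field unfolding measurable_form_field_def by blast

lemma SH_field: "measurable_hilbert_field \<nu> (\<lambda>\<zeta>. L2 (m \<zeta>)) SH"
  using form_field unfolding measurable_form_field_def by blast

lemma SQ_subset: "SQ \<subseteq> SH"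
  using form_field unfolding measurable_form_field_def by blast

lemma SQ_qdom: "u \<in> SQ \<Longrightarrow> \<zeta> \<in> space \<nu> \<Longrightarrow> u \<zeta> \<in> qdom (L2 (m \<zeta>)) (F \<zeta>)"
  using SQ_field unfolding measurable_hilbert_field_def field_linear_subspace_def by (auto simp: PiE_iff)

text \<open>The energy is the squared form norm minus the squared Hilbert norm, and
  \<open>SQ \<subseteq> SH\<close> makes both norms measurable along \<open>u\<close>.\<close>

lemma F_measurable:
  assumes u: "u \<in> SQ"
  shows "(\<lambda>\<zeta>. F \<zeta> (u \<zeta>)) \<in> borel_measurable (completion \<nu>)"
proof -
  have [measurable]: "(\<lambda>\<zeta>. hnorm (form_space (L2 (m \<zeta>)) (F \<zeta>)) (u \<zeta>)) \<in> borel_measurable (completion \<nu>)"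
    using SQ_field u unfolding measurable_hilbert_field_def measurable_norms_def by blast
  have [measurable]: "(\<lambda>\<zeta>. hnorm (L2 (m \<zeta>)) (u \<zeta>)) \<in> borel_measurable (completion \<nu>)"
    using SH_field SQ_subset u unfolding measurable_hilbert_field_def measurable_norms_def by blast
  have eq: "F \<zeta> (u \<zeta>) = ennreal ((hnorm (form_space (L2 (m \<zeta>)) (F \<zeta>)) (u \<zeta>))\<^sup>2 - (hnorm (L2 (m \<zeta>)) (u \<zeta>))\<^sup>2)"
    if \<zeta>: "\<zeta> \<in> space (completion \<nu>)" for \<zeta>
  proof -
    interpret Q: closed_form_space "L2 (m \<zeta>)" "F \<zeta>" using \<zeta> by (simp add: closed_form_space)
    show ?thesis
      using Q.Q_eq[OF SQ_qdom[OF u]] Q.K_hnorm_sq[OF SQ_qdom[OF u]] \<zeta> by simp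
  qed
  show ?thesis by (subst measurable_cong[OF eq]) measurable
qed

text \<open>A field space is closed under constant scalars by definition; closure under scalar
  functions follows from its maximality, since membership can be tested by inner products with the
  fields of \<open>SQ\<close>. Polarisation reduces these inner products to measurable
  norms.\<close>

lemma SQ_scale:
  assumes u: "u \<in> SQ" and \<theta>: "\<theta> \<in> borel_measurable \<nu>"
  shows "(\<lambda>\<zeta>\<in>space \<nu>. hscale (L2 (m \<zeta>)) (\<theta> \<zeta>) (u \<zeta>)) \<in> SQ" (is "?v \<in> SQ")
proof -
  let ?K = "\<lambda>\<zeta>. form_space (L2 (m \<zeta>)) (F \<zeta>)"
  have norms: "(\<lambda>\<zeta>. hnorm (?K \<zeta>) (w \<zeta>)) \<in> borel_measurable (completion \<nu>)" if "w \<in> SQ" for w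
    using SQ_field that unfolding measurable_hilbert_field_def measurable_norms_def by blast
  have "(\<lambda>\<zeta>. hinner (?K \<zeta>) (w \<zeta>) (?v \<zeta>)) \<in> borel_measurable (completion \<nu>)" if w: "w \<in> SQ" for w
  proof -
    define x where "x = (\<lambda>\<zeta>\<in>space \<nu>. hadd (L2 (m \<zeta>)) (w \<zeta>) (u \<zeta>))"
    have x: "x \<in> SQ"
      using SQ_field u w unfolding measurable_hilbert_field_def field_linear_subspace_def x_def by simp
    note [measurable] = norms[OF x] norms[OF u] norms[OF w] measurable_completion[OF \<theta>]
    have eq: "hinner (?K \<zeta>) (w \<zeta>) (?v \<zeta>)
        = \<theta> \<zeta> * (((hnorm (?K \<zeta>) (x \<zeta>))\<^sup>2 - (hnorm (?K \<zeta>) (u \<zeta>))\<^sup>2 - (hnorm (?K \<zeta>) (w \<zeta>))\<^sup>2) / 2)"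
      if \<zeta>: "\<zeta> \<in> space (completion \<nu>)" for \<zeta>
    proof -
      interpret Q: closed_form_space "L2 (m \<zeta>)" "F \<zeta>" using \<zeta> by (simp add: closed_form_space)
      have cl: "u \<zeta> \<in> qdom (L2 (m \<zeta>)) (F \<zeta>)" "w \<zeta> \<in> qdom (L2 (m \<zeta>)) (F \<zeta>)"
        "x \<zeta> \<in> qdom (L2 (m \<zeta>)) (F \<zeta>)"
        using SQ_qdom u w x \<zeta> by auto
      show ?thesis
        using cl \<zeta> Q.K.inner_commute[of "u \<zeta>" "w \<zeta>"] Q.K.hnorm_sq[of "x \<zeta>"] Q.K.hnorm_sq[of "u \<zeta>"]
          Q.K.hnorm_sq[of "w \<zeta>"] Q.K.inner_scale_right[of "w \<zeta>" "u \<zeta>" "\<theta> \<zeta>"]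
          Q.K.inner_add[of "w \<zeta>" "u \<zeta>" "x \<zeta>"] Q.K.inner_add_right[of "u \<zeta>" "w \<zeta>" "u \<zeta>"]
          Q.K.inner_add_right[of "w \<zeta>" "w \<zeta>" "u \<zeta>"]
        by (simp add: x_def del: form_space_simps(6))
    qed
    show ?thesis by (subst measurable_cong[OF eq]) measurable
  qed
  moreover have "?v \<in> (\<Pi>\<^sub>E \<zeta>\<in>space \<nu>. hcarrier (?K \<zeta>))"
  proof (rule PiE_I)
    fix \<zeta> assume \<zeta>: "\<zeta> \<in> space \<nu>"
    interpret Q: closed_form_space "L2 (m \<zeta>)" "F \<zeta>" using \<zeta> by (rule closed_form_space)
    show "?v \<zeta> \<in> hcarrier (?K \<zeta>)" using SQ_qdom[OF u \<zeta>] \<zeta> by (simp add: Q.qdom_closed)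
  qed simp
  ultimately show ?thesis using SQ_field unfolding measurable_hilbert_field_def by blast
qed

lemma delta_AE:
  assumes f: "f \<in> lspace M" and "AE x in M. g x = f x"
  shows "AE \<zeta> in \<nu>. delta_field \<nu> m g \<zeta> = lclass (m \<zeta>) f"
  using AE_space AE_lspace[OF f] AE_fibre_measures[OF assms(2)]
proof eventually_elim
  case (elim \<zeta>)
  have "g \<in> lspace (m \<zeta>)" by (rule lspace_cong_AE[OF elim(2)]) (use elim(3) in \<open>auto elim: AE_mp\<close>)
  then show ?case using elim lclass_eqI[OF elim(3)] by (simp add: delta_field_def)
qed

text \<open>Representatives of the same class differ on an \<open>M\<close>-null set, which is null
  on almost every fibre, so the choice made by \<open>rep\<close> disappears. A finite form norm
  also implies the square-integrability that membership in \<open>delta_map\<close> asks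
  for.\<close>

lemma delta_map_iff:
  assumes f: "f \<in> lspace M"
  shows "v \<in> SQ \<inter> delta_map \<nu> m SH (lclass M f) \<and>
      (\<integral>\<^sup>+\<zeta>. F \<zeta> (v \<zeta>) + ennreal ((hnorm (L2 (m \<zeta>)) (v \<zeta>))\<^sup>2) \<partial>completion \<nu>) < \<infinity> \<longleftrightarrow> repr f v"
proof -
  have "AE \<zeta> in \<nu>. delta_field \<nu> m (rep (lclass M f)) \<zeta> = lclass (m \<zeta>) f"
    using f rep_lclass(2)[OF f] by (rule delta_AE)
  then have *: "(AE \<zeta> in \<nu>. delta_field \<nu> m (rep (lclass M f)) \<zeta> = v \<zeta>) \<longleftrightarrow> (AE \<zeta> in \<nu>. v \<zeta> = lclass (m \<zeta>) f)"
    by (intro eventually_subst) (auto elim!: AE_mp)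
  define L where "L = (\<integral>\<^sup>+\<zeta>. F \<zeta> (v \<zeta>) + ennreal ((hnorm (L2 (m \<zeta>)) (v \<zeta>))\<^sup>2) \<partial>\<nu>)"
  have mem: "v \<in> delta_map \<nu> m SH (lclass M f) \<longleftrightarrow>
      (v \<in> SH \<and> (\<integral>\<^sup>+\<zeta>. ennreal ((hnorm (L2 (m \<zeta>)) (v \<zeta>))\<^sup>2) \<partial>\<nu>) < \<infinity>) \<and> (AE \<zeta> in \<nu>. v \<zeta> = lclass (m \<zeta>) f)"
    by (simp add: delta_map_def aeclass_def[of \<nu>] sq_integrable_fields_def nn_integral_completion *)
  have "(\<integral>\<^sup>+\<zeta>. ennreal ((hnorm (L2 (m \<zeta>)) (v \<zeta>))\<^sup>2) \<partial>\<nu>) \<le> L"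
    unfolding L_def by (intro nn_integral_mono) simp
  then have "L < \<infinity> \<Longrightarrow> (\<integral>\<^sup>+\<zeta>. ennreal ((hnorm (L2 (m \<zeta>)) (v \<zeta>))\<^sup>2) \<partial>\<nu>) < \<infinity>"
    by (rule order_le_less_trans)
  then show ?thesis
    unfolding Int_iff mem repr_def nn_integral_completion L_def[symmetric] using SQ_subset by blast
qed

lemma delta_map_Collect:
  assumes "f \<in> lspace M"
  shows "{v \<in> SQ \<inter> delta_map \<nu> m SH (lclass M f).
      (\<integral>\<^sup>+\<zeta>. F \<zeta> (v \<zeta>) + ennreal ((hnorm (L2 (m \<zeta>)) (v \<zeta>))\<^sup>2) \<partial>completion \<nu>) < \<infinity>} = {v. repr f v}"
  using delta_map_iff[OF assms] by blast

text \<open>All representing fields agree almost everywhere, so the infimum defining the direct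
  integral runs over a constant family.\<close>

lemma repr_energy:
  assumes f: "f \<in> lspace M" and u: "repr f u"
  shows "E (lclass M f) = (\<integral>\<^sup>+\<zeta>. F \<zeta> (u \<zeta>) \<partial>\<nu>)" "dom f"
proof -
  have "(\<integral>\<^sup>+\<zeta>. F \<zeta> (v \<zeta>) \<partial>completion \<nu>) = (\<integral>\<^sup>+\<zeta>. F \<zeta> (u \<zeta>) \<partial>\<nu>)" if "repr f v" for v
    unfolding nn_integral_completion using that u
    by (intro nn_integral_cong_AE) (auto simp: repr_def elim!: AE_mp)
  then show E: "E (lclass M f) = (\<integral>\<^sup>+\<zeta>. F \<zeta> (u \<zeta>) \<partial>\<nu>)"
    unfolding E_eq[OF lclass_carrier[OF f]] direct_integral_form_def delta_map_Collect[OF f]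
    by (intro INF_eq_const) (use u in auto)
  have "(\<integral>\<^sup>+\<zeta>. F \<zeta> (u \<zeta>) \<partial>\<nu>) \<le> (\<integral>\<^sup>+\<zeta>. F \<zeta> (u \<zeta>) + ennreal ((hnorm (L2 (m \<zeta>)) (u \<zeta>))\<^sup>2) \<partial>\<nu>)"
    by (intro nn_integral_mono) simp
  then show "dom f"
    using u f unfolding dom_def qdom_def repr_def by (auto simp: E lclass_carrier dest: order_le_less_trans)
qed

text \<open>Without a representing field the infimum would be over the empty set, hence
  infinite.\<close>

lemma dom_repr:
  assumes "dom f"
  obtains u where "repr f u"
proof -
  have f: "f \<in> lspace M" and fin: "E (lclass M f) < \<infinity>" using assms by (auto simp: dom_def qdom_def)
  have "{u. repr f u} \<noteq> {}"
  proof
    assume "{u. repr f u} = {}"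
    then have "E (lclass M f) = \<infinity>"
      unfolding E_eq[OF lclass_carrier[OF f]] direct_integral_form_def delta_map_Collect[OF f] by simp
    then show False using fin by simp
  qed
  then show thesis using that by blast
qed

lemma lspace_comp_mult:
  assumes "f \<in> lspace M" "\<theta> \<in> borel_measurable \<nu>" "\<And>\<zeta>. \<bar>\<theta> \<zeta>\<bar> \<le> 1"
  shows "(\<lambda>x. \<theta> (s x) * f x) \<in> lspace M"
  by (rule lspace_mult[OF assms(1) measurable_completion[OF measurable_compose[OF s_measurable assms(2)]] assms(3)])

text \<open>On almost every fibre \<open>s\<close> is almost everywhere equal to the index, so
  multiplying \<open>f\<close> by \<open>\<theta> (s x)\<close> scales the field by
  \<open>\<theta> \<zeta>\<close>. The bound 1 keeps the integral from increasing.\<close>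

lemma repr_mult:
  assumes f: "f \<in> lspace M" and u: "repr f u" and \<theta>: "\<theta> \<in> borel_measurable \<nu>" "\<And>\<zeta>. \<bar>\<theta> \<zeta>\<bar> \<le> 1"
  shows "repr (\<lambda>x. \<theta> (s x) * f x) (\<lambda>\<zeta>\<in>space \<nu>. hscale (L2 (m \<zeta>)) (\<theta> \<zeta>) (u \<zeta>))" (is "repr ?f ?v")
  unfolding repr_def
proof (intro conjI)
  have uS: "u \<in> SQ" using u by (simp add: repr_def)
  show "?v \<in> SQ" using uS \<theta>(1) by (rule SQ_scale)
  have "AE \<zeta> in \<nu>. u \<zeta> = lclass (m \<zeta>) f" using u by (simp add: repr_def)
  then show "AE \<zeta> in \<nu>. ?v \<zeta> = lclass (m \<zeta>) ?f"
    using AE_space AE_fibre AE_lspace[OF f]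
  proof eventually_elim
    case (elim \<zeta>)
    have "lclass (m \<zeta>) (\<lambda>x. \<theta> \<zeta> * f x) = lclass (m \<zeta>) ?f"
      using elim(3) by (intro lclass_eqI) (auto elim: AE_mp)
    then show ?case using elim by (simp add: L2_scale)
  qed
  have "F \<zeta> (?v \<zeta>) + ennreal ((hnorm (L2 (m \<zeta>)) (?v \<zeta>))\<^sup>2) \<le> F \<zeta> (u \<zeta>) + ennreal ((hnorm (L2 (m \<zeta>)) (u \<zeta>))\<^sup>2)"
    if \<zeta>: "\<zeta> \<in> space \<nu>" for \<zeta>
  proof -
    interpret Q: closed_form_space "L2 (m \<zeta>)" "F \<zeta>" using \<zeta> by (rule closed_form_space)
    have uq: "u \<zeta> \<in> qdom (L2 (m \<zeta>)) (F \<zeta>)" using SQ_qdom[OF uS \<zeta>] .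
    have \<theta>2: "(\<theta> \<zeta>)\<^sup>2 \<le> 1" using \<theta>(2) by (simp add: abs_square_le_1)
    have "F \<zeta> (?v \<zeta>) \<le> 1 * F \<zeta> (u \<zeta>)"
      using \<zeta> uq \<theta>2 by (auto simp: Q.Q_scale simp del: mult_1 intro!: mult_right_mono)
    moreover have "(hnorm (L2 (m \<zeta>)) (?v \<zeta>))\<^sup>2 \<le> 1 * (hnorm (L2 (m \<zeta>)) (u \<zeta>))\<^sup>2"
      using \<zeta> uq mult_right_mono[OF \<theta>2, of "(hnorm (L2 (m \<zeta>)) (u \<zeta>))\<^sup>2"]
      by (simp add: Q.hnorm_scale qdomD power_mult_distrib)
    ultimately show ?thesis by (intro add_mono ennreal_leI) simp_all
  qed
  then have "(\<integral>\<^sup>+\<zeta>. F \<zeta> (?v \<zeta>) + ennreal ((hnorm (L2 (m \<zeta>)) (?v \<zeta>))\<^sup>2) \<partial>\<nu>)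
      \<le> (\<integral>\<^sup>+\<zeta>. F \<zeta> (u \<zeta>) + ennreal ((hnorm (L2 (m \<zeta>)) (u \<zeta>))\<^sup>2) \<partial>\<nu>)"
    by (intro nn_integral_mono)
  also have "\<dots> < \<infinity>" using u by (simp add: repr_def)
  finally show "(\<integral>\<^sup>+\<zeta>. F \<zeta> (?v \<zeta>) + ennreal ((hnorm (L2 (m \<zeta>)) (?v \<zeta>))\<^sup>2) \<partial>\<nu>) < \<infinity>" .
qed

text \<open>The localisation identity. An indicator for \<open>\<theta>\<close> exhibits
  \<open>energy f\<close> as a density of \<open>E\<close> along \<open>s\<close>; a sign function
  gives \<open>\<theta>\<close> square 1 and hence a symmetry.\<close>

lemma dom_mult:
  assumes f: "dom f" and \<theta>: "\<theta> \<in> borel_measurable \<nu>" "\<And>\<zeta>. \<bar>\<theta> \<zeta>\<bar> \<le> 1"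
  shows "dom (\<lambda>x. \<theta> (s x) * f x)"
    "E (lclass M (\<lambda>x. \<theta> (s x) * f x)) = (\<integral>\<^sup>+\<zeta>. ennreal ((\<theta> \<zeta>)\<^sup>2) * energy f \<zeta> \<partial>\<nu>)"
proof -
  have fl: "f \<in> lspace M" using f by (simp add: dom_def)
  obtain u where u: "repr f u" using f by (rule dom_repr)
  let ?v = "\<lambda>\<zeta>\<in>space \<nu>. hscale (L2 (m \<zeta>)) (\<theta> \<zeta>) (u \<zeta>)"
  note v = repr_mult[OF fl u \<theta>] and l = lspace_comp_mult[OF fl \<theta>]
  show "dom (\<lambda>x. \<theta> (s x) * f x)" using l v by (rule repr_energy)
  have "AE \<zeta> in \<nu>. u \<zeta> = lclass (m \<zeta>) f" using u by (simp add: repr_def)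
  with AE_space have "AE \<zeta> in \<nu>. F \<zeta> (?v \<zeta>) = ennreal ((\<theta> \<zeta>)\<^sup>2) * energy f \<zeta>"
  proof eventually_elim
    case (elim \<zeta>)
    interpret Q: closed_form_space "L2 (m \<zeta>)" "F \<zeta>" using elim(1) by (rule closed_form_space)
    show ?case using elim u SQ_qdom[of u \<zeta>] Q.Q_scale[of "u \<zeta>"] by (simp add: repr_def energy_def)
  qed
  then show "E (lclass M (\<lambda>x. \<theta> (s x) * f x)) = (\<integral>\<^sup>+\<zeta>. ennreal ((\<theta> \<zeta>)\<^sup>2) * energy f \<zeta> \<partial>\<nu>)"
    unfolding repr_energy(1)[OF l v] by (rule nn_integral_cong_AE)
qed

lemma dom_cut:
  assumes f: "dom f" and B: "B \<in> sets \<nu>"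
  shows "dom (\<lambda>x. indicator B (s x) * f x)"
    "E (lclass M (\<lambda>x. indicator B (s x) * f x)) = (\<integral>\<^sup>+\<zeta>. energy f \<zeta> * indicator B \<zeta> \<partial>\<nu>)"
proof -
  have B': "(indicator B :: 'z \<Rightarrow> real) \<in> borel_measurable \<nu>" "\<And>\<zeta>. \<bar>indicator B \<zeta> :: real\<bar> \<le> 1"
    using B by (auto simp: indicator_def)
  show "dom (\<lambda>x. indicator B (s x) * f x)" by (rule dom_mult[OF f B'])
  show "E (lclass M (\<lambda>x. indicator B (s x) * f x)) = (\<integral>\<^sup>+\<zeta>. energy f \<zeta> * indicator B \<zeta> \<partial>\<nu>)"
    unfolding dom_mult(2)[OF f B'] by (intro nn_integral_cong) (simp add: indicator_def)
qed

lemma energy_measurable: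
  assumes "dom f"
  shows "energy f \<in> borel_measurable (completion \<nu>)"
proof -
  obtain u where u: "repr f u" using assms by (rule dom_repr)
  then have "(\<lambda>\<zeta>. F \<zeta> (u \<zeta>)) \<in> borel_measurable (completion \<nu>)"
    by (intro F_measurable) (simp add: repr_def)
  then show ?thesis
    by (rule measurable_completion_cong_AE) (use u in \<open>auto simp: repr_def energy_def elim!: AE_mp\<close>)
qed

lemma AE_dom:
  assumes "dom f"
  shows "AE \<zeta> in \<nu>. f \<in> lspace (m \<zeta>) \<and> lclass (m \<zeta>) f \<in> qdom (L2 (m \<zeta>)) (F \<zeta>)"
proof -
  obtain u where u: "repr f u" using assms by (rule dom_repr)
  have "f \<in> lspace M" using assms by (simp add: dom_def)
  from AE_lspace[OF this] have "AE \<zeta> in \<nu>. f \<in> lspace (m \<zeta>)" .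
  moreover have "AE \<zeta> in \<nu>. u \<zeta> = lclass (m \<zeta>) f" using u by (simp add: repr_def)
  ultimately show ?thesis
    using AE_space
  proof eventually_elim
    case (elim \<zeta>)
    then show ?case using SQ_qdom[of u \<zeta>] u by (simp add: repr_def)
  qed
qed

text \<open>Sums and differences are recorded because \<open>qbil\<close> on the fibres is the
  polarisation of their energies.\<close>

lemma dom_add:
  assumes "f \<in> \<A>" "g \<in> \<A>"
  shows "dom f" "dom (\<lambda>x. f x + g x)" "dom (\<lambda>x. f x - g x)"
proof -
  have *: "dom h" if "h \<in> \<A>" for h using \<A> that by (auto simp: dom_def dense_function_space_def)
  have add: "(\<lambda>x. h x + k x) \<in> \<A>" if "h \<in> \<A>" "k \<in> \<A>" for h k
    using \<A>(1) that by (simp add: dense_function_space_def)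
  have scale: "(\<lambda>x. c * h x) \<in> \<A>" if "h \<in> \<A>" for c h
    using \<A>(1) that by (simp add: dense_function_space_def)
  from add[OF assms(1) scale[OF assms(2), of "- 1"]] have "dom (\<lambda>x. f x + - 1 * g x)" by (rule *)
  then show "dom (\<lambda>x. f x - g x)" by simp
  show "dom f" "dom (\<lambda>x. f x + g x)" using * add assms by auto
qed

lemma AE_qbil:
  assumes f: "dom f" and g: "dom g"
  shows "AE \<zeta> in \<nu>. qbil (L2 (m \<zeta>)) (F \<zeta>) (lclass (m \<zeta>) f) (lclass (m \<zeta>) g) =
    (enn2real (energy (\<lambda>x. f x + g x) \<zeta>) - enn2real (energy (\<lambda>x. f x - g x) \<zeta>)) / 4"
  using AE_dom[OF f] AE_dom[OF g]
  by eventually_elim (simp add: qbil_def energy_def L2_add L2_diff)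

text \<open>The total fields come from functions of \<open>\<A>\<close>, and countably many of them
  share one null set. Functions, unlike fields, can also be evaluated on the fibres of another
  decomposition.\<close>

lemma total_sequence:
  obtains f :: "nat \<Rightarrow> 'x \<Rightarrow> real" where "range f \<subseteq> \<A>"
    "AE \<zeta> in \<nu>. htotal (form_space (L2 (m \<zeta>)) (F \<zeta>)) (range (\<lambda>n. lclass (m \<zeta>) (f n)))"
proof -
  obtain u :: "nat \<Rightarrow> 'z \<Rightarrow> ('x \<Rightarrow> real) set" where u: "range u \<subseteq> delta_field \<nu> m ` \<A>"
    and total: "\<And>\<zeta>. \<zeta> \<in> space \<nu> \<Longrightarrow> htotal (form_space (L2 (m \<zeta>)) (F \<zeta>)) (range (\<lambda>n. u n \<zeta>))"
    using generates unfolding generates_field_def has_total_sequence_def by blast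
  have "\<exists>g\<in>\<A>. u n = delta_field \<nu> m g" for n using u by blast
  then obtain f where f: "\<And>n. f n \<in> \<A>" and uf: "\<And>n. u n = delta_field \<nu> m (f n)" by metis
  have "AE \<zeta> in \<nu>. \<forall>n. u n \<zeta> = lclass (m \<zeta>) (f n)"
    unfolding AE_all_countable uf using \<A>(1) f by (intro allI delta_AE) (auto simp: dense_function_space_def)
  with AE_space have "AE \<zeta> in \<nu>. htotal (form_space (L2 (m \<zeta>)) (F \<zeta>)) (range (\<lambda>n. lclass (m \<zeta>) (f n)))"
  proof eventually_elim
    case (elim \<zeta>)
    then show ?case using total[of \<zeta>] by simp
  qed
  then show thesis using f by (intro that[of f]) auto
qed

lemma energy_AE_eq:
  assumes f: "dom f" and g: "dom g"
    and eq: "\<And>B. B \<in> sets \<nu> \<Longrightarrow>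
      E (lclass M (\<lambda>x. indicator B (s x) * f x)) = E (lclass M (\<lambda>x. indicator B (s x) * g x))"
  shows "AE \<zeta> in \<nu>. energy f \<zeta> = energy g \<zeta>"
  using eq dom_cut[OF f] dom_cut[OF g]
  by (intro completion_AE_eq_if_nn_integral_eq energy_measurable f g finite_measure_axioms) simp

section \<open>Symmetries of the form and irreducibility of the fibres\<close>

definition symmetry_set :: "'x set \<Rightarrow> bool" where
  "symmetry_set A \<longleftrightarrow>
     (\<forall>f. dom f \<longrightarrow> dom (\<lambda>x. signum A x * f x) \<and> E (lclass M (\<lambda>x. signum A x * f x)) = E (lclass M f))"

lemma symmetry_setD:
  assumes "symmetry_set A" "dom f"
  shows "dom (\<lambda>x. signum A x * f x)" "E (lclass M (\<lambda>x. signum A x * f x)) = E (lclass M f)"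
  using assms by (simp_all add: symmetry_set_def)

text \<open>The sign commutes with the cut-off \<open>indicator B (s x)\<close>, so the symmetry
  holds for every cut of \<open>f\<close>, and equal integrals over all \<open>B\<close> give equal
  densities.\<close>

lemma signum_energy:
  assumes A: "A \<in> sets M"
    and inv: "symmetry_set A"
    and f: "dom f"
  shows "AE \<zeta> in \<nu>. energy (\<lambda>x. signum A x * f x) \<zeta> = energy f \<zeta>"
proof (rule energy_AE_eq)
  fix B assume "B \<in> sets \<nu>"
  from symmetry_setD(2)[OF inv dom_cut(1)[OF f this]]
  show "E (lclass M (\<lambda>x. indicator B (s x) * (signum A x * f x))) = E (lclass M (\<lambda>x. indicator B (s x) * f x))"
    by (simp add: mult.left_commute)
qed (use symmetry_setD[OF inv f] f in auto)

text \<open>Off one null set of indices the sign preserves the bilinear form on a total sequence.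
  \<open>conformal_extension\<close> with factor 1 then covers the whole domain of
  \<open>F \<zeta>\<close>, and \<open>invariant_set_signum\<close> applies.\<close>

lemma AE_invariant_set:
  assumes A: "A \<in> sets M"
    and inv: "symmetry_set A"
  shows "AE \<zeta> in \<nu>. invariant_set (m \<zeta>) (F \<zeta>) A"
proof -
  obtain f :: "nat \<Rightarrow> 'x \<Rightarrow> real" where "range f \<subseteq> \<A>" and
    total: "AE \<zeta> in \<nu>. htotal (form_space (L2 (m \<zeta>)) (F \<zeta>)) (range (\<lambda>n. lclass (m \<zeta>) (f n)))"
    by (rule total_sequence)
  then have f: "f n \<in> \<A>" for n by blast
  have f_dom: "dom (f n)" for n using dom_add(1)[OF f f] .
  have "AE \<zeta> in \<nu>. \<forall>n. (f n \<in> lspace (m \<zeta>) \<and> lclass (m \<zeta>) (f n) \<in> qdom (L2 (m \<zeta>)) (F \<zeta>)) \<and>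
      lclass (m \<zeta>) (\<lambda>x. signum A x * f n x) \<in> qdom (L2 (m \<zeta>)) (F \<zeta>)"
    unfolding AE_all_countable
  proof
    fix n
    have "dom (\<lambda>x. signum A x * f n x)" using inv f_dom by (rule symmetry_setD)
    from AE_dom[OF f_dom[of n]] AE_dom[OF this]
    show "AE \<zeta> in \<nu>. (f n \<in> lspace (m \<zeta>) \<and> lclass (m \<zeta>) (f n) \<in> qdom (L2 (m \<zeta>)) (F \<zeta>)) \<and>
        lclass (m \<zeta>) (\<lambda>x. signum A x * f n x) \<in> qdom (L2 (m \<zeta>)) (F \<zeta>)"
      by eventually_elim simp
  qed
  \<comment> \<open>These energies determine the polarised form on the sequence, the sign factor
    being distributed over the sum and the difference.\<close>
  moreover have "AE \<zeta> in \<nu>. \<forall>i j. energy (\<lambda>x. signum A x * (f i x + f j x)) \<zeta> = energy (\<lambda>x. f i x + f j x) \<zeta> \<and>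
      energy (\<lambda>x. signum A x * (f i x - f j x)) \<zeta> = energy (\<lambda>x. f i x - f j x) \<zeta>"
    unfolding AE_all_countable
  proof (intro allI)
    fix i j
    show "AE \<zeta> in \<nu>. energy (\<lambda>x. signum A x * (f i x + f j x)) \<zeta> = energy (\<lambda>x. f i x + f j x) \<zeta> \<and>
      energy (\<lambda>x. signum A x * (f i x - f j x)) \<zeta> = energy (\<lambda>x. f i x - f j x) \<zeta>"
      using signum_energy[OF A inv dom_add(2)[OF f[of i] f[of j]]] signum_energy[OF A inv dom_add(3)[OF f[of i] f[of j]]]
      by eventually_elim simp
  qed
  ultimately show ?thesis
    using total AE_space
  proof eventually_elim
    case (elim \<zeta>)
    note Q = closed_form_space[OF elim(4)]
    have A': "A \<in> sets (m \<zeta>)" using A elim(4) by (simp add: sets_m)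
    let ?J = "mult_class (m \<zeta>) (signum A)"
    have g: "signum A \<in> borel_measurable (completion (m \<zeta>))" "\<And>x. x \<in> space (m \<zeta>) \<Longrightarrow> \<bar>signum A x\<bar> \<le> 1"
      using A' by (auto intro: measurable_completion)
    have fl: "f n \<in> lspace (m \<zeta>)" for n using elim(1) by blast
    show ?case
    proof (rule invariant_set_signum[OF Q A'])
      fix U assume U: "U \<in> qdom (L2 (m \<zeta>)) (F \<zeta>)"
      have "?J U \<in> qdom (L2 (m \<zeta>)) (F \<zeta>) \<and> F \<zeta> (?J U) = ennreal 1 * F \<zeta> U"
      proof (rule conformal_extension[OF Q Q _ _ _ elim(3) _ _ U])
        show "hlinear (L2 (m \<zeta>)) (L2 (m \<zeta>)) ?J" by (rule mult_class_linear[OF g])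
      next
        fix x y assume "x \<in> hcarrier (L2 (m \<zeta>))" "y \<in> hcarrier (L2 (m \<zeta>))"
        then show "hinner (L2 (m \<zeta>)) (?J x) (?J y) = 1 * hinner (L2 (m \<zeta>)) x y"
          by (elim L2_carrierE) (simp add: mult_class_lclass L2_inner lspace_mult[OF _ g])
      next
        fix x assume "x \<in> range (\<lambda>n. lclass (m \<zeta>) (f n))"
        then show "?J x \<in> qdom (L2 (m \<zeta>)) (F \<zeta>)" using elim(1) by (auto simp: mult_class_lclass)
      next
        fix x y assume "x \<in> range (\<lambda>n. lclass (m \<zeta>) (f n))" "y \<in> range (\<lambda>n. lclass (m \<zeta>) (f n))"
        then obtain i j where xy: "x = lclass (m \<zeta>) (f i)" "y = lclass (m \<zeta>) (f j)" by blast
        show "qbil (L2 (m \<zeta>)) (F \<zeta>) (?J x) (?J y) = 1 * qbil (L2 (m \<zeta>)) (F \<zeta>) x y"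
          using elim(2) unfolding xy qbil_def energy_def
          by (simp add: mult_class_lclass fl lspace_mult[OF fl g] L2_add L2_diff
              flip: distrib_left right_diff_distrib)
      qed simp
      then show "?J U \<in> qdom (L2 (m \<zeta>)) (F \<zeta>) \<and> F \<zeta> (?J U) = F \<zeta> U" by simp
    qed
  qed
qed

text \<open>\<open>B\<close> collects the indices whose measure makes \<open>A\<close> conegligible.
  By irreducibility \<open>A\<close> is negligible for almost all others, so \<open>A\<close> is
  recovered from \<open>s\<close> up to a null set. The collection is measurable only for the
  completion and is replaced by a set of \<open>\<nu>\<close> that agrees with it almost
  everywhere.\<close>

lemma invariant_set_vimage:
  assumes A: "A \<in> sets M"
    and inv: "symmetry_set A"
  obtains B where "B \<in> sets \<nu>" "AE x in M. x \<in> A \<longleftrightarrow> s x \<in> B"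
proof -
  have A': "space M - A \<in> sets M" using A by simp
  have "{\<zeta> \<in> space (completion \<nu>). emeasure (m \<zeta>) (space M - A) = 0} \<in> sets (completion \<nu>)"
    using emeasure_m_measurable[OF A'] by measurable
  then obtain B where B: "B \<in> sets \<nu>"
    and BA: "AE \<zeta> in \<nu>. \<zeta> \<in> {\<zeta> \<in> space (completion \<nu>). emeasure (m \<zeta>) (space M - A) = 0} \<longleftrightarrow> \<zeta> \<in> B"
    by (rule AE_completion_set)
  let ?D = "{x \<in> space M. \<not> (x \<in> A \<longleftrightarrow> s x \<in> B)}"
  have D: "?D \<in> sets M" using A B by measurable
  have "AE \<zeta> in \<nu>. ?D \<in> null_sets (m \<zeta>)"
    using AE_space BA AE_fibre AE_invariant_set[OF A inv]
  proof eventually_elim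
    case (elim \<zeta>)
    note \<zeta> = elim(1)
    have "A \<in> negligible_sets (m \<zeta>) \<or> conegligible (m \<zeta>) A"
      using irreducible[OF \<zeta>] elim(4) by (simp add: irreducible_form_def)
    then have "A \<in> null_sets (m \<zeta>) \<or> space M - A \<in> null_sets (m \<zeta>)"
      using A A' \<zeta> by (simp add: conegligible_def null_sets_completion_iff sets_m space_m)
    moreover have "space M - A \<in> null_sets (m \<zeta>) \<longleftrightarrow> \<zeta> \<in> B"
      using elim(2) A' \<zeta> by (simp add: null_sets_def sets_m)
    ultimately have "AE x in m \<zeta>. x \<in> A \<longleftrightarrow> \<zeta> \<in> B"
    proof (elim disjE)
      assume A0: "A \<in> null_sets (m \<zeta>)" and iff: "space M - A \<in> null_sets (m \<zeta>) \<longleftrightarrow> \<zeta> \<in> B"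
      \<comment> \<open>The two alternatives of irreducibility exclude each other because
        \<open>m \<zeta>\<close> is not the zero measure.\<close>
      have "\<zeta> \<notin> B"
      proof
        assume "\<zeta> \<in> B"
        with iff have "A \<union> (space M - A) \<in> null_sets (m \<zeta>)" by (intro null_sets.Un A0) simp
        moreover have "A \<union> (space M - A) = space M" using sets.sets_into_space[OF A] by auto
        ultimately show False using m_nonzero[OF \<zeta>] by (simp add: null_sets_def)
      qed
      then show ?thesis using AE_not_in[OF A0] by simp
    next
      assume A0: "space M - A \<in> null_sets (m \<zeta>)" and iff: "space M - A \<in> null_sets (m \<zeta>) \<longleftrightarrow> \<zeta> \<in> B"
      show ?thesis using AE_not_in[OF A0] AE_space by eventually_elim (use A0 iff \<zeta> space_m in auto)
    qed
    with elim(3) have "AE x in m \<zeta>. x \<notin> ?D" by eventually_elim simp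
    then show ?case using D \<zeta> by (simp add: AE_iff_null_sets sets_m)
  qed
  then have "?D \<in> null_sets M" using null_sets_iff[OF D] by simp
  then have "AE x in M. x \<notin> ?D" by (rule AE_not_in)
  then have "AE x in M. x \<in> A \<longleftrightarrow> s x \<in> B" using AE_space by eventually_elim simp
  with B show thesis by (rule that)
qed

text \<open>The sign of this preimage is \<open>signum B\<close> composed with \<open>s\<close>, and
  its square is 1 in the localisation identity.\<close>

lemma vimage_symmetry:
  assumes B: "B \<in> sets \<nu>"
  shows "symmetry_set (s -` B \<inter> space M)"
  unfolding symmetry_set_def
proof (intro allI impI conjI)
  fix f assume f: "dom f"
  note dm = dom_mult[OF f, of "signum B", OF signum_measurable[OF B]]
  have fl: "f \<in> lspace M" using f by (simp add: dom_def)
  have "AE x in M. signum B (s x) * f x = signum (s -` B \<inter> space M) x * f x"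
    by (intro AE_I2) (simp add: signum_def)
  then have l: "lclass M (\<lambda>x. signum (s -` B \<inter> space M) x * f x) = lclass M (\<lambda>x. signum B (s x) * f x)"
    and m: "(\<lambda>x. signum (s -` B \<inter> space M) x * f x) \<in> lspace M"
    using dm(1) by (auto simp: dom_def intro!: lclass_eqI elim: lspace_cong_AE AE_mp)
  show "dom (\<lambda>x. signum (s -` B \<inter> space M) x * f x)"
    using dm(1) m by (simp add: dom_def l)
  \<comment> \<open>Cutting by the whole index space gives \<open>E\<close> of \<open>f\<close>
    itself as the integral of \<open>energy f\<close>.\<close>
  have "indicator (space \<nu>) (s x) * f x = f x" if "x \<in> space M" for x
    using measurable_space[OF s_measurable that] by simp
  then have "lclass M (\<lambda>x. indicator (space \<nu>) (s x) * f x) = lclass M f"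
    by (intro lclass_eqI AE_I2)
  with dom_cut(2)[OF f sets.top] have "E (lclass M f) = (\<integral>\<^sup>+\<zeta>. energy f \<zeta> \<partial>\<nu>)"
    by (simp add: nn_integral_cong[of \<nu> "\<lambda>\<zeta>. energy f \<zeta> * indicator (space \<nu>) \<zeta>" "energy f"])
  then show "E (lclass M (\<lambda>x. signum (s -` B \<inter> space M) x * f x)) = E (lclass M f)"
    using dm(2) by (simp add: l)
qed

end

section \<open>The isomorphism of the index spaces\<close>

text \<open>Two quotient maps of one space which, off a null set \<open>N\<close>, generate the same \<open>\<sigma>\<close>-algebra.\<close>

locale common_factor =
  fixes M :: "'x measure" and \<nu>1 :: "'y measure" and \<nu>2 :: "'z measure"
    and s1 :: "'x \<Rightarrow> 'y" and s2 :: "'x \<Rightarrow> 'z" and N :: "'x set"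
  assumes prob1: "prob_space \<nu>1" and prob2: "prob_space \<nu>2"
    and singletons1: "separable_measure \<nu>1" and singletons2: "separable_measure \<nu>2"
    and s1: "s1 \<in> M \<rightarrow>\<^sub>M \<nu>1" and s2: "s2 \<in> M \<rightarrow>\<^sub>M \<nu>2"
    and N: "N \<in> null_sets M"
    and push: "\<And>A. A \<in> sets \<nu>1 \<Longrightarrow> \<exists>B\<in>sets \<nu>2. \<forall>x\<in>space M - N. s1 x \<in> A \<longleftrightarrow> s2 x \<in> B"
    and pull: "\<And>B. B \<in> sets \<nu>2 \<Longrightarrow> \<exists>A\<in>sets \<nu>1. \<forall>x\<in>space M - N. s2 x \<in> B \<longleftrightarrow> s1 x \<in> A"
    and null1: "\<And>A. A \<in> sets \<nu>1 \<Longrightarrow> s1 -` A \<inter> space M \<in> null_sets M \<longleftrightarrow> A \<in> null_sets \<nu>1"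
    and null2: "\<And>B. B \<in> sets \<nu>2 \<Longrightarrow> s2 -` B \<inter> space M \<in> null_sets M \<longleftrightarrow> B \<in> null_sets \<nu>2"
    and conull1: "AE \<zeta> in \<nu>1. \<zeta> \<in> s1 ` (space M - N)"
    and conull2: "AE \<eta> in \<nu>2. \<eta> \<in> s2 ` (space M - N)"

text \<open>The hypotheses are symmetric in the two quotients, so the inverse of
  \<open>\<rho>\<close> and its properties are instances of those of \<open>\<rho>\<close>.\<close>

lemma (in common_factor) swap: "common_factor M \<nu>2 \<nu>1 s2 s1 N"
  by (intro common_factor.intro prob1 prob2 singletons1 singletons2 s1 s2 N push pull null1 null2 conull1 conull2)

context common_factor
begin

abbreviation "Y \<equiv> s1 ` (space M - N)"
abbreviation "Z \<equiv> s2 ` (space M - N)"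

text \<open>Outside \<open>Y\<close>, which is conegligible but need not be measurable, the value is
  an arbitrary fixed point of \<open>space \<nu>2\<close>, so that \<open>\<rho>\<close> maps into
  that space everywhere.\<close>

definition \<rho> :: "'y \<Rightarrow> 'z" where
  "\<rho> \<zeta> = (if \<zeta> \<in> Y then s2 (SOME x. x \<in> space M - N \<and> s1 x = \<zeta>) else (SOME \<eta>. \<eta> \<in> space \<nu>2))"

text \<open>Singletons are measurable, so off \<open>N\<close> the condition that \<open>s2\<close>
  takes the value \<open>s2 x\<close> can be expressed by a condition on \<open>s1\<close>
  alone.\<close>

lemma s2_eq_if_s1_eq:
  assumes x: "x \<in> space M - N" and y: "y \<in> space M - N" and eq: "s1 x = s1 y"
  shows "s2 x = s2 y"
proof -
  have "{s2 x} \<in> sets \<nu>2"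
    using singletons2 measurable_space[OF s2] x by (auto simp: separable_measure_def)
  from pull[OF this] obtain A where "\<forall>x'\<in>space M - N. s2 x' \<in> {s2 x} \<longleftrightarrow> s1 x' \<in> A" by blast
  with x y eq show ?thesis by (metis singletonD singletonI)
qed

lemma \<rho>_s1:
  assumes "x \<in> space M - N"
  shows "\<rho> (s1 x) = s2 x"
proof -
  let ?y = "SOME y. y \<in> space M - N \<and> s1 y = s1 x"
  have "?y \<in> space M - N \<and> s1 ?y = s1 x" by (rule someI[of _ x]) (use assms in simp)
  then have "s2 ?y = s2 x" using assms by (intro s2_eq_if_s1_eq) auto
  then show ?thesis using assms by (auto simp: \<rho>_def)
qed

lemma Y_subset: "Y \<subseteq> space \<nu>1" using measurable_space[OF s1] by auto

lemma Z_subset: "Z \<subseteq> space \<nu>2" using measurable_space[OF s2] by auto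

lemma \<rho>_space: "\<rho> \<zeta> \<in> space \<nu>2"
proof (cases "\<zeta> \<in> Y")
  case True then show ?thesis using \<rho>_s1 Z_subset by auto
next
  case False
  have "\<exists>\<eta>. \<eta> \<in> space \<nu>2" using prob_space.not_empty[OF prob2] by blast
  then have "(SOME \<eta>. \<eta> \<in> space \<nu>2) \<in> space \<nu>2" by (rule someI_ex)
  with False show ?thesis by (simp add: \<rho>_def)
qed

lemma \<rho>_mem_iff:
  assumes "\<forall>x\<in>space M - N. s2 x \<in> B \<longleftrightarrow> s1 x \<in> A" "\<zeta> \<in> Y"
  shows "\<rho> \<zeta> \<in> B \<longleftrightarrow> \<zeta> \<in> A"
  using assms \<rho>_s1 by auto

lemma \<rho>_vimage_AE:
  assumes "\<forall>x\<in>space M - N. s2 x \<in> B \<longleftrightarrow> s1 x \<in> A"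
  shows "AE \<zeta> in \<nu>1. \<rho> \<zeta> \<in> B \<longleftrightarrow> \<zeta> \<in> A"
  using conull1 by eventually_elim (rule \<rho>_mem_iff[OF assms])

text \<open>The preimage of \<open>B\<close> is controlled only on \<open>Y\<close>, where it
  coincides with the pulled-back set \<open>A\<close>. It is thus measurable up to a null set, which
  is why the completion of \<open>\<nu>1\<close> is the source.\<close>

lemma \<rho>_measurable: "\<rho> \<in> completion \<nu>1 \<rightarrow>\<^sub>M \<nu>2"
proof (rule measurableI)
  fix B assume "B \<in> sets \<nu>2"
  from pull[OF this] obtain A where A: "A \<in> sets \<nu>1" "\<forall>x\<in>space M - N. s2 x \<in> B \<longleftrightarrow> s1 x \<in> A" by blast
  show "\<rho> -` B \<inter> space (completion \<nu>1) \<in> sets (completion \<nu>1)"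
  proof (rule completion.in_sets_AE)
    have "AE \<zeta> in \<nu>1. \<zeta> \<in> A \<longleftrightarrow> \<zeta> \<in> \<rho> -` B \<inter> space (completion \<nu>1)"
      using AE_space \<rho>_vimage_AE[OF A(2)] by eventually_elim auto
    then show "AE \<zeta> in completion \<nu>1. \<zeta> \<in> A \<longleftrightarrow> \<zeta> \<in> \<rho> -` B \<inter> space (completion \<nu>1)"
      by (rule AE_completion)
  qed (use A in auto)
qed (rule \<rho>_space)

text \<open>The preimages of \<open>A\<close> and \<open>B\<close> in \<open>space M\<close> differ
  only inside \<open>N\<close>, and each quotient map transfers null sets in both
  directions.\<close>

lemma null_pull_iff:
  assumes A: "A \<in> sets \<nu>1" and B: "B \<in> sets \<nu>2" and AB: "\<forall>x\<in>space M - N. s2 x \<in> B \<longleftrightarrow> s1 x \<in> A"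
  shows "A \<in> null_sets \<nu>1 \<longleftrightarrow> B \<in> null_sets \<nu>2"
proof -
  have "(AE x in M. x \<notin> s1 -` A \<inter> space M) \<longleftrightarrow> (AE x in M. x \<notin> s2 -` B \<inter> space M)"
    by (intro eventually_subst, use AE_space AE_not_in[OF N] in eventually_elim) (use AB in auto)
  then have "s1 -` A \<inter> space M \<in> null_sets M \<longleftrightarrow> s2 -` B \<inter> space M \<in> null_sets M"
    using measurable_sets[OF s1 A] measurable_sets[OF s2 B] by (simp add: AE_iff_null_sets)
  then show ?thesis using null1[OF A] null2[OF B] by simp
qed

lemma \<rho>_vimage_null:
  assumes B: "B \<in> sets \<nu>2"
  shows "emeasure (distr (completion \<nu>1) \<nu>2 \<rho>) B = 0 \<longleftrightarrow> B \<in> null_sets \<nu>2"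
proof -
  from pull[OF B] obtain A where A: "A \<in> sets \<nu>1" "\<forall>x\<in>space M - N. s2 x \<in> B \<longleftrightarrow> s1 x \<in> A" by blast
  have "emeasure (distr (completion \<nu>1) \<nu>2 \<rho>) B = emeasure (completion \<nu>1) (\<rho> -` B \<inter> space (completion \<nu>1))"
    using \<rho>_measurable B by (rule emeasure_distr)
  also have "\<dots> = emeasure (completion \<nu>1) A"
  proof (rule emeasure_eq_AE)
    have "AE \<zeta> in \<nu>1. \<zeta> \<in> \<rho> -` B \<inter> space (completion \<nu>1) \<longleftrightarrow> \<zeta> \<in> A"
      using AE_space \<rho>_vimage_AE[OF A(2)] by eventually_elim auto
    then show "AE \<zeta> in completion \<nu>1. \<zeta> \<in> \<rho> -` B \<inter> space (completion \<nu>1) \<longleftrightarrow> \<zeta> \<in> A"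
      by (rule AE_completion)
  qed (use A measurable_sets[OF \<rho>_measurable B] in auto)
  also have "\<dots> = 0 \<longleftrightarrow> A \<in> null_sets \<nu>1" using A by (auto simp: null_sets_def)
  finally show ?thesis using null_pull_iff[OF A(1) B A(2)] by simp
qed

lemma equivalent: "equivalent_measures (distr (completion \<nu>1) \<nu>2 \<rho>) \<nu>2"
  using \<rho>_vimage_null by (auto simp: equivalent_measures_def absolutely_continuous_def null_sets_def)

lemma AE_\<rho>:
  assumes "AE \<eta> in \<nu>2. P \<eta>"
  shows "AE \<zeta> in \<nu>1. P (\<rho> \<zeta>)"
proof -
  have "AE \<eta> in distr (completion \<nu>1) \<nu>2 \<rho>. P \<eta>"
    using equivalent by (intro absolutely_continuous_AE[OF _ _ assms]) (auto simp: equivalent_measures_def)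
  then have "AE \<zeta> in completion \<nu>1. P (\<rho> \<zeta>)" by (rule AE_distrD[OF \<rho>_measurable])
  then show ?thesis by (simp add: AE_completion_iff)
qed

lemma \<rho>_measurable_completion: "\<rho> \<in> completion \<nu>1 \<rightarrow>\<^sub>M completion \<nu>2"
  using equivalent by (intro completion.measurable_completion2 \<rho>_measurable)
    (auto simp: equivalent_measures_def absolutely_continuous_def)

lemma \<rho>_bij: "bij_betw \<rho> Y Z"
proof (rule bij_betw_imageI)
  interpret swap: common_factor M \<nu>2 \<nu>1 s2 s1 N by (rule swap)
  show "inj_on \<rho> Y"
    by (intro inj_onI) (auto simp: \<rho>_s1 intro: swap.s2_eq_if_s1_eq)
  show "\<rho> ` Y = Z" using \<rho>_s1 by (auto simp: image_image)
qed

text \<open>For \<open>S\<close> in \<open>\<nu>1\<close> the image of \<open>S \<inter> Y\<close>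
  is exactly the trace on \<open>Z\<close> of the set that \<open>push\<close> supplies. A completed
  set adds part of a null set, whose image may fail to be such a trace but lies inside a null set of
  \<open>\<nu>2\<close>.\<close>

lemma \<rho>_image_measurable:
  assumes A: "A \<in> sets (completion \<nu>1)"
  shows "\<exists>B\<in>sets (completion \<nu>2). \<rho> ` (A \<inter> Y) = B \<inter> Z"
    and "A \<in> null_sets (completion \<nu>1) \<Longrightarrow> \<exists>B\<in>null_sets (completion \<nu>2). \<rho> ` (A \<inter> Y) = B \<inter> Z"
proof -
  have image: "\<rho> ` (S \<inter> Y) = B \<inter> Z" if "\<forall>x\<in>space M - N. s1 x \<in> S \<longleftrightarrow> s2 x \<in> B" for S B
  proof -
    have "S \<inter> Y = s1 ` {x \<in> space M - N. s1 x \<in> S}" by blast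
    then have "\<rho> ` (S \<inter> Y) = (\<lambda>x. \<rho> (s1 x)) ` {x \<in> space M - N. s1 x \<in> S}" by (simp only: image_image)
    also have "\<dots> = s2 ` {x \<in> space M - N. s2 x \<in> B}"
      using that by (intro image_cong) (auto simp: \<rho>_s1)
    also have "\<dots> = B \<inter> Z" by blast
    finally show ?thesis .
  qed
  have null: "\<exists>B\<in>null_sets (completion \<nu>2). \<rho> ` (A \<inter> Y) = B \<inter> Z" if A: "A \<in> null_sets (completion \<nu>1)" for A
  proof -
    obtain S where S: "S \<in> null_sets \<nu>1" "A \<subseteq> S" using A by (auto simp: null_sets_completion_iff2)
    obtain B where B: "B \<in> sets \<nu>2" "\<forall>x\<in>space M - N. s1 x \<in> S \<longleftrightarrow> s2 x \<in> B"
      using push[of S] S(1) by blast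
    have "B \<in> null_sets \<nu>2" using null_pull_iff[of S B] S(1) B by (simp add: null_setsD2)
    moreover have "\<rho> ` (A \<inter> Y) \<subseteq> B" using image[OF B(2)] image_mono[of "A \<inter> Y" "S \<inter> Y" \<rho>] S(2) by blast
    ultimately have "\<rho> ` (A \<inter> Y) \<in> null_sets (completion \<nu>2)" unfolding null_sets_completion_iff2 by blast
    moreover have "\<rho> ` (A \<inter> Y) \<inter> Z = \<rho> ` (A \<inter> Y)"
      using \<rho>_bij image_mono[of "A \<inter> Y" Y \<rho>] by (simp add: bij_betw_def Int_absorb2)
    ultimately show ?thesis by (intro bexI[of _ "\<rho> ` (A \<inter> Y)"]) simp_all
  qed
  then show "A \<in> null_sets (completion \<nu>1) \<Longrightarrow> \<exists>B\<in>null_sets (completion \<nu>2). \<rho> ` (A \<inter> Y) = B \<inter> Z" .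
  obtain S K K' where S: "A = S \<union> K" "K \<subseteq> K'" "K' \<in> null_sets \<nu>1" "S \<in> sets \<nu>1"
    using A by (rule sets_completionE)
  obtain B where B: "B \<in> sets \<nu>2" "\<forall>x\<in>space M - N. s1 x \<in> S \<longleftrightarrow> s2 x \<in> B" using push[OF S(4)] by blast
  have "K \<in> null_sets (completion \<nu>1)" unfolding null_sets_completion_iff2 using S(2,3) by blast
  from null[OF this] obtain C where C: "C \<in> null_sets (completion \<nu>2)" "\<rho> ` (K \<inter> Y) = C \<inter> Z" by blast
  have "\<rho> ` (A \<inter> Y) = (B \<union> C) \<inter> Z"
    using image[OF B(2)] C(2) unfolding S(1) by (simp add: Int_Un_distrib2 image_Un)
  moreover have "B \<union> C \<in> sets (completion \<nu>2)" using B(1) C(1) by (intro sets.Un) auto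
  ultimately show "\<exists>B\<in>sets (completion \<nu>2). \<rho> ` (A \<inter> Y) = B \<inter> Z" by (rule bexI)
qed

text \<open>The exceptional sets are the complements of \<open>Y\<close> and \<open>Z\<close>. That
  every trace on the right is attained is the image lemma for the inverse map
  \<open>swap.\<rho>\<close>.\<close>

lemma \<rho>_almost_isomorphism: "almost_isomorphism \<nu>1 \<nu>2 \<rho>"
proof -
  interpret swap: common_factor M \<nu>2 \<nu>1 s2 s1 N by (rule swap)
  have inv: "\<rho> (swap.\<rho> \<eta>) = \<eta>" if "\<eta> \<in> Z" for \<eta> using that \<rho>_s1 swap.\<rho>_s1 by auto
  have inv_image: "\<rho> ` swap.\<rho> ` (B \<inter> Z) = B \<inter> Z" for B
    using inv by (auto simp: image_image)
  have diff1: "A - (space \<nu>1 - Y) = A \<inter> Y" if "A \<in> sets (completion \<nu>1)" for A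
    using sets.sets_into_space[OF that] by auto
  have diff2: "B - (space \<nu>2 - Z) = B \<inter> Z" if "B \<in> sets (completion \<nu>2)" for B
    using sets.sets_into_space[OF that] by auto
  have null1: "space \<nu>1 - Y \<in> null_sets (completion \<nu>1)"
    using AE_completion[OF conull1] by (subst (asm) completion.AE_iff_null_sets) (simp add: set_diff_eq)
  have null2: "space \<nu>2 - Z \<in> null_sets (completion \<nu>2)"
    using AE_completion[OF conull2] by (subst (asm) completion.AE_iff_null_sets) (simp add: set_diff_eq)
  \<comment> \<open>Stated for arbitrary families \<open>P\<close> and \<open>R\<close>, since it is
    needed once for the completed \<open>\<sigma>\<close>-algebras and once for the ideals of
    negligible sets.\<close>
  have traces: "(\<lambda>A. \<rho> ` A) ` {A - (space \<nu>1 - Y) |A. A \<in> P} = {B - (space \<nu>2 - Z) |B. B \<in> R}"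
    if P: "P \<subseteq> sets (completion \<nu>1)" and R: "R \<subseteq> sets (completion \<nu>2)"
      and PR: "\<And>A. A \<in> P \<Longrightarrow> \<exists>B\<in>R. \<rho> ` (A \<inter> Y) = B \<inter> Z"
      and RP: "\<And>B. B \<in> R \<Longrightarrow> \<exists>A\<in>P. swap.\<rho> ` (B \<inter> Z) = A \<inter> Y" for P R
  proof -
    have L: "(\<lambda>A. \<rho> ` A) ` {A - (space \<nu>1 - Y) |A. A \<in> P} = (\<lambda>A. \<rho> ` (A \<inter> Y)) ` P"
      using diff1 subsetD[OF P] unfolding Setcompr_eq_image image_image by (intro image_cong) auto
    have R': "{B - (space \<nu>2 - Z) |B. B \<in> R} = (\<lambda>B. B \<inter> Z) ` R"
      using diff2 subsetD[OF R] unfolding Setcompr_eq_image by (intro image_cong) auto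
    have "\<exists>A\<in>P. \<rho> ` (A \<inter> Y) = B \<inter> Z" if B: "B \<in> R" for B
    proof -
      obtain A where A: "A \<in> P" "swap.\<rho> ` (B \<inter> Z) = A \<inter> Y" using RP[OF B] ..
      have "\<rho> ` (A \<inter> Y) = B \<inter> Z" unfolding A(2)[symmetric] by (rule inv_image)
      with A(1) show ?thesis ..
    qed
    then have "(\<lambda>B. B \<inter> Z) ` R \<subseteq> (\<lambda>A. \<rho> ` (A \<inter> Y)) ` P" by (intro image_subsetI) (metis imageI)
    moreover have "(\<lambda>A. \<rho> ` (A \<inter> Y)) ` P \<subseteq> (\<lambda>B. B \<inter> Z) ` R" using PR by (intro image_subsetI) (metis imageI)
    ultimately show ?thesis unfolding L R' by (intro equalityI)
  qed
  show ?thesis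
    unfolding almost_isomorphism_def
  proof (intro conjI bexI)
    show "bij_betw \<rho> (space \<nu>1 - (space \<nu>1 - Y)) (space \<nu>2 - (space \<nu>2 - Z))"
      using \<rho>_bij Y_subset Z_subset by (simp add: double_diff)
    show "(\<lambda>A. \<rho> ` A) ` {A - (space \<nu>1 - Y) |A. A \<in> sets (completion \<nu>1)} =
        {B - (space \<nu>2 - Z) |B. B \<in> sets (completion \<nu>2)}"
      by (intro traces \<rho>_image_measurable(1) swap.\<rho>_image_measurable(1)) auto
    show "(\<lambda>A. \<rho> ` A) ` {A - (space \<nu>1 - Y) |A. A \<in> null_sets (completion \<nu>1)} =
        {B - (space \<nu>2 - Z) |B. B \<in> null_sets (completion \<nu>2)}"
      by (intro traces \<rho>_image_measurable(2) swap.\<rho>_image_measurable(2)) auto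
  qed (use \<rho>_space null1 null2 in auto)
qed

text \<open>The density of \<open>\<nu>2\<close> with respect to the image of \<open>\<nu>1\<close>, modified on a null set.\<close>

lemma density_function:
  obtains h :: "'z \<Rightarrow> real" where "h \<in> borel_measurable \<nu>2" "\<And>\<eta>. 0 < h \<eta>"
    "\<And>\<phi>1 \<phi>2. \<lbrakk>\<phi>1 \<in> borel_measurable (completion \<nu>1); \<phi>2 \<in> borel_measurable (completion \<nu>2);
        \<And>A B. \<lbrakk>A \<in> sets \<nu>1; B \<in> sets \<nu>2; \<forall>x\<in>space M - N. s2 x \<in> B \<longleftrightarrow> s1 x \<in> A\<rbrakk>
          \<Longrightarrow> (\<integral>\<^sup>+\<zeta>. \<phi>1 \<zeta> * indicator A \<zeta> \<partial>\<nu>1) = (\<integral>\<^sup>+\<eta>. \<phi>2 \<eta> * indicator B \<eta> \<partial>\<nu>2)\<rbrakk>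
      \<Longrightarrow> AE \<zeta> in \<nu>1. \<phi>1 \<zeta> = ennreal (h (\<rho> \<zeta>)) * \<phi>2 (\<rho> \<zeta>)"
proof -
  interpret p1: prob_space \<nu>1 by (rule prob1)
  interpret p2: prob_space \<nu>2 by (rule prob2)
  let ?D = "distr (completion \<nu>1) \<nu>2 \<rho>"
  interpret D: prob_space ?D by (rule prob_space.prob_space_distr[OF p1.prob_space_completion \<rho>_measurable])
  have ac: "absolutely_continuous ?D \<nu>2" and ca: "absolutely_continuous \<nu>2 ?D"
    using equivalent by (simp_all add: equivalent_measures_def)
  obtain g where g: "g \<in> borel_measurable ?D" "density ?D g = \<nu>2"
    using D.Radon_Nikodym[OF ac] by auto
  have g' [measurable]: "g \<in> borel_measurable \<nu>2" using g(1) by simp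
  have AE_D: "(AE \<eta> in ?D. P \<eta>)" if "AE \<eta> in \<nu>2. P \<eta>" for P
    using ca that by (rule absolutely_continuous_AE[rotated]) simp
  \<comment> \<open>The default value 1 where \<open>g\<close> is 0 or infinite makes
    \<open>h\<close> real and positive everywhere; both exceptional sets turn out to be
    null.\<close>
  define h where "h \<eta> = (if g \<eta> = 0 \<or> g \<eta> = \<infinity> then 1 else enn2real (g \<eta>))" for \<eta>
  have "(\<integral>\<^sup>+\<eta>. g \<eta> \<partial>?D) = emeasure (density ?D g) (space ?D)"
    using g(1) by (subst emeasure_density) (auto intro!: nn_integral_cong)
  then have "(\<integral>\<^sup>+\<eta>. g \<eta> \<partial>?D) = emeasure \<nu>2 (space \<nu>2)"
    unfolding g(2) by simp
  then have "AE \<eta> in ?D. g \<eta> \<noteq> \<infinity>"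
    using g(1) by (intro nn_integral_PInf_AE) (auto simp: p2.emeasure_space_1)
  \<comment> \<open>A measure does not charge the zero set of its density, here for
    \<open>\<nu>2\<close>; absolute continuity carries this over to \<open>?D\<close>.\<close>
  moreover have "AE \<eta> in ?D. g \<eta> \<noteq> 0"
  proof (rule AE_D)
    have "AE \<eta> in density ?D g. g \<eta> \<noteq> 0"
      by (subst AE_density[OF g(1)]) (intro AE_I2, auto)
    then show "AE \<eta> in \<nu>2. g \<eta> \<noteq> 0" unfolding g(2) .
  qed
  ultimately have "AE \<eta> in ?D. ennreal (h \<eta>) = g \<eta>"
    by eventually_elim (simp add: h_def ennreal_enn2real_if)
  then have "AE \<zeta> in completion \<nu>1. ennreal (h (\<rho> \<zeta>)) = g (\<rho> \<zeta>)" by (rule AE_distrD[OF \<rho>_measurable])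
  then have hg: "AE \<zeta> in \<nu>1. ennreal (h (\<rho> \<zeta>)) = g (\<rho> \<zeta>)" by (simp only: AE_completion_iff)
  have h: "h \<in> borel_measurable \<nu>2" unfolding h_def by measurable
  \<comment> \<open>Change of variables through \<open>\<nu>2 = density ?D g\<close> and the image
    measure \<open>?D\<close>. The set \<open>B\<close> pulls back to \<open>A\<close> up to a null
    set, and a Borel version of \<open>\<phi>\<close> is used because densities and images are
    integrated over uncompleted \<open>\<nu>2\<close>.\<close>
  have change: "(\<integral>\<^sup>+\<eta>. \<phi> \<eta> * indicator B \<eta> \<partial>\<nu>2)
        = (\<integral>\<^sup>+\<zeta>. (ennreal (h (\<rho> \<zeta>)) * \<phi> (\<rho> \<zeta>)) * indicator A \<zeta> \<partial>\<nu>1)"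
    if \<phi>: "\<phi> \<in> borel_measurable (completion \<nu>2)" and A: "A \<in> sets \<nu>1" and B: "B \<in> sets \<nu>2"
      and AB: "\<forall>x\<in>space M - N. s2 x \<in> B \<longleftrightarrow> s1 x \<in> A" for \<phi> :: "'z \<Rightarrow> ennreal" and A B
  proof -
    obtain \<phi>' where \<phi>' [measurable]: "\<phi>' \<in> borel_measurable \<nu>2" and eq: "AE \<eta> in \<nu>2. \<phi> \<eta> = \<phi>' \<eta>"
      using completion_ex_borel_measurable[OF \<phi>] by blast
    have "(\<integral>\<^sup>+\<eta>. \<phi> \<eta> * indicator B \<eta> \<partial>\<nu>2) = (\<integral>\<^sup>+\<eta>. \<phi>' \<eta> * indicator B \<eta> \<partial>\<nu>2)"
      using eq by (intro nn_integral_cong_AE) (auto elim: AE_mp)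
    also have "\<dots> = (\<integral>\<^sup>+\<eta>. g \<eta> * (\<phi>' \<eta> * indicator B \<eta>) \<partial>?D)"
    proof -
      have "(\<integral>\<^sup>+\<eta>. \<phi>' \<eta> * indicator B \<eta> \<partial>density ?D g) = (\<integral>\<^sup>+\<eta>. g \<eta> * (\<phi>' \<eta> * indicator B \<eta>) \<partial>?D)"
        using B by (intro nn_integral_density g(1)) simp
      then show ?thesis unfolding g(2) .
    qed
    also have "\<dots> = (\<integral>\<^sup>+\<zeta>. g (\<rho> \<zeta>) * (\<phi>' (\<rho> \<zeta>) * indicator B (\<rho> \<zeta>)) \<partial>completion \<nu>1)"
      using B by (intro nn_integral_distr \<rho>_measurable) simp
    also have "\<dots> = (\<integral>\<^sup>+\<zeta>. (ennreal (h (\<rho> \<zeta>)) * \<phi> (\<rho> \<zeta>)) * indicator A \<zeta> \<partial>\<nu>1)"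
      unfolding nn_integral_completion
    proof (rule nn_integral_cong_AE)
      show "AE \<zeta> in \<nu>1. g (\<rho> \<zeta>) * (\<phi>' (\<rho> \<zeta>) * indicator B (\<rho> \<zeta>))
          = (ennreal (h (\<rho> \<zeta>)) * \<phi> (\<rho> \<zeta>)) * indicator A \<zeta>"
        using hg AE_\<rho>[OF eq] \<rho>_vimage_AE[OF AB]
        by eventually_elim (simp add: indicator_def)
    qed
    finally show ?thesis .
  qed
  show thesis
  proof
    show "h \<in> borel_measurable \<nu>2" by (rule h)
    show "0 < h \<eta>" for \<eta> by (auto simp: h_def enn2real_positive_iff less_top zero_less_iff_neq_zero)
    fix \<phi>1 :: "'y \<Rightarrow> ennreal" and \<phi>2 :: "'z \<Rightarrow> ennreal"
    assume \<phi>1: "\<phi>1 \<in> borel_measurable (completion \<nu>1)" and \<phi>2: "\<phi>2 \<in> borel_measurable (completion \<nu>2)"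
      and eq: "\<And>A B. \<lbrakk>A \<in> sets \<nu>1; B \<in> sets \<nu>2; \<forall>x\<in>space M - N. s2 x \<in> B \<longleftrightarrow> s1 x \<in> A\<rbrakk>
          \<Longrightarrow> (\<integral>\<^sup>+\<zeta>. \<phi>1 \<zeta> * indicator A \<zeta> \<partial>\<nu>1) = (\<integral>\<^sup>+\<eta>. \<phi>2 \<eta> * indicator B \<eta> \<partial>\<nu>2)"
    show "AE \<zeta> in \<nu>1. \<phi>1 \<zeta> = ennreal (h (\<rho> \<zeta>)) * \<phi>2 (\<rho> \<zeta>)"
    proof (rule completion_AE_eq_if_nn_integral_eq[OF p1.finite_measure_axioms \<phi>1])
      have "(\<lambda>\<zeta>. ennreal (h (\<rho> \<zeta>))) \<in> borel_measurable (completion \<nu>1)"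
        using measurable_compose[OF \<rho>_measurable h] by measurable
      then show "(\<lambda>\<zeta>. ennreal (h (\<rho> \<zeta>)) * \<phi>2 (\<rho> \<zeta>)) \<in> borel_measurable (completion \<nu>1)"
        using measurable_compose[OF \<rho>_measurable_completion \<phi>2] by (rule borel_measurable_times_ennreal)
      fix A assume A: "A \<in> sets \<nu>1"
      from push[OF A] obtain B where B: "B \<in> sets \<nu>2" "\<forall>x\<in>space M - N. s1 x \<in> A \<longleftrightarrow> s2 x \<in> B" by blast
      then have AB: "\<forall>x\<in>space M - N. s2 x \<in> B \<longleftrightarrow> s1 x \<in> A" by simp
      show "(\<integral>\<^sup>+\<zeta>. \<phi>1 \<zeta> * indicator A \<zeta> \<partial>\<nu>1)
          = (\<integral>\<^sup>+\<zeta>. (ennreal (h (\<rho> \<zeta>)) * \<phi>2 (\<rho> \<zeta>)) * indicator A \<zeta> \<partial>\<nu>1)"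
        using eq[OF A B(1) AB] change[OF \<phi>2 A B(1) AB] by (rule trans)
    qed
  qed
qed

end

section \<open>Uniqueness of the decomposition\<close>

text \<open>Local finiteness makes the basic open sets of finite measure a base; their finite
  intersections form a countable generator on which fibre measures can be compared with a single
  null set of indices.\<close>

lemma countable_finite_generator:
  assumes "second_countable T" and sets: "sets M = sets (borel_of T)" and radon: "radon_measure_space T M"
  obtains \<G> where "countable \<G>" "\<G> \<subseteq> sets M" "Int_stable \<G>" "sets M = sigma_sets (space M) \<G>"
    "\<Union>\<G> = space M" "\<And>G. G \<in> \<G> \<Longrightarrow> emeasure M G < \<infinity>"
proof -
  have sp: "space M = topspace T" using radon by (simp add: radon_measure_space_def)
  have sets_sigma: "sets M = sigma_sets (topspace T) {U. openin T U}"
    unfolding sets borel_of_def using openin_subset by (subst sets_measure_of) auto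
  have open_sets: "U \<in> sets M" if "openin T U" for U using that by (auto simp: sets_sigma)
  obtain \<B> where \<B>: "countable \<B>" "\<And>V. V \<in> \<B> \<Longrightarrow> openin T V"
    "\<And>U x. \<lbrakk>openin T U; x \<in> U\<rbrakk> \<Longrightarrow> \<exists>V\<in>\<B>. x \<in> V \<and> V \<subseteq> U"
    using assms(1) unfolding second_countable_def by metis
  define \<C> where "\<C> = {V \<in> \<B>. emeasure M V < \<infinity>}"
  \<comment> \<open>Empty families are excluded: their intersection would be the whole type.\<close>
  define \<G> where "\<G> = {\<Inter>S |S. finite S \<and> S \<noteq> {} \<and> S \<subseteq> \<C>}"
  have \<C>_\<G>: "\<C> \<subseteq> \<G>" by (auto simp: \<G>_def intro: exI[of _ "{V}" for V])
  have \<C>_open: "openin T V" if "V \<in> \<C>" for V using that \<B>(2) by (simp add: \<C>_def)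
  have base: "\<exists>V\<in>\<C>. x \<in> V \<and> V \<subseteq> U" if U: "openin T U" and x: "x \<in> U" for U x
  proof -
    have "x \<in> topspace T" using openin_subset[OF U] x by blast
    then obtain W where W: "openin T W" "x \<in> W" "emeasure (completion M) W < \<infinity>"
      using radon unfolding radon_measure_space_def by blast
    have "openin T (U \<inter> W)" "x \<in> U \<inter> W" using U W x by auto
    then obtain V where V: "V \<in> \<B>" "x \<in> V" "V \<subseteq> U \<inter> W" using \<B>(3) by blast
    have "emeasure M V \<le> emeasure M W" using V(3) open_sets[OF W(1)] by (intro emeasure_mono) auto
    also have "\<dots> < \<infinity>" using W(3) open_sets[OF W(1)] by simp
    finally show ?thesis using V by (auto simp: \<C>_def)
  qed
  have \<G>_open: "openin T G \<and> emeasure M G < \<infinity>" if "G \<in> \<G>" for G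
  proof -
    obtain S where S: "G = \<Inter>S" "finite S" "S \<noteq> {}" "S \<subseteq> \<C>" using \<open>G \<in> \<G>\<close> by (auto simp: \<G>_def)
    then obtain V where V: "V \<in> S" by blast
    have "emeasure M G \<le> emeasure M V"
      using S V open_sets[OF \<C>_open] by (intro emeasure_mono) auto
    also have "\<dots> < \<infinity>" using V S by (auto simp: \<C>_def)
    finally have "emeasure M G < \<infinity>" .
    moreover have "openin T G" unfolding S(1) using S \<C>_open by (intro openin_Inter) auto
    ultimately show ?thesis by simp
  qed
  show thesis
  proof
    have "\<G> \<subseteq> Inter ` {S. finite S \<and> S \<subseteq> \<C>}" by (auto simp: \<G>_def)
    moreover have "countable {S. finite S \<and> S \<subseteq> \<C>}"
      using \<B>(1) by (intro countable_Collect_finite_subset) (simp add: \<C>_def)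
    ultimately show "countable \<G>" using countable_image countable_subset by metis
    show \<G>_sets: "\<G> \<subseteq> sets M" using \<G>_open open_sets by (intro subsetI) simp
    show "Int_stable \<G>"
    proof (rule Int_stableI)
      fix G H assume "G \<in> \<G>" "H \<in> \<G>"
      then obtain S R where "G = \<Inter>S" "finite S" "S \<noteq> {}" "S \<subseteq> \<C>" "H = \<Inter>R" "finite R" "R \<noteq> {}" "R \<subseteq> \<C>"
        by (auto simp: \<G>_def)
      then show "G \<inter> H \<in> \<G>" unfolding \<G>_def by (intro CollectI exI[of _ "S \<union> R"]) (simp add: Inter_Un_distrib)
    qed
    show "\<Union>\<G> = space M"
    proof
      show "\<Union>\<G> \<subseteq> space M" unfolding sp by (intro Union_least openin_subset) (simp add: \<G>_open)
      have "space M \<subseteq> \<Union>\<C>" unfolding sp using base[OF openin_topspace] by auto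
      also have "\<dots> \<subseteq> \<Union>\<G>" using \<C>_\<G> by (rule Union_mono)
      finally show "space M \<subseteq> \<Union>\<G>" .
    qed
    show "sets M = sigma_sets (space M) \<G>"
    proof (intro equalityI)
      show "sigma_sets (space M) \<G> \<subseteq> sets M" using \<G>_sets by (rule sets.sigma_sets_subset)
      have "U \<in> sigma_sets (space M) \<G>" if U: "openin T U" for U
      proof -
        have "{V \<in> \<C>. V \<subseteq> U} \<subseteq> \<B>" by (auto simp: \<C>_def)
        then have "countable {V \<in> \<C>. V \<subseteq> U}" using \<B>(1) by (rule countable_subset)
        moreover have "V \<in> sigma_sets (space M) \<G>" if "V \<in> {V \<in> \<C>. V \<subseteq> U}" for V
          using \<C>_\<G> that by (intro sigma_sets.Basic) auto
        ultimately have "\<Union>{V \<in> \<C>. V \<subseteq> U} \<in> sigma_sets (space M) \<G>"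
          by (intro sigma_sets_UNION) auto
        moreover have "\<Union>{V \<in> \<C>. V \<subseteq> U} = U" using base[OF U] by auto
        ultimately show ?thesis by simp
      qed
      then show "sets M \<subseteq> sigma_sets (space M) \<G>"
        unfolding sets_sigma sp by (intro sigma_sets_mono) auto
    qed
    show "emeasure M G < \<infinity>" if "G \<in> \<G>" for G using \<G>_open[OF that] ..
  qed
qed

text \<open>For an index outside the image, the non-zero measure \<open>m \<zeta>\<close> would be
  concentrated on an empty part of its fibre. The image itself need not be measurable; the
  quantifier only asks for its complement to lie in a null set.\<close>

lemma (in decomposition) AE_image:
  assumes N: "N \<in> null_sets M"
  shows "AE \<zeta> in \<nu>. \<zeta> \<in> s ` (space M - N)"
proof -
  have "AE \<zeta> in \<nu>. AE x in m \<zeta>. x \<notin> N" using AE_not_in[OF N] by (rule AE_fibre_measures)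
  with AE_space AE_fibre show ?thesis
  proof eventually_elim
    case (elim \<zeta>)
    show ?case
    proof (rule ccontr)
      assume no: "\<zeta> \<notin> s ` (space M - N)"
      have "AE x in m \<zeta>. False"
        using elim(2,3) AE_space by eventually_elim (use no space_m[OF elim(1)] in auto)
      then show False
        using AE_E2[of "\<lambda>_. False" "m \<zeta>"] m_nonzero[OF elim(1)] space_m[OF elim(1)] by auto
    qed
  qed
qed

text \<open>Each generator of \<open>\<nu>2\<close> matches some set of \<open>\<nu>1\<close> up to
  a null set. Discarding the union of these countably many null sets makes the matches exact, and
  exact matches pass to complements and countable unions without further exceptions.\<close>

lemma decompositions_pull:
  assumes "decomposition M E \<nu>1 s1 m1 F1 SH1 SQ1 \<A>1" and "decomposition M E \<nu>2 s2 m2 F2 SH2 SQ2 \<A>2"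
  obtains N where "N \<in> null_sets M"
    "\<And>B. B \<in> sets \<nu>2 \<Longrightarrow> \<exists>A\<in>sets \<nu>1. \<forall>x\<in>space M - N. s2 x \<in> B \<longleftrightarrow> s1 x \<in> A"
proof -
  interpret d1: decomposition M E \<nu>1 s1 m1 F1 SH1 SQ1 \<A>1 by fact
  interpret d2: decomposition M E \<nu>2 s2 m2 F2 SH2 SQ2 \<A>2 by fact
  obtain \<G> where \<G>: "countable \<G>" "\<G> \<subseteq> Pow (space \<nu>2)" "sets \<nu>2 = sigma_sets (space \<nu>2) \<G>"
    using d2.countably_generated by (auto simp: countably_generated_measure_def)
  have "\<exists>A\<in>sets \<nu>1. AE x in M. s2 x \<in> B \<longleftrightarrow> s1 x \<in> A" if B: "B \<in> sets \<nu>2" for B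
  proof -
    have "s2 -` B \<inter> space M \<in> sets M" using d2.s_measurable B by (rule measurable_sets)
    \<comment> \<open>\<open>symmetry_set\<close> depends only on \<open>M\<close> and
      \<open>E\<close>, so a symmetry found in the second decomposition is one for the
      first.\<close>
    then obtain A where A: "A \<in> sets \<nu>1" "AE x in M. x \<in> s2 -` B \<inter> space M \<longleftrightarrow> s1 x \<in> A"
      using d2.vimage_symmetry[OF B] by (rule d1.invariant_set_vimage)
    have "AE x in M. s2 x \<in> B \<longleftrightarrow> s1 x \<in> A" using A(2) AE_space by eventually_elim auto
    with A(1) show ?thesis ..
  qed
  then obtain a where a: "\<And>B. B \<in> sets \<nu>2 \<Longrightarrow> a B \<in> sets \<nu>1"
    "\<And>B. B \<in> sets \<nu>2 \<Longrightarrow> AE x in M. s2 x \<in> B \<longleftrightarrow> s1 x \<in> a B" by metis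
  have \<G>_sets: "B \<in> sets \<nu>2" if "B \<in> \<G>" for B using that by (auto simp: \<G>(3))
  have "AE x in M. \<forall>B\<in>\<G>. s2 x \<in> B \<longleftrightarrow> s1 x \<in> a B"
    using \<G>(1) a(2) \<G>_sets by (simp add: AE_ball_countable)
  then obtain N where N: "{x \<in> space M. \<not> (\<forall>B\<in>\<G>. s2 x \<in> B \<longleftrightarrow> s1 x \<in> a B)} \<subseteq> N" "N \<in> null_sets M"
    by (auto simp: eventually_ae_filter)
  have "\<exists>A\<in>sets \<nu>1. \<forall>x\<in>space M - N. s2 x \<in> B \<longleftrightarrow> s1 x \<in> A" if "B \<in> sigma_sets (space \<nu>2) \<G>" for B
    using that
  proof (induction rule: sigma_sets.induct)
    case (Basic B)
    then show ?case using N(1) a(1)[OF \<G>_sets[OF Basic]] by (intro bexI[of _ "a B"]) auto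
  next
    case Empty
    then show ?case by (intro bexI[of _ "{}"]) auto
  next
    case (Compl B)
    then obtain A where "A \<in> sets \<nu>1" "\<forall>x\<in>space M - N. s2 x \<in> B \<longleftrightarrow> s1 x \<in> A" by blast
    then show ?case
      using measurable_space[OF d1.s_measurable] measurable_space[OF d2.s_measurable]
      by (intro bexI[of _ "space \<nu>1 - A"]) auto
  next
    case (Union B)
    then obtain A where "\<And>i. A i \<in> sets \<nu>1" "\<And>i. \<forall>x\<in>space M - N. s2 x \<in> B i \<longleftrightarrow> s1 x \<in> A i" by metis
    then show ?case by (intro bexI[of _ "\<Union>i::nat. A i"]) auto
  qed
  with N(2) show thesis using that \<G>(3) by blast
qed

lemma decompositions_common_factor:
  assumes 1: "decomposition M E \<nu>1 s1 m1 F1 SH1 SQ1 \<A>1" and 2: "decomposition M E \<nu>2 s2 m2 F2 SH2 SQ2 \<A>2"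
  obtains N where "common_factor M \<nu>1 \<nu>2 s1 s2 N"
proof -
  interpret d1: decomposition M E \<nu>1 s1 m1 F1 SH1 SQ1 \<A>1 by fact
  interpret d2: decomposition M E \<nu>2 s2 m2 F2 SH2 SQ2 \<A>2 by fact
  obtain K where K: "K \<in> null_sets M"
    "\<And>B. B \<in> sets \<nu>2 \<Longrightarrow> \<exists>A\<in>sets \<nu>1. \<forall>x\<in>space M - K. s2 x \<in> B \<longleftrightarrow> s1 x \<in> A"
    using decompositions_pull[OF 1 2] by blast
  obtain L where L: "L \<in> null_sets M"
    "\<And>A. A \<in> sets \<nu>1 \<Longrightarrow> \<exists>B\<in>sets \<nu>2. \<forall>x\<in>space M - L. s1 x \<in> A \<longleftrightarrow> s2 x \<in> B"
    using decompositions_pull[OF 2 1] by blast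
  have N: "K \<union> L \<in> null_sets M" using K(1) L(1) by (rule null_sets.Un)
  have "common_factor M \<nu>1 \<nu>2 s1 s2 (K \<union> L)"
  proof (intro common_factor.intro d1.prob d2.prob d1.singletons d2.singletons d1.s_measurable
      d2.s_measurable N d1.null_sets_vimage_iff d2.null_sets_vimage_iff d1.AE_image d2.AE_image)
    fix A assume "A \<in> sets \<nu>1"
    from L(2)[OF this] show "\<exists>B\<in>sets \<nu>2. \<forall>x\<in>space M - (K \<union> L). s1 x \<in> A \<longleftrightarrow> s2 x \<in> B" by blast
  next
    fix B assume "B \<in> sets \<nu>2"
    from K(2)[OF this] show "\<exists>A\<in>sets \<nu>1. \<forall>x\<in>space M - (K \<union> L). s2 x \<in> B \<longleftrightarrow> s1 x \<in> A" by blast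
  qed
  then show thesis by (rule that)
qed

text \<open>The identity on classes is conformal between the two spaces. Extension from
  \<open>f\<close>, with factor \<open>1 / c\<close>, puts the domain of \<open>F\<close> inside
  that of \<open>G\<close>; extension from \<open>g\<close>, with factor \<open>c\<close>, gives the
  reverse inclusion and the values.\<close>

lemma same_form_if_total:
  fixes M N :: "'x measure"
  assumes F: "closed_form_space (L2 M) F" and G: "closed_form_space (L2 N) G"
    and sets: "sets M = sets N" and c: "0 < c"
    and M: "\<And>A. A \<in> sets N \<Longrightarrow> emeasure M A = ennreal c * emeasure N A"
    and f: "htotal (form_space (L2 M) F) (range (\<lambda>n. lclass M (f n)))"
      "\<And>n. lclass N (f n) \<in> qdom (L2 N) G"
      "\<And>i j. qbil (L2 M) F (lclass M (f i)) (lclass M (f j)) = c * qbil (L2 N) G (lclass N (f i)) (lclass N (f j))"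
    and g: "htotal (form_space (L2 N) G) (range (\<lambda>n. lclass N (g n)))"
      "\<And>n. lclass M (g n) \<in> qdom (L2 M) F"
      "\<And>i j. qbil (L2 M) F (lclass M (g i)) (lclass M (g j)) = c * qbil (L2 N) G (lclass N (g i)) (lclass N (g j))"
  shows "same_form M F N (\<lambda>U. ennreal c * G U)"
proof -
  have ls: "lspace M = lspace N" using sets c M by (rule L2_proportional(1))
  have lc: "lclass M = lclass N" using sets c M by (rule L2_proportional(2))
  note eq = L2_carrier_proportional[OF lc ls]
  have cl: "lclass M h = lclass N h" for h using lc by (rule fun_cong)
  have lin: "hlinear (L2 M) (L2 N) (\<lambda>U. U)" "hlinear (L2 N) (L2 M) (\<lambda>U. U)"
    by (simp_all add: hlinear_def eq)
  have inner: "hinner (L2 M) U V = c * hinner (L2 N) U V" if UV: "U \<in> hcarrier (L2 N)" "V \<in> hcarrier (L2 N)" for U V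
  proof -
    obtain h k where hk: "h \<in> lspace N" "U = lclass N h" "k \<in> lspace N" "V = lclass N k"
      using UV by (auto elim!: L2_carrierE)
    have "hinner (L2 M) (lclass M h) (lclass M k) = c * hinner (L2 N) (lclass N h) (lclass N k)"
      using sets c M hk(1,3) by (rule L2_proportional(3))
    then show ?thesis by (simp only: hk(2,4) cl)
  qed
  have ext1: "U \<in> qdom (L2 N) G \<and> G U = ennreal (1 / c) * F U" if U: "U \<in> qdom (L2 M) F" for U
  proof (rule conformal_extension[OF F G lin(1) _ _ f(1) _ _ U])
    show "0 < 1 / c" using c by simp
    show "hinner (L2 N) V W = 1 / c * hinner (L2 M) V W" if "V \<in> hcarrier (L2 M)" "W \<in> hcarrier (L2 M)" for V W
      using inner[of V W] that c by (simp add: eq)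
    show "V \<in> qdom (L2 N) G" if "V \<in> range (\<lambda>n. lclass M (f n))" for V
      using that f(2) by (auto simp: cl)
    fix V W assume "V \<in> range (\<lambda>n. lclass M (f n))" "W \<in> range (\<lambda>n. lclass M (f n))"
    then obtain i j where "V = lclass M (f i)" "W = lclass M (f j)" by blast
    then show "qbil (L2 N) G V W = 1 / c * qbil (L2 M) F V W" using f(3)[of i j] c by (simp add: cl)
  qed
  have ext2: "U \<in> qdom (L2 M) F \<and> F U = ennreal c * G U" if U: "U \<in> qdom (L2 N) G" for U
  proof (rule conformal_extension[OF G F lin(2) c _ g(1) _ _ U])
    show "hinner (L2 M) V W = c * hinner (L2 N) V W" if "V \<in> hcarrier (L2 N)" "W \<in> hcarrier (L2 N)" for V W
      using that by (rule inner)
    show "V \<in> qdom (L2 M) F" if "V \<in> range (\<lambda>n. lclass N (g n))" for V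
      using that g(2) by (auto simp: cl)
    fix V W assume "V \<in> range (\<lambda>n. lclass N (g n))" "W \<in> range (\<lambda>n. lclass N (g n))"
    then obtain i j where "V = lclass N (g i)" "W = lclass N (g j)" by blast
    then show "qbil (L2 M) F V W = c * qbil (L2 N) G V W" using g(3)[of i j] by (simp add: cl)
  qed
  show ?thesis
    unfolding same_form_def
  proof (intro conjI ballI)
    show "hcarrier (L2 M) = hcarrier (L2 N)" by (rule eq)
    fix U assume U: "U \<in> hcarrier (L2 M)"
    show "F U = ennreal c * G U"
    proof (cases "U \<in> qdom (L2 N) G")
      case True then show ?thesis using ext2 by blast
    next
      case False
      \<comment> \<open>Outside the domain of \<open>G\<close> the first inclusion excludes the
        domain of \<open>F\<close>; positivity of \<open>c\<close> keeps the product
        infinite.\<close>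
      then have "G U = \<infinity>" "F U = \<infinity>" using ext1[of U] U by (auto simp: qdom_def eq simp flip: less_top)
      then show ?thesis using c by (simp add: ennreal_mult_top)
    qed
  qed
qed

theorem theorem4p4:
  fixes T :: "'x topology" and \<mu> :: "'x measure"
    and E :: "('x \<Rightarrow> real) set \<Rightarrow> ennreal"
    and \<nu>1 :: "'y measure" and s1 :: "'x \<Rightarrow> 'y"
    and \<mu>1 :: "'y \<Rightarrow> 'x measure" and E1 :: "'y \<Rightarrow> ('x \<Rightarrow> real) set \<Rightarrow> ennreal"
    and \<nu>2 :: "'z measure" and s2 :: "'x \<Rightarrow> 'z"
    and \<mu>2 :: "'z \<Rightarrow> 'x measure" and E2 :: "'z \<Rightarrow> ('x \<Rightarrow> real) set \<Rightarrow> ennreal"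
  assumes "locally_compact_space T" and "completely_metrizable_space T" and "second_countable T"
    and "sets \<mu> = sets (borel_of T)" and "radon_measure_space T \<mu>" and "full_support T \<mu>"
    and "regular_dirichlet_form T \<mu> E"
    and "ergodic_decomposition T \<mu> E \<nu>1 s1 \<mu>1 E1"
    and "ergodic_decomposition T \<mu> E \<nu>2 s2 \<mu>2 E2"
  shows "\<exists>(\<rho> :: 'y \<Rightarrow> 'z) (h :: 'z \<Rightarrow> real).
           almost_isomorphism \<nu>1 \<nu>2 \<rho> \<and>
           h \<in> borel_measurable \<nu>2 \<and> (\<forall>\<eta>\<in>space \<nu>2. 0 < h \<eta>) \<and>
           equivalent_measures (distr (completion \<nu>1) \<nu>2 \<rho>) \<nu>2 \<and>
           (AE \<zeta> in \<nu>1. same_form (\<mu>1 \<zeta>) (E1 \<zeta>)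
              (\<mu>2 (\<rho> \<zeta>)) (\<lambda>U. ennreal (h (\<rho> \<zeta>)) * E2 (\<rho> \<zeta>) U))"
proof -
  obtain SH1 SQ1 \<A>1 where dec1: "decomposition \<mu> E \<nu>1 s1 \<mu>1 E1 SH1 SQ1 \<A>1"
    using assms(8) by (rule ergodic_decompositionE)
  obtain SH2 SQ2 \<A>2 where dec2: "decomposition \<mu> E \<nu>2 s2 \<mu>2 E2 SH2 SQ2 \<A>2"
    using assms(9) by (rule ergodic_decompositionE)
  interpret d1: decomposition \<mu> E \<nu>1 s1 \<mu>1 E1 SH1 SQ1 \<A>1 by (rule dec1)
  interpret d2: decomposition \<mu> E \<nu>2 s2 \<mu>2 E2 SH2 SQ2 \<A>2 by (rule dec2)
  obtain N where cf: "common_factor \<mu> \<nu>1 \<nu>2 s1 s2 N" using dec1 dec2 by (rule decompositions_common_factor)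
  interpret cf: common_factor \<mu> \<nu>1 \<nu>2 s1 s2 N by (rule cf)
  let ?\<rho> = "cf.\<rho>"
  obtain h :: "'z \<Rightarrow> real" where h: "h \<in> borel_measurable \<nu>2" "\<And>\<eta>. 0 < h \<eta>"
    and scaled: "\<And>\<phi>1 \<phi>2. \<lbrakk>\<phi>1 \<in> borel_measurable (completion \<nu>1); \<phi>2 \<in> borel_measurable (completion \<nu>2);
        \<And>A B. \<lbrakk>A \<in> sets \<nu>1; B \<in> sets \<nu>2; \<forall>x\<in>space \<mu> - N. s2 x \<in> B \<longleftrightarrow> s1 x \<in> A\<rbrakk>
          \<Longrightarrow> (\<integral>\<^sup>+\<zeta>. \<phi>1 \<zeta> * indicator A \<zeta> \<partial>\<nu>1) = (\<integral>\<^sup>+\<eta>. \<phi>2 \<eta> * indicator B \<eta> \<partial>\<nu>2)\<rbrakk>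
      \<Longrightarrow> AE \<zeta> in \<nu>1. \<phi>1 \<zeta> = ennreal (h (?\<rho> \<zeta>)) * \<phi>2 (?\<rho> \<zeta>)"
    by (rule cf.density_function) blast
  obtain \<G> where \<G>: "countable \<G>" "\<G> \<subseteq> sets \<mu>" "Int_stable \<G>" "sets \<mu> = sigma_sets (space \<mu>) \<G>"
    "\<Union>\<G> = space \<mu>" "\<And>G. G \<in> \<G> \<Longrightarrow> emeasure \<mu> G < \<infinity>"
    using assms(3,4,5) by (rule countable_finite_generator) blast

  \<comment> \<open>For fixed \<open>G\<close>, both disintegrations return the measure of the same
    part of \<open>G\<close> over corresponding index sets, so \<open>scaled\<close> compares the
    densities.\<close>
  have measures: "AE \<zeta> in \<nu>1. \<forall>A\<in>sets \<mu>. emeasure (\<mu>1 \<zeta>) A = ennreal (h (?\<rho> \<zeta>)) * emeasure (\<mu>2 (?\<rho> \<zeta>)) A"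
  proof -
    have "AE \<zeta> in \<nu>1. emeasure (\<mu>1 \<zeta>) G = ennreal (h (?\<rho> \<zeta>)) * emeasure (\<mu>2 (?\<rho> \<zeta>)) G \<and> emeasure (\<mu>1 \<zeta>) G < \<infinity>"
      if G: "G \<in> \<G>" for G
    proof -
      have Gs: "G \<in> sets \<mu>" using \<G>(2) G by blast
      have "AE \<zeta> in \<nu>1. emeasure (\<mu>1 \<zeta>) G = ennreal (h (?\<rho> \<zeta>)) * emeasure (\<mu>2 (?\<rho> \<zeta>)) G"
      proof (rule scaled[OF d1.emeasure_m_measurable[OF Gs] d2.emeasure_m_measurable[OF Gs]])
        fix A B assume AB: "A \<in> sets \<nu>1" "B \<in> sets \<nu>2" "\<forall>x\<in>space \<mu> - N. s2 x \<in> B \<longleftrightarrow> s1 x \<in> A"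
        have "emeasure \<mu> (G \<inter> (s1 -` A \<inter> space \<mu>)) = emeasure \<mu> (G \<inter> (s2 -` B \<inter> space \<mu>))"
        proof (rule emeasure_eq_AE)
          show "AE x in \<mu>. x \<in> G \<inter> (s1 -` A \<inter> space \<mu>) \<longleftrightarrow> x \<in> G \<inter> (s2 -` B \<inter> space \<mu>)"
            using AE_space AE_not_in[OF cf.N] by eventually_elim (use AB(3) in auto)
        qed (use Gs measurable_sets[OF cf.s1 AB(1)] measurable_sets[OF cf.s2 AB(2)] in auto)
        then show "(\<integral>\<^sup>+\<zeta>. emeasure (\<mu>1 \<zeta>) G * indicator A \<zeta> \<partial>\<nu>1) = (\<integral>\<^sup>+\<eta>. emeasure (\<mu>2 \<eta>) G * indicator B \<eta> \<partial>\<nu>2)"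
          by (simp add: d1.emeasure_Int_eq[OF Gs AB(1)] d2.emeasure_Int_eq[OF Gs AB(2)])
      qed
      with d1.AE_emeasure_finite[OF Gs \<G>(6)[OF G]] show ?thesis by eventually_elim simp
    qed
    then have "AE \<zeta> in \<nu>1. \<forall>G\<in>\<G>. emeasure (\<mu>1 \<zeta>) G = ennreal (h (?\<rho> \<zeta>)) * emeasure (\<mu>2 (?\<rho> \<zeta>)) G \<and> emeasure (\<mu>1 \<zeta>) G < \<infinity>"
      using \<G>(1) by (simp add: AE_ball_countable)
    with AE_space show ?thesis
    proof eventually_elim
      case (elim \<zeta>)
      have s1: "sets (\<mu>1 \<zeta>) = sets \<mu>" and s2: "sets (\<mu>2 (?\<rho> \<zeta>)) = sets \<mu>"
        using elim(1) cf.\<rho>_space by (simp_all add: d1.sets_m d2.sets_m)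
      have "\<mu>1 \<zeta> = density (\<mu>2 (?\<rho> \<zeta>)) (\<lambda>_. ennreal (h (?\<rho> \<zeta>)))"
      \<comment> \<open>\<open>\<G>\<close> is used both as the generator and as the countable cover
        by sets of finite measure.\<close>
      proof (rule measure_eqI_generator_eq_countable[where E = \<G> and \<Omega> = "space \<mu>" and A = \<G>])
        show "\<G> \<subseteq> Pow (space \<mu>)" using \<G>(2) sets.space_closed[of \<mu>] by (rule order_trans)
        fix G assume G: "G \<in> \<G>"
        then have "G \<in> sets (\<mu>2 (?\<rho> \<zeta>))" using \<G>(2) s2 by blast
        then show "emeasure (\<mu>1 \<zeta>) G = emeasure (density (\<mu>2 (?\<rho> \<zeta>)) (\<lambda>_. ennreal (h (?\<rho> \<zeta>)))) G"
          using elim(2) G by (simp add: emeasure_density_const)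
        show "emeasure (\<mu>1 \<zeta>) G \<noteq> \<infinity>" using elim(2) G by auto
      qed (use \<G> s1 s2 in auto)
      then show ?case by (simp add: s2 emeasure_density_const)
    qed
  qed

  \<comment> \<open>\<open>d1.dom\<close> and \<open>d2.dom\<close> are one predicate of
    \<open>\<mu>\<close> and \<open>E\<close>. The same \<open>f\<close> can thus be cut along
    \<open>s1\<close> and along \<open>s2\<close>, and cuts by corresponding index sets give the
    same class.\<close>
  have energies: "AE \<zeta> in \<nu>1. d1.energy f \<zeta> = ennreal (h (?\<rho> \<zeta>)) * d2.energy f (?\<rho> \<zeta>)" if f: "d1.dom f" for f
  proof (rule scaled[OF d1.energy_measurable[OF f] d2.energy_measurable[OF f]])
    fix A B assume AB: "A \<in> sets \<nu>1" "B \<in> sets \<nu>2" "\<forall>x\<in>space \<mu> - N. s2 x \<in> B \<longleftrightarrow> s1 x \<in> A"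
    have "lclass \<mu> (\<lambda>x. indicator A (s1 x) * f x) = lclass \<mu> (\<lambda>x. indicator B (s2 x) * f x)"
    proof (rule lclass_eqI)
      show "AE x in \<mu>. indicator A (s1 x) * f x = indicator B (s2 x) * f x"
        using AE_space AE_not_in[OF cf.N] by eventually_elim (use AB(3) in \<open>auto simp: indicator_def\<close>)
    qed
    then show "(\<integral>\<^sup>+\<zeta>. d1.energy f \<zeta> * indicator A \<zeta> \<partial>\<nu>1) = (\<integral>\<^sup>+\<eta>. d2.energy f \<eta> * indicator B \<eta> \<partial>\<nu>2)"
      by (simp flip: d1.dom_cut(2)[OF f AB(1)] d2.dom_cut(2)[OF f AB(2)])
  qed

  have qbils: "AE \<zeta> in \<nu>1. \<forall>i j. qbil (L2 (\<mu>1 \<zeta>)) (E1 \<zeta>) (lclass (\<mu>1 \<zeta>) (f i)) (lclass (\<mu>1 \<zeta>) (f j)) =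
      h (?\<rho> \<zeta>) * qbil (L2 (\<mu>2 (?\<rho> \<zeta>))) (E2 (?\<rho> \<zeta>)) (lclass (\<mu>2 (?\<rho> \<zeta>)) (f i)) (lclass (\<mu>2 (?\<rho> \<zeta>)) (f j))"
    if f: "\<And>n. d1.dom (f n)" "\<And>i j. d1.dom (\<lambda>x. f i x + f j x)" "\<And>i j. d1.dom (\<lambda>x. f i x - f j x)"
    for f :: "nat \<Rightarrow> 'x \<Rightarrow> real"
    unfolding AE_all_countable
  proof (intro allI)
    fix i j
    show "AE \<zeta> in \<nu>1. qbil (L2 (\<mu>1 \<zeta>)) (E1 \<zeta>) (lclass (\<mu>1 \<zeta>) (f i)) (lclass (\<mu>1 \<zeta>) (f j)) =
      h (?\<rho> \<zeta>) * qbil (L2 (\<mu>2 (?\<rho> \<zeta>))) (E2 (?\<rho> \<zeta>)) (lclass (\<mu>2 (?\<rho> \<zeta>)) (f i)) (lclass (\<mu>2 (?\<rho> \<zeta>)) (f j))"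
      using d1.AE_qbil[OF f(1)[of i] f(1)[of j]] cf.AE_\<rho>[OF d2.AE_qbil[OF f(1)[of i] f(1)[of j]]]
        energies[OF f(2)[of i j]] energies[OF f(3)[of i j]]
    proof eventually_elim
      case (elim \<zeta>)
      show ?case
        unfolding elim(1,2) elim(3,4) using h(2)[of "?\<rho> \<zeta>"]
        by (simp add: enn2real_mult right_diff_distrib)
    qed
  qed

  have doms: "AE \<zeta> in \<nu>1. \<forall>n. lclass (\<mu>1 \<zeta>) (f n) \<in> qdom (L2 (\<mu>1 \<zeta>)) (E1 \<zeta>) \<and>
      lclass (\<mu>2 (?\<rho> \<zeta>)) (f n) \<in> qdom (L2 (\<mu>2 (?\<rho> \<zeta>))) (E2 (?\<rho> \<zeta>))"
    if f: "\<And>n. d1.dom (f n)" for f :: "nat \<Rightarrow> 'x \<Rightarrow> real"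
    unfolding AE_all_countable
  proof
    fix n
    show "AE \<zeta> in \<nu>1. lclass (\<mu>1 \<zeta>) (f n) \<in> qdom (L2 (\<mu>1 \<zeta>)) (E1 \<zeta>) \<and>
        lclass (\<mu>2 (?\<rho> \<zeta>)) (f n) \<in> qdom (L2 (\<mu>2 (?\<rho> \<zeta>))) (E2 (?\<rho> \<zeta>))"
      using d1.AE_dom[OF f[of n]] cf.AE_\<rho>[OF d2.AE_dom[OF f[of n]]] by eventually_elim simp
  qed

  \<comment> \<open>Totality of \<open>f\<close> is known only for the domains of the first
    decomposition and totality of \<open>g\<close> only for those of the second, so each sequence
    yields one inclusion of domains.\<close>
  obtain f :: "nat \<Rightarrow> 'x \<Rightarrow> real" where f: "range f \<subseteq> \<A>1"
    and f_total: "AE \<zeta> in \<nu>1. htotal (form_space (L2 (\<mu>1 \<zeta>)) (E1 \<zeta>)) (range (\<lambda>n. lclass (\<mu>1 \<zeta>) (f n)))"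
    by (rule d1.total_sequence)
  obtain g :: "nat \<Rightarrow> 'x \<Rightarrow> real" where g: "range g \<subseteq> \<A>2"
    and g_total: "AE \<eta> in \<nu>2. htotal (form_space (L2 (\<mu>2 \<eta>)) (E2 \<eta>)) (range (\<lambda>n. lclass (\<mu>2 \<eta>) (g n)))"
    by (rule d2.total_sequence)
  have "f n \<in> \<A>1" "g n \<in> \<A>2" for n using f g by auto
  note fd = d1.dom_add[OF this(1) this(1)] and gd = d2.dom_add[OF this(2) this(2)]
  have "AE \<zeta> in \<nu>1. same_form (\<mu>1 \<zeta>) (E1 \<zeta>) (\<mu>2 (?\<rho> \<zeta>)) (\<lambda>U. ennreal (h (?\<rho> \<zeta>)) * E2 (?\<rho> \<zeta>) U)"
    using AE_space measures f_total cf.AE_\<rho>[OF g_total] doms[of f, OF fd(1)] doms[of g, OF gd(1)]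
      qbils[of f, OF fd] qbils[of g, OF gd]
  proof eventually_elim
    case (elim \<zeta>)
    have \<eta>: "?\<rho> \<zeta> \<in> space \<nu>2" by (rule cf.\<rho>_space)
    show ?case
    proof (rule same_form_if_total[where f = f and g = g])
      show "closed_form_space (L2 (\<mu>1 \<zeta>)) (E1 \<zeta>)" using elim(1) by (rule d1.closed_form_space)
      show "closed_form_space (L2 (\<mu>2 (?\<rho> \<zeta>))) (E2 (?\<rho> \<zeta>))" using \<eta> by (rule d2.closed_form_space)
      show "sets (\<mu>1 \<zeta>) = sets (\<mu>2 (?\<rho> \<zeta>))" using elim(1) \<eta> by (simp add: d1.sets_m d2.sets_m)
      show "0 < h (?\<rho> \<zeta>)" by (rule h)
      show "emeasure (\<mu>1 \<zeta>) A = ennreal (h (?\<rho> \<zeta>)) * emeasure (\<mu>2 (?\<rho> \<zeta>)) A" if "A \<in> sets (\<mu>2 (?\<rho> \<zeta>))" for A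
        using elim(2) that \<eta> by (simp add: d2.sets_m)
    next
      fix i j n
      show "lclass (\<mu>2 (?\<rho> \<zeta>)) (f n) \<in> qdom (L2 (\<mu>2 (?\<rho> \<zeta>))) (E2 (?\<rho> \<zeta>))" using elim(5) by simp
      show "lclass (\<mu>1 \<zeta>) (g n) \<in> qdom (L2 (\<mu>1 \<zeta>)) (E1 \<zeta>)" using elim(6) by simp
      show "qbil (L2 (\<mu>1 \<zeta>)) (E1 \<zeta>) (lclass (\<mu>1 \<zeta>) (f i)) (lclass (\<mu>1 \<zeta>) (f j)) =
          h (?\<rho> \<zeta>) * qbil (L2 (\<mu>2 (?\<rho> \<zeta>))) (E2 (?\<rho> \<zeta>)) (lclass (\<mu>2 (?\<rho> \<zeta>)) (f i)) (lclass (\<mu>2 (?\<rho> \<zeta>)) (f j))"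
        using elim(7) by (elim allE)
      show "qbil (L2 (\<mu>1 \<zeta>)) (E1 \<zeta>) (lclass (\<mu>1 \<zeta>) (g i)) (lclass (\<mu>1 \<zeta>) (g j)) =
          h (?\<rho> \<zeta>) * qbil (L2 (\<mu>2 (?\<rho> \<zeta>))) (E2 (?\<rho> \<zeta>)) (lclass (\<mu>2 (?\<rho> \<zeta>)) (g i)) (lclass (\<mu>2 (?\<rho> \<zeta>)) (g j))"
        using elim(8) by (elim allE)
    qed (rule elim(3), rule elim(4))
  qed
  then show ?thesis
    using cf.\<rho>_almost_isomorphism cf.equivalent h by (intro exI[of _ ?\<rho>] exI[of _ h]) simp
qed

end
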